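(* Let $\eta$ have state space $\{0,1\}$, let $\varepsilon\in\mathbb R$, and let $\theta_0(0)=\theta_1(0)=0$. Assume: (1) $Z$ is independent of $\eta$, the $Z_t$ are i.i.d., and for each $\vartheta\in\Theta$, $t\in\mathbb Z$, $\varphi(Z_t,\vartheta)$ has a density $f(x,\vartheta)$; (2) $\eta$ is a Markov chain and there are $\kappa\ge 1$, $\phi_*>0$ such that $\Pr\{\eta_t=b\mid\eta_s=a\}\ge\phi_*$ for all $a,b\in\{0,1\}$ and $s,t\in\mathbb Z$ with $|s-t|\ge\kappa$; (3) for each $z\in\mathcal Z$, $a,b\in\{0,1\}$, $0<f(\varphi(z,\theta_a(\varepsilon)),\theta_b(\varepsilon))<\infty$ and this is continuous in $\varepsilon$; (4) there is an integer $q\ge2$ such that for each $z\in\mathcal Z$, $a,b\in\{0,1\}$, $f(\varphi(z,\theta_a(\varepsilon)),\theta_b(\varepsilon))$ as a function of $\varepsilon$ belongs to $C^{(q)}$ and all its derivatives of order $\le q$ are continuous in $(z,\varepsilon)$; furthermore, for every $r>0$ there is $c=c(r)>2$ such that $\Pr\{M_q(Z_0,r)\ge u\}=O((\log u)^{-c})$ as $u\to\infty$. Then, almost surely, $$\mathsf r'(0)=\sum_{t=1}^\infty D_{0t}\,d_t'(0),$$ $$\mathsf r''(0)=\sum_{t=1}^\infty D_{0t}\bigl\{d_t''(0)+[P_{0t}(1,0)-P_{0t}(0,1)][d_t'(0)]^2\bigr\}+2\sum_{t=1}^\infty D_{0t}\,d_t'(0)\sum_{s=1}^{t-1}[P_{0s}(1,0)-P_{0s}(0,1)]\,d_s'(0),$$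 where primes denote differentiation with respect to $\varepsilon$.
   Context: Model: $\eta=(\eta_t)_{t\in\mathbb Z}$ is a $\{0,1\}$-valued process; $Z=(Z_t)_{t\in\mathbb Z}$ takes values in a Euclidean space $\mathcal Z$; $\Theta\subset\mathbb R^d$ is open; $\varphi(\cdot,\vartheta):\mathcal Z\to\mathcal X$, $\vartheta\in\Theta$, is a family of maps into a Euclidean space $\mathcal X$; $\theta_0,\theta_1:\mathbb R\to\Theta$ are functions. $C^{(q)}$ denotes functions whose derivatives up to order $q$ exist and are continuous. Derivatives of random functions of $\varepsilon$ are taken in $\varepsilon$ with the realization of $(\eta,Z)$ fixed. With $\ell_{z,ab}(\varepsilon)=\ln f(\varphi(z,\theta_a(\varepsilon)),\theta_b(\varepsilon))$, $M_k(z,r)=\sup\{|\ell_{z,ab}^{(j)}(\varepsilon)|:1\le j\le k,\ |\varepsilon|\le r,\ a,b\in\{0,1\}\}$ for $k>0$. $P_{st}(a,b)=\Pr\{\eta_t=b\mid\eta_s=a\}$ and $D_{st}=P_{st}(1,1)-P_{st}(0,1)$. $\psi_t(\varepsilon,c)=f(\varphi(Z_t,\theta_{\eta_t}(\varepsilon)),\theta_c(\varepsilon))$ for $c\in\{0,1\}$, and $d_t(\varepsilon)=\ln\psi_t(\varepsilon,1)-\ln\psi_t(\varepsilon,0)$. Let $\sigma=(\sigma_t)$ be an independent copy of $\eta$, also independent of $Z$, and $\mathsf E_\sigma$ expectation with respect to $\sigma$ ($\eta,Z$ held fixed). Then $$\mathsf r(\varepsilon)=\lim_{n\to\infty}\ln\frac{\mathsf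 E_\sigma[\prod_{s=1}^n\psi_s(\varepsilon,\sigma_s)\mid\sigma_0=1]}{\mathsf E_\sigma[\prod_{s=1}^n\psi_s(\varepsilon,\sigma_s)\mid\sigma_0=0]}$$ (an almost sure limit, which exists). *)

theory Defs
  imports "HOL-Probability.Probability" "HOL-Library.Landau_Symbols"
begin

text \<open>
  \<open>indep_var\<close> of the library wants both random variables to have values in the same type;
  this is the same notion for values in two different types.
\<close>

definition indep_elements ::
  "'w measure \<Rightarrow> 'a measure \<Rightarrow> ('w \<Rightarrow> 'a) \<Rightarrow> 'b measure \<Rightarrow> ('w \<Rightarrow> 'b) \<Rightarrow> bool"
  where "indep_elements M S X T Y \<longleftrightarrow>
    X \<in> measurable M S \<and> Y \<in> measurable M T \<and>
    prob_space.indep_set M {X -` A \<inter> space M | A. A \<in> sets S} {Y -` B \<inter> space M | B. B \<in> sets T}"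

text \<open>
  Discrete-valued Markov chain indexed by all integers; the transition probabilities may depend
  on time.
\<close>

definition markov_chain :: "'w measure \<Rightarrow> (int \<Rightarrow> 'w \<Rightarrow> 's) \<Rightarrow> bool" where
  "markov_chain M X \<longleftrightarrow>
     (\<forall>(t::int) (n::nat) (x :: int \<Rightarrow> 's).
        \<P>(\<omega> in M. \<forall>i\<in>{t - int n..t}. X i \<omega> = x i) > 0 \<longrightarrow>
        \<P>(\<omega> in M. X (t + 1) \<omega> = x (t + 1) \<bar> \<forall>i\<in>{t - int n..t}. X i \<omega> = x i)
          = \<P>(\<omega> in M. X (t + 1) \<omega> = x (t + 1) \<bar> X t \<omega> = x t))"

definition C_upto :: "nat \<Rightarrow> (real \<Rightarrow> real) \<Rightarrow> bool" where
  "C_upto q g \<longleftrightarrow>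
     (\<forall>j<q. \<forall>x. (deriv ^^ j) g differentiable at x) \<and>
     (\<forall>j\<le>q. continuous_on UNIV ((deriv ^^ j) g))"

text \<open>
  In the following, \<open>f x p\<close> is the density of the signal \<open>\<phi>(Z\<^sub>t, p)\<close> at \<open>x\<close> and \<open>\<theta> a\<close>, for
  \<open>a \<in> {0, 1}\<close>, is the parameter curve belonging to state \<open>a\<close>.
\<close>

definition dens ::
  "('x \<Rightarrow> 'p \<Rightarrow> ennreal) \<Rightarrow> ('z \<Rightarrow> 'p \<Rightarrow> 'x) \<Rightarrow> (nat \<Rightarrow> real \<Rightarrow> 'p) \<Rightarrow> 'z \<Rightarrow> nat \<Rightarrow> nat \<Rightarrow> real \<Rightarrow> ennreal"
  where "dens f \<phi> \<theta> z a b \<epsilon> = f (\<phi> z (\<theta> a \<epsilon>)) (\<theta> b \<epsilon>)"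

definition rdens ::
  "('x \<Rightarrow> 'p \<Rightarrow> ennreal) \<Rightarrow> ('z \<Rightarrow> 'p \<Rightarrow> 'x) \<Rightarrow> (nat \<Rightarrow> real \<Rightarrow> 'p) \<Rightarrow> 'z \<Rightarrow> nat \<Rightarrow> nat \<Rightarrow> real \<Rightarrow> real"
  where "rdens f \<phi> \<theta> z a b \<epsilon> = enn2real (dens f \<phi> \<theta> z a b \<epsilon>)"

definition logdens ::
  "('x \<Rightarrow> 'p \<Rightarrow> ennreal) \<Rightarrow> ('z \<Rightarrow> 'p \<Rightarrow> 'x) \<Rightarrow> (nat \<Rightarrow> real \<Rightarrow> 'p) \<Rightarrow> 'z \<Rightarrow> nat \<Rightarrow> nat \<Rightarrow> real \<Rightarrow> real"
  where "logdens f \<phi> \<theta> z a b \<epsilon> = ln (rdens f \<phi> \<theta> z a b \<epsilon>)"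

text \<open>
  The supremum is a real one; the set is bounded whenever the derivatives of \<open>logdens\<close> of order
  at most \<open>k\<close> are continuous.
\<close>

definition Msup ::
  "('x \<Rightarrow> 'p \<Rightarrow> ennreal) \<Rightarrow> ('z \<Rightarrow> 'p \<Rightarrow> 'x) \<Rightarrow> (nat \<Rightarrow> real \<Rightarrow> 'p) \<Rightarrow> nat \<Rightarrow> 'z \<Rightarrow> real \<Rightarrow> real"
  where "Msup f \<phi> \<theta> k z r =
    Sup {\<bar>(deriv ^^ j) (logdens f \<phi> \<theta> z a b) \<epsilon>\<bar> | j \<epsilon> a b.
           1 \<le> j \<and> j \<le> k \<and> \<bar>\<epsilon>\<bar> \<le> r \<and> a \<in> {0, 1} \<and> b \<in> {0, 1}}"

definition trans_prob :: "'w measure \<Rightarrow> (int \<Rightarrow> 'w \<Rightarrow> nat) \<Rightarrow> int \<Rightarrow> int \<Rightarrow> nat \<Rightarrow> nat \<Rightarrow> real" where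
  "trans_prob M \<eta> s t a b = \<P>(\<omega> in M. \<eta> t \<omega> = b \<bar> \<eta> s \<omega> = a)"

definition trans_diff :: "'w measure \<Rightarrow> (int \<Rightarrow> 'w \<Rightarrow> nat) \<Rightarrow> int \<Rightarrow> int \<Rightarrow> real" where
  "trans_diff M \<eta> s t = trans_prob M \<eta> s t 1 1 - trans_prob M \<eta> s t 0 1"

text \<open>
  Below, \<open>h :: int \<Rightarrow> nat\<close> and \<open>z :: int \<Rightarrow> 'z\<close> stand for one realization (a pair of sample paths)
  of \<open>\<eta>\<close> and \<open>Z\<close>; it is held fixed in all derivatives and in the expectation over \<open>\<sigma>\<close>.
\<close>

definition psi ::
  "('x \<Rightarrow> 'p \<Rightarrow> ennreal) \<Rightarrow> ('z \<Rightarrow> 'p \<Rightarrow> 'x) \<Rightarrow> (nat \<Rightarrow> real \<Rightarrow> 'p) \<Rightarrow>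
   (int \<Rightarrow> nat) \<Rightarrow> (int \<Rightarrow> 'z) \<Rightarrow> int \<Rightarrow> real \<Rightarrow> nat \<Rightarrow> real"
  where "psi f \<phi> \<theta> h z t \<epsilon> c = rdens f \<phi> \<theta> (z t) (h t) c \<epsilon>"

definition dlog ::
  "('x \<Rightarrow> 'p \<Rightarrow> ennreal) \<Rightarrow> ('z \<Rightarrow> 'p \<Rightarrow> 'x) \<Rightarrow> (nat \<Rightarrow> real \<Rightarrow> 'p) \<Rightarrow>
   (int \<Rightarrow> nat) \<Rightarrow> (int \<Rightarrow> 'z) \<Rightarrow> int \<Rightarrow> real \<Rightarrow> real"
  where "dlog f \<phi> \<theta> h z t \<epsilon> = ln (psi f \<phi> \<theta> h z t \<epsilon> 1) - ln (psi f \<phi> \<theta> h z t \<epsilon> 0)"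

text \<open>
  \<open>uniform_measure M A\<close> is \<open>M\<close> conditioned on the event \<open>A\<close>. Only \<open>\<sigma>\<close> is integrated out here,
  so this is the expectation with respect to \<open>\<sigma>\<close>, given \<open>\<sigma>\<^sub>0 = c\<close>, for fixed \<open>(h, z)\<close>.
\<close>

definition cond_lik ::
  "'w measure \<Rightarrow> (int \<Rightarrow> 'w \<Rightarrow> nat) \<Rightarrow>
   ('x \<Rightarrow> 'p \<Rightarrow> ennreal) \<Rightarrow> ('z \<Rightarrow> 'p \<Rightarrow> 'x) \<Rightarrow> (nat \<Rightarrow> real \<Rightarrow> 'p) \<Rightarrow>
   (int \<Rightarrow> nat) \<Rightarrow> (int \<Rightarrow> 'z) \<Rightarrow> nat \<Rightarrow> real \<Rightarrow> nat \<Rightarrow> real"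
  where "cond_lik M \<sigma> f \<phi> \<theta> h z n \<epsilon> c =
    (\<integral>\<omega>. (\<Prod>s = 1..int n. psi f \<phi> \<theta> h z s \<epsilon> (\<sigma> s \<omega>)) \<partial>uniform_measure M {\<omega> \<in> space M. \<sigma> 0 \<omega> = c})"

definition log_lik_ratio ::
  "'w measure \<Rightarrow> (int \<Rightarrow> 'w \<Rightarrow> nat) \<Rightarrow>
   ('x \<Rightarrow> 'p \<Rightarrow> ennreal) \<Rightarrow> ('z \<Rightarrow> 'p \<Rightarrow> 'x) \<Rightarrow> (nat \<Rightarrow> real \<Rightarrow> 'p) \<Rightarrow>
   (int \<Rightarrow> nat) \<Rightarrow> (int \<Rightarrow> 'z) \<Rightarrow> nat \<Rightarrow> real \<Rightarrow> real"
  where "log_lik_ratio M \<sigma> f \<phi> \<theta> h z n \<epsilon> =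
    ln (cond_lik M \<sigma> f \<phi> \<theta> h z n \<epsilon> 1 / cond_lik M \<sigma> f \<phi> \<theta> h z n \<epsilon> 0)"

definition r_lim ::
  "'w measure \<Rightarrow> (int \<Rightarrow> 'w \<Rightarrow> nat) \<Rightarrow>
   ('x \<Rightarrow> 'p \<Rightarrow> ennreal) \<Rightarrow> ('z \<Rightarrow> 'p \<Rightarrow> 'x) \<Rightarrow> (nat \<Rightarrow> real \<Rightarrow> 'p) \<Rightarrow>
   (int \<Rightarrow> nat) \<Rightarrow> (int \<Rightarrow> 'z) \<Rightarrow> real \<Rightarrow> real"
  where "r_lim M \<sigma> f \<phi> \<theta> h z \<epsilon> = lim (\<lambda>n. log_lik_ratio M \<sigma> f \<phi> \<theta> h z n \<epsilon>)"

end

theory Submission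
  imports Defs
begin

text \<open>
  The common factors \<open>\<psi>\<^sub>t(\<epsilon>, 0)\<close> cancel in the likelihood ratio, so that with weights \<open>exp (d\<^sub>t(\<epsilon>) \<sigma>\<^sub>t)\<close>
  the likelihoods given \<open>\<sigma>\<^sub>0 = 1\<close> and \<open>\<sigma>\<^sub>0 = 0\<close> follow from a backward recursion with \<open>2 \<times> 2\<close> matrices.
  Only the logarithm of the quotient of the two components matters. It obeys the scalar recursion
  \<open>x\<^sub>t\<^sub>-\<^sub>1 = step\<^sub>t (d\<^sub>t + x\<^sub>t)\<close> with terminal value \<open>x\<^sub>n = 0\<close> (\<open>traj_eq_ln_lik\<close>, \<open>integral_uniform_measure_eq_lik\<close>),
  where \<open>step\<^sub>t\<close> is a difference of two functions \<open>ln (1 - a + a exp y)\<close>. Its slope lies in \<open>[-1, 1]\<close>, and its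
  second and third derivatives are the slope times bounded factors.

  Passing from \<open>n - 1\<close> to \<open>n\<close> observations means switching on \<open>d\<^sub>n\<close>. With \<open>d\<^sub>n\<close> replaced by \<open>s d\<^sub>n\<close>, the
  increment of the log-likelihood ratio is the integral over \<open>s \<in> [0, 1]\<close> of \<open>\<Pi>\<^sub>n d\<^sub>n\<close>, where \<open>\<Pi>\<^sub>n\<close> is the product of
  the slopes along the trajectory (\<open>increment\<close>). The first two \<open>\<epsilon>\<close>-derivatives of \<open>\<Pi>\<^sub>n\<close> are \<open>\<Pi>\<^sub>n\<close> times
  quantities that are polynomial in \<open>n\<close> and in bounds on \<open>d\<^sub>1', d\<^sub>1'', ..., d\<^sub>n', d\<^sub>n''\<close>. Hence, if \<open>\<Pi>\<^sub>n\<close> decays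
  exponentially while the derivatives of \<open>d\<^sub>n\<close> grow at a smaller exponential rate, the limit may be differentiated
  twice term by term (\<open>limit_derivatives\<close>). At \<open>\<epsilon> = 0\<close> all \<open>d\<^sub>t\<close> vanish, the product \<open>\<Pi>\<^sub>n\<close> becomes \<open>D\<^sub>0\<^sub>n\<close>, and the
  \<open>n\<close>-th terms become exactly the \<open>n\<close>-th terms of the two claimed series.

  Both rates hold almost surely. A block of \<open>\<kappa>\<close> steps in which all \<open>d\<^sub>t\<close> are bounded is a fractional linear map
  with a matrix whose entries lie between two positive constants, and so its slope is bounded by some \<open>c < 1\<close>
  (\<open>gain_contraction\<close>). Blocks are good in this sense independently and with the same positive probability,
  so by the Markov inequality and the Borel-Cantelli lemma the product of the block factors decays
  exponentially (\<open>AE_block_product_decay\<close>). The tail assumption gives, again by Borel-Cantelli, that the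
  suprema \<open>M\<^sub>q(Z\<^sub>t, r)\<close> are eventually below \<open>exp (\<gamma> t)\<close> for each \<open>\<gamma> > 0\<close> (\<open>AE_eventually_less_exp\<close>).
\<close>

section \<open>Log-odds of two-state mixtures\<close>

text \<open>
  The probability of state 1 after reweighting a Bernoulli law with parameter \<open>a\<close> by \<open>exp y\<close> on state 1. It
  is the derivative of \<open>ln (1 - a + a exp y)\<close>, and \<open>a\<close> itself at \<open>y = 0\<close>.
\<close>

definition tilt :: "real \<Rightarrow> real \<Rightarrow> real" where
  "tilt a y = a * exp y / (1 - a + a * exp y)"

lemma mix_exp_pos:
  fixes a y :: real
  assumes "0 \<le> a" "a \<le> 1"
  shows "0 < 1 - a + a * exp y"
proof (cases "a = 0")
  case False
  with assms have "0 < a * exp y" by simp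
  with assms show ?thesis by linarith
qed simp

lemma tilt_bounds:
  assumes "0 \<le> a" "a \<le> 1"
  shows "0 \<le> tilt a y" "tilt a y \<le> 1"
  using mix_exp_pos[OF assms, of y] assms by (auto simp: tilt_def divide_simps)

lemma tilt_0 [simp]: "tilt a 0 = a"
  by (simp add: tilt_def)

lemma ln_mix_exp_deriv [derivative_intros]:
  assumes "0 \<le> a" "a \<le> 1" and g: "(g has_real_derivative g') (at x within S)"
  shows "((\<lambda>x. ln (1 - a + a * exp (g x))) has_real_derivative tilt a (g x) * g') (at x within S)"
  unfolding tilt_def using mix_exp_pos[OF assms(1,2), of "g x"]
  by (auto intro!: derivative_eq_intros g simp: field_simps)

lemma tilt_deriv [derivative_intros]:
  assumes "0 \<le> a" "a \<le> 1" and g: "(g has_real_derivative g') (at x within S)"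
  shows "((\<lambda>x. tilt a (g x)) has_real_derivative tilt a (g x) * (1 - tilt a (g x)) * g') (at x within S)"
  unfolding tilt_def using mix_exp_pos[OF assms(1,2), of "g x"]
  apply (auto intro!: derivative_eq_intros g)
  apply (simp add: divide_simps)
  apply (simp add: algebra_simps)
  done

lemma tilt_continuous [continuous_intros]:
  assumes "0 \<le> a" "a \<le> 1" and "continuous_on S g"
  shows "continuous_on S (\<lambda>x. tilt a (g x))"
  unfolding tilt_def using mix_exp_pos[OF assms(1,2)] assms(3)
  by (auto intro!: continuous_intros simp: less_imp_neq[THEN not_sym])

text \<open>
  With \<open>w = exp y\<close>, the difference is \<open>(W\<^sub>1 N\<^sub>0 - W\<^sub>0 N\<^sub>1) w\<close> over a denominator that is at least
  \<open>(W\<^sub>1 N\<^sub>0 + W\<^sub>0 N\<^sub>1) w\<close>. Both products lie in \<open>[m\<^sup>2, K\<^sup>2]\<close>, so the quotient of their difference and their sum stays away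
  from 1, uniformly in \<open>y\<close>.
\<close>

lemma moebius_deriv_bound:
  fixes m K N0 N1 W0 W1 y :: real
  assumes "0 < m"
    and "m \<le> N0" "m \<le> N1" "m \<le> W0" "m \<le> W1" "N0 \<le> K" "N1 \<le> K" "W0 \<le> K" "W1 \<le> K"
  shows "\<bar>W1 * exp y / (N1 + W1 * exp y) - W0 * exp y / (N0 + W0 * exp y)\<bar> \<le> 1 - m\<^sup>2 / K\<^sup>2"
proof -
  define w where "w = exp y"
  have w: "w > 0" by (simp add: w_def)
  have pos: "0 < N0" "0 < N1" "0 < W0" "0 < W1" "0 < K" using assms by linarith+
  have den: "0 < N1 + W1 * w" "0 < N0 + W0 * w" using pos w by (auto intro: add_pos_pos)
  have diff: "W1 * w / (N1 + W1 * w) - W0 * w / (N0 + W0 * w) =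
      (W1 * N0 - W0 * N1) * w / ((N1 + W1 * w) * (N0 + W0 * w))"
    using den by (simp add: divide_simps) (simp add: algebra_simps)
  have lo: "m\<^sup>2 \<le> W1 * N0" "m\<^sup>2 \<le> W0 * N1"
    using assms pos by (auto simp: power2_eq_square intro!: mult_mono)
  have hi: "W1 * N0 \<le> K\<^sup>2" "W0 * N1 \<le> K\<^sup>2"
    using assms pos by (auto simp: power2_eq_square intro!: mult_mono)
  define P where "P = W1 * N0" define R where "R = W0 * N1"
  have PR: "m\<^sup>2 \<le> P" "m\<^sup>2 \<le> R" "P \<le> K\<^sup>2" "R \<le> K\<^sup>2" using lo hi by (auto simp: P_def R_def)
  have m2: "0 < m\<^sup>2" "0 < K\<^sup>2" using assms pos by auto
  \<comment> \<open>The smaller of the two products is at least \<open>m\<^sup>2\<close>, hence at least \<open>m\<^sup>2 / K\<^sup>2\<close> times their mean.\<close>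
  have *: "\<bar>P - R\<bar> \<le> (1 - m\<^sup>2 / K\<^sup>2) * (P + R)"
  proof -
    have "m\<^sup>2 / K\<^sup>2 * P \<le> m\<^sup>2" "m\<^sup>2 / K\<^sup>2 * R \<le> m\<^sup>2"
      using PR m2 by (auto simp: divide_simps mult_left_mono)
    then have "m\<^sup>2 / K\<^sup>2 * (P + R) \<le> 2 * m\<^sup>2" by (simp add: distrib_left)
    then show ?thesis using PR by (auto simp: algebra_simps abs_if)
  qed
  have "\<bar>(P - R) * w / ((N1 + W1 * w) * (N0 + W0 * w))\<bar>
      = \<bar>P - R\<bar> * w / ((N1 + W1 * w) * (N0 + W0 * w))"
    using w den by (simp add: abs_mult)
  also have "\<dots> \<le> (1 - m\<^sup>2 / K\<^sup>2) * (P + R) * w / ((N1 + W1 * w) * (N0 + W0 * w))"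
    using * w den by (intro divide_right_mono mult_right_mono) auto
  also have "\<dots> \<le> (1 - m\<^sup>2 / K\<^sup>2) * 1"
  proof -
    have "(P + R) * w \<le> (N1 + W1 * w) * (N0 + W0 * w)"
      using pos w by (simp add: P_def R_def algebra_simps)
    then have "(P + R) * w / ((N1 + W1 * w) * (N0 + W0 * w)) \<le> 1"
      using den by (simp add: divide_simps)
    moreover have "0 \<le> 1 - m\<^sup>2 / K\<^sup>2"
      using PR m2 by (simp add: divide_simps)
    ultimately have "(1 - m\<^sup>2 / K\<^sup>2) * ((P + R) * w / ((N1 + W1 * w) * (N0 + W0 * w))) \<le> (1 - m\<^sup>2 / K\<^sup>2) * 1"
      by (rule mult_left_mono)
    then show ?thesis by (simp only: times_divide_eq_right mult.assoc)
  qed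
  finally show ?thesis unfolding w_def[symmetric] diff P_def R_def by simp
qed

section \<open>Backward recursion for the likelihoods\<close>

text \<open>
  \<open>p t c\<close> is the probability of state 1 at time \<open>t\<close> given state \<open>c\<close> at time \<open>t - 1\<close>.
\<close>

locale binary_kernels =
  fixes p :: "nat \<Rightarrow> nat \<Rightarrow> real"
  assumes p_nonneg: "0 \<le> p t c" and p_le_1: "p t c \<le> 1"
begin

text \<open>
  The conditional expectation, given state \<open>c\<close> at time \<open>i\<close>, of the product of the weights \<open>w t\<close> of the states
  at the times \<open>i + 1, ..., i + k\<close> times \<open>v\<close> of the last state.
\<close>

fun lik :: "(nat \<Rightarrow> nat \<Rightarrow> real) \<Rightarrow> (nat \<Rightarrow> real) \<Rightarrow> nat \<Rightarrow> nat \<Rightarrow> nat \<Rightarrow> real" where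
  "lik w v i 0 c = v c"
| "lik w v i (Suc k) c =
     (1 - p (Suc i) c) * (w (Suc i) 0 * lik w v (Suc i) k 0) +
     p (Suc i) c * (w (Suc i) 1 * lik w v (Suc i) k 1)"

text \<open>
  The action of the transition at time \<open>t\<close> on the log-odds of the two conditional likelihoods. The next
  three functions are its derivative, the logarithmic derivative of that derivative, and the
  derivative of \<open>curv\<close>.
\<close>

definition step :: "nat \<Rightarrow> real \<Rightarrow> real" where
  "step t y = ln (1 - p t 1 + p t 1 * exp y) - ln (1 - p t 0 + p t 0 * exp y)"

definition slope :: "nat \<Rightarrow> real \<Rightarrow> real" where
  "slope t y = tilt (p t 1) y - tilt (p t 0) y"

definition curv :: "nat \<Rightarrow> real \<Rightarrow> real" where
  "curv t y = 1 - tilt (p t 1) y - tilt (p t 0) y"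

definition curv' :: "nat \<Rightarrow> real \<Rightarrow> real" where
  "curv' t y = - tilt (p t 1) y * (1 - tilt (p t 1) y) - tilt (p t 0) y * (1 - tilt (p t 0) y)"

text \<open>
  The log-odds at time \<open>i\<close> if they equal \<open>y\<close> at time \<open>i + k\<close> and \<open>u t\<close> is the log-odds contribution of the
  observation at time \<open>t\<close>.
\<close>

fun traj :: "(nat \<Rightarrow> real) \<Rightarrow> real \<Rightarrow> nat \<Rightarrow> nat \<Rightarrow> real" where
  "traj u y i 0 = y"
| "traj u y i (Suc k) = step (Suc i) (u (Suc i) + traj u y (Suc i) k)"

text \<open>
  The first and second derivatives of \<open>traj\<close> with respect to a parameter on which \<open>u\<close> depends, with \<open>u'\<close>, \<open>u''\<close>
  for the derivatives of \<open>u\<close>. They are functions of the values of \<open>u\<close>, \<open>u'\<close> and \<open>u''\<close> at one point,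
  which reduces continuity and bounds to inductions on \<open>k\<close>.
\<close>

fun traj1 :: "(nat \<Rightarrow> real) \<Rightarrow> (nat \<Rightarrow> real) \<Rightarrow> nat \<Rightarrow> nat \<Rightarrow> real" where
  "traj1 u u' i 0 = 0"
| "traj1 u u' i (Suc k) =
     slope (Suc i) (u (Suc i) + traj u 0 (Suc i) k) * (u' (Suc i) + traj1 u u' (Suc i) k)"

fun traj2 :: "(nat \<Rightarrow> real) \<Rightarrow> (nat \<Rightarrow> real) \<Rightarrow> (nat \<Rightarrow> real) \<Rightarrow> nat \<Rightarrow> nat \<Rightarrow> real" where
  "traj2 u u' u'' i 0 = 0"
| "traj2 u u' u'' i (Suc k) =
     slope (Suc i) (u (Suc i) + traj u 0 (Suc i) k) *
     (curv (Suc i) (u (Suc i) + traj u 0 (Suc i) k) * (u' (Suc i) + traj1 u u' (Suc i) k)\<^sup>2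
      + (u'' (Suc i) + traj2 u u' u'' (Suc i) k))"

text \<open>
  The product of the slopes along the trajectory: the sensitivity of the log-odds at time \<open>i\<close> to those
  at time \<open>i + k\<close>.
\<close>

fun gain :: "(nat \<Rightarrow> real) \<Rightarrow> real \<Rightarrow> nat \<Rightarrow> nat \<Rightarrow> real" where
  "gain u y i 0 = 1"
| "gain u y i (Suc k) = slope (Suc i) (u (Suc i) + traj u y (Suc i) k) * gain u y (Suc i) k"

text \<open>
  The logarithmic derivative of \<open>gain\<close> with respect to the parameter, and the derivative of that.
\<close>

fun lgain1 :: "(nat \<Rightarrow> real) \<Rightarrow> (nat \<Rightarrow> real) \<Rightarrow> nat \<Rightarrow> nat \<Rightarrow> real" where
  "lgain1 u u' i 0 = 0"
| "lgain1 u u' i (Suc k) =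
     curv (Suc i) (u (Suc i) + traj u 0 (Suc i) k) * (u' (Suc i) + traj1 u u' (Suc i) k)
     + lgain1 u u' (Suc i) k"

fun lgain2 :: "(nat \<Rightarrow> real) \<Rightarrow> (nat \<Rightarrow> real) \<Rightarrow> (nat \<Rightarrow> real) \<Rightarrow> nat \<Rightarrow> nat \<Rightarrow> real" where
  "lgain2 u u' u'' i 0 = 0"
| "lgain2 u u' u'' i (Suc k) =
     curv' (Suc i) (u (Suc i) + traj u 0 (Suc i) k) * (u' (Suc i) + traj1 u u' (Suc i) k)\<^sup>2
     + curv (Suc i) (u (Suc i) + traj u 0 (Suc i) k) * (u'' (Suc i) + traj2 u u' u'' (Suc i) k)
     + lgain2 u u' u'' (Suc i) k"

lemma slope_abs_le: "\<bar>slope t y\<bar> \<le> 1"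
  using tilt_bounds[OF p_nonneg p_le_1, of t 1 y] tilt_bounds[OF p_nonneg p_le_1, of t 0 y]
  by (auto simp: slope_def abs_if)

lemma curv_abs_le: "\<bar>curv t y\<bar> \<le> 1"
  using tilt_bounds[OF p_nonneg p_le_1, of t 1 y] tilt_bounds[OF p_nonneg p_le_1, of t 0 y]
  by (auto simp: curv_def abs_if)

lemma curv'_abs_le: "\<bar>curv' t y\<bar> \<le> 1"
proof -
  have *: "0 \<le> z * (1 - z)" "z * (1 - z) \<le> 1/4" if "0 \<le> z" "z \<le> 1" for z :: real
    subgoal using that by simp
    using zero_le_power2[of "z - 1/2"] by (auto simp: power2_eq_square field_simps intro!: mult_nonneg_nonneg mult_left_le_one_le)
  show ?thesis
    using *[OF tilt_bounds[OF p_nonneg p_le_1, of t 1 y]] *[OF tilt_bounds[OF p_nonneg p_le_1, of t 0 y]]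
    by (auto simp: curv'_def abs_if)
qed

lemma step_deriv [derivative_intros]:
  assumes "(g has_real_derivative g') (at x within S)"
  shows "((\<lambda>x. step t (g x)) has_real_derivative slope t (g x) * g') (at x within S)"
  unfolding step_def slope_def left_diff_distrib
  by (intro DERIV_diff ln_mix_exp_deriv assms p_nonneg p_le_1)

lemma slope_deriv [derivative_intros]:
  assumes "(g has_real_derivative g') (at x within S)"
  shows "((\<lambda>x. slope t (g x)) has_real_derivative slope t (g x) * curv t (g x) * g') (at x within S)"
  unfolding slope_def curv_def
  by (auto intro!: derivative_eq_intros assms p_nonneg p_le_1 simp: algebra_simps)

lemma curv_deriv [derivative_intros]:
  assumes "(g has_real_derivative g') (at x within S)"
  shows "((\<lambda>x. curv t (g x)) has_real_derivative curv' t (g x) * g') (at x within S)"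
  unfolding curv_def curv'_def
  by (auto intro!: derivative_eq_intros assms p_nonneg p_le_1 simp: algebra_simps)

lemma step_continuous [continuous_intros]:
  "continuous_on S g \<Longrightarrow> continuous_on S (\<lambda>x. step t (g x))"
  unfolding step_def using mix_exp_pos[OF p_nonneg p_le_1]
  by (auto intro!: continuous_intros simp: less_imp_neq[THEN not_sym])

lemma slope_continuous [continuous_intros]:
  "continuous_on S g \<Longrightarrow> continuous_on S (\<lambda>x. slope t (g x))"
  unfolding slope_def by (intro continuous_intros p_nonneg p_le_1)

lemma curv_continuous [continuous_intros]:
  "continuous_on S g \<Longrightarrow> continuous_on S (\<lambda>x. curv t (g x))"
  unfolding curv_def by (intro continuous_intros p_nonneg p_le_1)

lemma curv'_continuous [continuous_intros]:
  "continuous_on S g \<Longrightarrow> continuous_on S (\<lambda>x. curv' t (g x))"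
  unfolding curv'_def by (intro continuous_intros p_nonneg p_le_1)

lemmas kernel_continuous = step_continuous slope_continuous curv_continuous curv'_continuous

lemma step_0 [simp]: "step t 0 = 0"
  by (simp add: step_def)

lemma lik_pos:
  assumes "\<And>t b. 0 < w t b" "\<And>b. 0 < v b"
  shows "0 < lik w v i k c"
proof (induction k arbitrary: i c)
  case (Suc k)
  let ?A = "w (Suc i) 0 * lik w v (Suc i) k 0" and ?B = "w (Suc i) 1 * lik w v (Suc i) k 1"
  have "0 < ?A" "0 < ?B" using Suc assms by auto
  then show ?case
    using p_nonneg[of "Suc i" c] p_le_1[of "Suc i" c]
    by (cases "p (Suc i) c = 0") (auto intro!: add_nonneg_pos mult_nonneg_nonneg[of "1 - p (Suc i) c"])
qed (use assms in simp)

lemma lik_linear: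
  "lik w (\<lambda>b. \<alpha> * v b + \<beta> * v' b) i k c = \<alpha> * lik w v i k c + \<beta> * lik w v' i k c"
  by (induction k arbitrary: i c) (auto simp: algebra_simps)

lemma lik_terminal_cong:
  assumes "v 0 = v' 0" "v 1 = v' 1" "c \<le> 1"
  shows "lik w v i k c = lik w v' i k c"
  using assms
proof (induction k arbitrary: i c)
  case 0
  then have "c = 0 \<or> c = 1" by auto
  with 0 show ?case by auto
qed auto

lemma lik_scale:
  assumes "\<And>t b. b \<le> 1 \<Longrightarrow> w t b = r t * w' t b"
  shows "lik w v i k c = (\<Prod>t = Suc i..i + k. r t) * lik w' v i k c"
proof (induction k arbitrary: i c)
  case (Suc k)
  have "{Suc i..i + Suc k} = insert (Suc i) {Suc (Suc i)..Suc i + k}" by auto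
  then show ?case by (simp add: Suc assms algebra_simps)
qed simp

text \<open>
  The likelihood from either state is the one of state 0 at the next time multiplied by \<open>1 - p + p exp x\<close>, where
  \<open>x\<close> is the sum of the weight exponent and the log-odds at that time. The common factor drops out of the
  difference of the logarithms.
\<close>

lemma traj_eq_ln_lik:
  "traj u y i k = ln (lik (\<lambda>t b. exp (u t * real b)) (\<lambda>b. exp (y * real b)) i k 1)
     - ln (lik (\<lambda>t b. exp (u t * real b)) (\<lambda>b. exp (y * real b)) i k 0)"
proof (induction k arbitrary: i)
  case (Suc k)
  let ?V = "\<lambda>i k c. lik (\<lambda>t b. exp (u t * real b)) (\<lambda>b. exp (y * real b)) i k c"
  have pos: "0 < ?V i k c" for i k c by (intro lik_pos) auto
  let ?x = "u (Suc i) + traj u y (Suc i) k"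
  have "exp (traj u y (Suc i) k) = ?V (Suc i) k 1 / ?V (Suc i) k 0"
    using Suc pos by (simp add: exp_diff)
  then have 1: "?V i (Suc k) c = ?V (Suc i) k 0 * (1 - p (Suc i) c + p (Suc i) c * exp ?x)" for c
    using pos[of "Suc i" k 0] by (simp add: exp_add field_simps)
  have "ln (?V i (Suc k) c) = ln (?V (Suc i) k 0) + ln (1 - p (Suc i) c + p (Suc i) c * exp ?x)" for c
    unfolding 1 using pos[of "Suc i" k 0] mix_exp_pos[OF p_nonneg p_le_1, of "Suc i" c ?x]
    by (simp add: ln_mult)
  then show ?case by (simp add: step_def)
qed simp

lemma traj_split: "traj u y i (k + l) = traj u (traj u y (i + k) l) i k"
  by (induction k arbitrary: i) auto

lemma gain_split: "gain u y i (k + l) = gain u (traj u y (i + k) l) i k * gain u y (i + k) l"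
  by (induction k arbitrary: i) (auto simp: traj_split)

lemma gain_abs_le_1: "\<bar>gain u y i k\<bar> \<le> 1"
proof (induction k arbitrary: i)
  case (Suc k)
  then show ?case using slope_abs_le by (simp add: abs_mult mult_le_one)
qed simp

lemma traj_deriv_terminal:
  "((\<lambda>y. traj u y i k) has_real_derivative gain u y i k) (at y)"
proof (induction k arbitrary: i)
  case (Suc k)
  show ?case by (auto intro!: derivative_eq_intros Suc)
qed auto

lemma lik_ge:
  assumes w: "\<And>t b. i < t \<Longrightarrow> t \<le> i + k \<Longrightarrow> b \<le> 1 \<Longrightarrow> l \<le> w t b" and "0 \<le> l" and v: "\<And>b. 0 \<le> v b"
  shows "l ^ k * lik (\<lambda>_ _. 1) v i k c \<le> lik w v i k c"
  using w
proof (induction k arbitrary: i c)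
  case (Suc k)
  have nn: "0 \<le> lik (\<lambda>_ _. 1) v i k c" for i k c
    by (induction k arbitrary: i c) (auto intro!: add_nonneg_nonneg mult_nonneg_nonneg simp: v p_nonneg p_le_1)
  have IH: "l ^ k * lik (\<lambda>_ _. 1) v (Suc i) k c \<le> lik w v (Suc i) k c" for c
    by (rule Suc.IH) (use Suc.prems in auto)
  have *: "l * (l ^ k * lik (\<lambda>_ _. 1) v (Suc i) k b) \<le> w (Suc i) b * lik w v (Suc i) k b" if "b \<le> 1" for b
    using Suc.prems[of "Suc i" b] that IH[of b] \<open>0 \<le> l\<close> nn
    by (intro mult_mono) (auto intro: order_trans)
  have "l ^ Suc k * lik (\<lambda>_ _. 1) v i (Suc k) c =
     (1 - p (Suc i) c) * (l * (l ^ k * lik (\<lambda>_ _. 1) v (Suc i) k 0)) +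
     p (Suc i) c * (l * (l ^ k * lik (\<lambda>_ _. 1) v (Suc i) k 1))"
    by (simp add: algebra_simps)
  also have "\<dots> \<le> lik w v i (Suc k) c"
    by (simp only: lik.simps) (intro add_mono mult_left_mono *; simp add: p_nonneg p_le_1)
  finally show ?case .
qed simp

lemma lik_le:
  assumes w: "\<And>t b. i < t \<Longrightarrow> t \<le> i + k \<Longrightarrow> b \<le> 1 \<Longrightarrow> 0 \<le> w t b \<and> w t b \<le> l"
    and v: "\<And>b. 0 \<le> v b" "\<And>b. v b \<le> 1"
  shows "0 \<le> lik w v i k c \<and> lik w v i k c \<le> l ^ k"
  using w
proof (induction k arbitrary: i c)
  case (Suc k)
  have IH: "0 \<le> lik w v (Suc i) k c \<and> lik w v (Suc i) k c \<le> l ^ k" for c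
    by (rule Suc.IH) (use Suc.prems in auto)
  have *: "0 \<le> w (Suc i) b * lik w v (Suc i) k b \<and> w (Suc i) b * lik w v (Suc i) k b \<le> l * l ^ k"
    if "b \<le> 1" for b
    using Suc.prems[of "Suc i" b] that IH[of b] by (auto intro!: mult_mono)
  have "lik w v i (Suc k) c \<le> (1 - p (Suc i) c) * (l * l ^ k) + p (Suc i) c * (l * l ^ k)"
    by (simp only: lik.simps) (intro add_mono mult_left_mono *[THEN conjunct2]; simp add: p_nonneg p_le_1)
  moreover have "0 \<le> lik w v i (Suc k) c"
    by (simp only: lik.simps)
      (intro add_nonneg_nonneg mult_nonneg_nonneg *[THEN conjunct1]; simp add: p_nonneg p_le_1)
  ultimately show ?case by (simp add: algebra_simps)
qed (use v in simp)

text \<open>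
  The composition of the \<open>k\<close> steps is the log-odds map of the matrix of the weighted \<open>k\<close>-step transitions. The
  chain rule makes its derivative the gain, and \<open>moebius_deriv_bound\<close> applies because bounded weights keep
  all four entries between positive constants. Whole blocks are considered because a single step may be an
  isometry: a transition that surely keeps or surely swaps the state preserves the log-odds up to sign.
\<close>

lemma gain_contraction:
  assumes u: "\<And>t. i < t \<Longrightarrow> t \<le> i + k \<Longrightarrow> \<bar>u t\<bar> \<le> K"
    and mix: "\<And>b c. b \<le> 1 \<Longrightarrow> c \<le> 1 \<Longrightarrow> \<phi> \<le> lik (\<lambda>_ _. 1) (\<lambda>b'. of_bool (b' = b)) i k c"
    and "0 < \<phi>"
  shows "\<bar>gain u y i k\<bar> \<le> 1 - (exp (- K) ^ k * \<phi>)\<^sup>2 / (exp K ^ k)\<^sup>2"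
proof -
  define A where "A b c = lik (\<lambda>t b. exp (u t * real b)) (\<lambda>b'. of_bool (b' = b)) i k c" for b c
  have uK: "exp (- K) \<le> exp (u t * real b)" "exp (u t * real b) \<le> exp K"
    if "i < t" "t \<le> i + k" "b \<le> 1" for t b
  proof -
    have "\<bar>u t * real b\<bar> \<le> K" using u[OF that(1,2)] that(3) by (cases b) auto
    then show "exp (- K) \<le> exp (u t * real b)" "exp (u t * real b) \<le> exp K" by (auto simp: abs_le_iff)
  qed
  have lo: "exp (- K) ^ k * \<phi> \<le> A b c" if "b \<le> 1" "c \<le> 1" for b c
  proof -
    have "exp (- K) ^ k * \<phi> \<le> exp (- K) ^ k * lik (\<lambda>_ _. 1) (\<lambda>b'. of_bool (b' = b)) i k c"
      using mix[OF that] by (intro mult_left_mono) auto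
    also have "\<dots> \<le> A b c" unfolding A_def by (intro lik_ge uK) auto
    finally show ?thesis .
  qed
  have hi: "A b c \<le> exp K ^ k" for b c
    unfolding A_def by (rule lik_le[THEN conjunct2]) (use uK in auto)
  have m: "0 < exp (- K) ^ k * \<phi>" using \<open>0 < \<phi>\<close> by simp
  then have A_pos: "0 < A b c" if "b \<le> 1" "c \<le> 1" for b c
    using lo[OF that] by linarith
  have den: "0 < A 0 c + A 1 c * exp y" if "c \<le> 1" for c y
    using A_pos[of 0 c] A_pos[of 1 c] that by (intro add_pos_pos) auto
  have "lik (\<lambda>t b. exp (u t * real b)) (\<lambda>b. exp (y * real b)) i k c = A 0 c + A 1 c * exp y"
    if "c \<le> 1" for c y
  proof -
    have "lik (\<lambda>t b. exp (u t * real b)) (\<lambda>b. exp (y * real b)) i k c =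
        lik (\<lambda>t b. exp (u t * real b)) (\<lambda>b. 1 * of_bool (b = 0) + exp y * of_bool (b = 1)) i k c"
      by (rule lik_terminal_cong) (use that in auto)
    also have "\<dots> = 1 * A 0 c + exp y * A 1 c" unfolding A_def by (rule lik_linear)
    finally show ?thesis by simp
  qed
  then have traj_eq: "(\<lambda>y. traj u y i k) = (\<lambda>y. ln (A 0 1 + A 1 1 * exp y) - ln (A 0 0 + A 1 0 * exp y))"
    by (simp add: traj_eq_ln_lik)
  have "((\<lambda>y. ln (A 0 1 + A 1 1 * exp y) - ln (A 0 0 + A 1 0 * exp y)) has_real_derivative
      A 1 1 * exp y / (A 0 1 + A 1 1 * exp y) - A 1 0 * exp y / (A 0 0 + A 1 0 * exp y)) (at y)"
    using den[of 1 y] den[of 0 y] by (auto intro!: derivative_eq_intros simp: field_simps)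
  with traj_deriv_terminal[of u i k y] have
    "gain u y i k = A 1 1 * exp y / (A 0 1 + A 1 1 * exp y) - A 1 0 * exp y / (A 0 0 + A 1 0 * exp y)"
    unfolding traj_eq by (rule DERIV_unique)
  then show ?thesis
    using moebius_deriv_bound[OF m, of "A 0 0" "A 0 1" "A 1 0" "A 1 1" "exp K ^ k" y] lo hi by simp
qed

section \<open>Derivatives of the backward recursion\<close>

lemma traj_deriv:
  assumes u: "\<And>t. ((\<lambda>x. u x t) has_real_derivative u' x t) (at x within S)"
  shows "((\<lambda>x. traj (u x) 0 i k) has_real_derivative traj1 (u x) (u' x) i k) (at x within S)"
proof (induction k arbitrary: i)
  case (Suc k)
  show ?case by (auto intro!: derivative_eq_intros Suc u)
qed auto

lemma traj1_deriv:
  assumes u: "\<And>t. ((\<lambda>x. u x t) has_real_derivative u' x t) (at x within S)"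
    and u': "\<And>t. ((\<lambda>x. u' x t) has_real_derivative u'' x t) (at x within S)"
  shows "((\<lambda>x. traj1 (u x) (u' x) i k) has_real_derivative traj2 (u x) (u' x) (u'' x) i k) (at x within S)"
proof (induction k arbitrary: i)
  case (Suc k)
  show ?case
    by (auto intro!: derivative_eq_intros Suc u u' traj_deriv[where u' = u'] simp: power2_eq_square algebra_simps)
qed auto

lemma gain_deriv:
  assumes u: "\<And>t. ((\<lambda>x. u x t) has_real_derivative u' x t) (at x within S)"
  shows "((\<lambda>x. gain (u x) 0 i k) has_real_derivative gain (u x) 0 i k * lgain1 (u x) (u' x) i k) (at x within S)"
proof (induction k arbitrary: i)
  case (Suc k)
  show ?case
    by (auto intro!: derivative_eq_intros Suc u traj_deriv[where u' = u'] simp: algebra_simps)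
qed auto

lemma lgain1_deriv:
  assumes u: "\<And>t. ((\<lambda>x. u x t) has_real_derivative u' x t) (at x within S)"
    and u': "\<And>t. ((\<lambda>x. u' x t) has_real_derivative u'' x t) (at x within S)"
  shows "((\<lambda>x. lgain1 (u x) (u' x) i k) has_real_derivative lgain2 (u x) (u' x) (u'' x) i k) (at x within S)"
proof (induction k arbitrary: i)
  case (Suc k)
  show ?case
    by (auto intro!: derivative_eq_intros Suc u u' traj_deriv[where u' = u'] traj1_deriv[where u' = u' and u'' = u'']
        simp: power2_eq_square algebra_simps)
qed auto

lemma traj_continuous:
  assumes "\<And>t. continuous_on S (\<lambda>x. u x t)"
  shows "continuous_on S (\<lambda>x. traj (u x) 0 i k)"
proof (induction k arbitrary: i)
  case (Suc k)
  show ?case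
    by (simp only: traj.simps, intro kernel_continuous continuous_on_mult continuous_on_add continuous_on_power continuous_on_const Suc.IH assms)
qed simp

lemma traj1_continuous:
  assumes "\<And>t. continuous_on S (\<lambda>x. u x t)" "\<And>t. continuous_on S (\<lambda>x. u' x t)"
  shows "continuous_on S (\<lambda>x. traj1 (u x) (u' x) i k)"
proof (induction k arbitrary: i)
  case (Suc k)
  show ?case
    by (simp only: traj1.simps, intro kernel_continuous continuous_on_mult continuous_on_add continuous_on_power continuous_on_const Suc.IH assms traj_continuous)
qed simp

lemma traj2_continuous:
  assumes "\<And>t. continuous_on S (\<lambda>x. u x t)" "\<And>t. continuous_on S (\<lambda>x. u' x t)" "\<And>t. continuous_on S (\<lambda>x. u'' x t)"
  shows "continuous_on S (\<lambda>x. traj2 (u x) (u' x) (u'' x) i k)"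
proof (induction k arbitrary: i)
  case (Suc k)
  show ?case
    by (simp only: traj2.simps, intro kernel_continuous continuous_on_mult continuous_on_add continuous_on_power continuous_on_const Suc.IH assms traj_continuous traj1_continuous)
qed simp

lemma gain_continuous:
  assumes "\<And>t. continuous_on S (\<lambda>x. u x t)"
  shows "continuous_on S (\<lambda>x. gain (u x) 0 i k)"
proof (induction k arbitrary: i)
  case (Suc k)
  show ?case
    by (simp only: gain.simps, intro kernel_continuous continuous_on_mult continuous_on_add continuous_on_power continuous_on_const Suc.IH assms traj_continuous)
qed simp

lemma lgain1_continuous:
  assumes "\<And>t. continuous_on S (\<lambda>x. u x t)" "\<And>t. continuous_on S (\<lambda>x. u' x t)"
  shows "continuous_on S (\<lambda>x. lgain1 (u x) (u' x) i k)"
proof (induction k arbitrary: i)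
  case (Suc k)
  show ?case
    by (simp only: lgain1.simps, intro kernel_continuous continuous_on_mult continuous_on_add continuous_on_power continuous_on_const Suc.IH assms traj_continuous traj1_continuous)
qed simp

lemma lgain2_continuous:
  assumes "\<And>t. continuous_on S (\<lambda>x. u x t)" "\<And>t. continuous_on S (\<lambda>x. u' x t)" "\<And>t. continuous_on S (\<lambda>x. u'' x t)"
  shows "continuous_on S (\<lambda>x. lgain2 (u x) (u' x) (u'' x) i k)"
proof (induction k arbitrary: i)
  case (Suc k)
  show ?case
    by (simp only: lgain2.simps, intro kernel_continuous continuous_on_mult continuous_on_add continuous_on_power continuous_on_const Suc.IH assms traj_continuous traj1_continuous traj2_continuous)
qed simp

end

section \<open>Transition probabilities as derivatives at the unperturbed parameter\<close>

context binary_kernels begin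

text \<open>
  The probability of state 1 at time \<open>i + k\<close> given state \<open>c\<close> at time \<open>i\<close>. The two combinations below are the
  difference and the deficit \<open>1 - P(1,1) - P(0,1) = P(1,0) - P(0,1)\<close> that occur in the two expansions.
\<close>

definition hit :: "nat \<Rightarrow> nat \<Rightarrow> nat \<Rightarrow> real" where
  "hit i k c = lik (\<lambda>_ _. 1) (\<lambda>b. of_bool (b = 1)) i k c"

definition memory :: "nat \<Rightarrow> nat \<Rightarrow> real" where
  "memory i k = hit i k 1 - hit i k 0"

definition skew :: "nat \<Rightarrow> nat \<Rightarrow> real" where
  "skew i k = 1 - hit i k 1 - hit i k 0"

lemma hit_Suc: "hit i (Suc k) c = hit (Suc i) k 0 + p (Suc i) c * memory (Suc i) k"
  by (simp add: hit_def memory_def algebra_simps)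

lemma memory_0 [simp]: "memory i 0 = 1"
  by (simp add: memory_def hit_def)

lemma memory_Suc: "memory i (Suc k) = (p (Suc i) 1 - p (Suc i) 0) * memory (Suc i) k"
  by (simp add: memory_def[of i] hit_Suc algebra_simps)

lemma skew_0 [simp]: "skew i 0 = 0"
  by (simp add: skew_def hit_def)

lemma skew_Suc: "skew i (Suc k) = (1 - p (Suc i) 1 - p (Suc i) 0) * memory (Suc i) k + skew (Suc i) k"
  by (simp add: skew_def hit_Suc memory_def algebra_simps)

lemma hit_bounds: "0 \<le> hit i k c" "hit i k c \<le> 1"
  using lik_le[where w = "\<lambda>_ _. 1" and l = 1 and v = "\<lambda>b. of_bool (b = 1)"]
  by (auto simp: hit_def)

lemma lik_one: "lik (\<lambda>_ _. 1) (\<lambda>_. 1) i k c = 1"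
  by (induction k arbitrary: i c) auto

lemma hit_complement:
  assumes "c \<le> 1"
  shows "lik (\<lambda>_ _. 1) (\<lambda>b. of_bool (b = 0)) i k c = 1 - hit i k c"
proof -
  have "1 = lik (\<lambda>_ _. 1) (\<lambda>b. 1 * of_bool (b = 0) + 1 * of_bool (b = 1)) i k c"
    using lik_terminal_cong[OF _ _ assms, of "\<lambda>b. 1 * of_bool (b = 0) + 1 * of_bool (b = 1)" "\<lambda>_. 1"] lik_one
    by simp
  then show ?thesis unfolding lik_linear hit_def by simp
qed

lemma skew_abs_le: "\<bar>skew i k\<bar> \<le> 1"
  using hit_bounds[of i k 0] hit_bounds[of i k 1] by (auto simp: skew_def abs_le_iff)

lemma traj_0: "traj (\<lambda>_. 0) 0 i k = 0"
  by (induction k arbitrary: i) auto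

text \<open>
  Without observations the trajectory vanishes identically, and the product of the one-step differences of
  transition probabilities is the \<open>k\<close>-step difference.
\<close>

lemma gain_0: "gain (\<lambda>_. 0) 0 i k = memory i k"
  by (induction k arbitrary: i) (auto simp: traj_0 memory_Suc slope_def)

lemma traj1_0: "traj1 (\<lambda>_. 0) u' i k = (\<Sum>j<k. memory i (Suc j) * u' (i + Suc j))"
proof (induction k arbitrary: i)
  case (Suc k)
  show ?case
    by (simp add: Suc traj_0 slope_def sum.lessThan_Suc_shift memory_Suc sum_distrib_left algebra_simps
        del: sum.lessThan_Suc)
qed simp

text \<open>
  The sum over the steps of the curvature times the response \<open>traj1_0\<close> to later observations, rearranged by
  observation time: \<open>skew_Suc\<close> says that each observation collects exactly the deficit at its time.
\<close>

lemma lgain1_0: "lgain1 (\<lambda>_. 0) u' i k = (\<Sum>j<k. skew i (Suc j) * u' (i + Suc j))"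
proof (induction k arbitrary: i)
  case (Suc k)
  show ?case
    by (simp add: Suc traj_0 curv_def traj1_0 sum.lessThan_Suc_shift skew_Suc[of i]
        sum_distrib_left sum.distrib sum_subtractf algebra_simps del: sum.lessThan_Suc)
qed simp

section \<open>Polynomial bounds on the derivatives\<close>

lemma traj1_abs_le:
  assumes "\<And>t. i < t \<Longrightarrow> t \<le> i + k \<Longrightarrow> \<bar>u' t\<bar> \<le> B"
  shows "\<bar>traj1 u u' i k\<bar> \<le> real k * B"
  using assms
proof (induction k arbitrary: i)
  case (Suc k)
  have "\<bar>traj1 u u' (Suc i) k\<bar> \<le> real k * B" by (rule Suc.IH) (use Suc.prems in auto)
  moreover have "\<bar>u' (Suc i)\<bar> \<le> B" using Suc.prems[of "Suc i"] by auto
  ultimately have "\<bar>u' (Suc i) + traj1 u u' (Suc i) k\<bar> \<le> real (Suc k) * B"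
    by (simp add: algebra_simps)
  then show ?case
    using mult_mono[OF slope_abs_le] by (fastforce simp: abs_mult)
qed simp

lemma step_argument_deriv_le:
  assumes "\<And>t. i < t \<Longrightarrow> t \<le> i + Suc k \<Longrightarrow> \<bar>u' t\<bar> \<le> B" and "0 \<le> B"
  shows "\<bar>u' (Suc i) + traj1 u u' (Suc i) k\<bar> \<le> real (Suc k) * B"
    "(u' (Suc i) + traj1 u u' (Suc i) k)\<^sup>2 \<le> (real (Suc k))\<^sup>2 * B\<^sup>2"
proof -
  have "\<bar>traj1 u u' (Suc i) k\<bar> \<le> real k * B" by (rule traj1_abs_le) (use assms in auto)
  moreover have "\<bar>u' (Suc i)\<bar> \<le> B" using assms(1)[of "Suc i"] by auto
  ultimately show *: "\<bar>u' (Suc i) + traj1 u u' (Suc i) k\<bar> \<le> real (Suc k) * B"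
    by (simp add: algebra_simps)
  show "(u' (Suc i) + traj1 u u' (Suc i) k)\<^sup>2 \<le> (real (Suc k))\<^sup>2 * B\<^sup>2"
    using power_mono[OF *, of 2] by (simp only: power2_abs power_mult_distrib abs_ge_zero)
qed

lemma traj2_abs_le:
  assumes "\<And>t. i < t \<Longrightarrow> t \<le> i + k \<Longrightarrow> \<bar>u' t\<bar> \<le> B \<and> \<bar>u'' t\<bar> \<le> B" and "1 \<le> B"
  shows "\<bar>traj2 u u' u'' i k\<bar> \<le> 2 * real k ^ 3 * B\<^sup>2"
  using assms(1)
proof (induction k arbitrary: i)
  case (Suc k)
  define y where "y = u' (Suc i) + traj1 u u' (Suc i) k"
  define c where "c = curv (Suc i) (u (Suc i) + traj u 0 (Suc i) k)"
  have B: "B \<le> B\<^sup>2" "0 \<le> B" "0 \<le> B\<^sup>2" using \<open>1 \<le> B\<close> by (auto simp: power2_eq_square)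
  have IH: "\<bar>traj2 u u' u'' (Suc i) k\<bar> \<le> 2 * real k ^ 3 * B\<^sup>2"
    by (rule Suc.IH) (use Suc.prems in auto)
  have y: "y\<^sup>2 \<le> (real (Suc k))\<^sup>2 * B\<^sup>2"
    unfolding y_def by (rule step_argument_deriv_le) (use Suc.prems B in auto)
  have u'': "\<bar>u'' (Suc i)\<bar> \<le> B" using Suc.prems[of "Suc i"] by auto
  have c: "\<bar>c * y\<^sup>2\<bar> \<le> y\<^sup>2"
    using mult_right_mono[OF curv_abs_le, of "y\<^sup>2"] by (simp add: abs_mult c_def)
  have "\<bar>traj2 u u' u'' i (Suc k)\<bar> \<le> \<bar>c * y\<^sup>2 + (u'' (Suc i) + traj2 u u' u'' (Suc i) k)\<bar>"
    using mult_right_mono[OF slope_abs_le, of "\<bar>c * y\<^sup>2 + (u'' (Suc i) + traj2 u u' u'' (Suc i) k)\<bar>"]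
    by (simp add: abs_mult c_def y_def)
  also have "\<dots> \<le> (real (Suc k))\<^sup>2 * B\<^sup>2 + B\<^sup>2 + 2 * real k ^ 3 * B\<^sup>2"
    using c y u'' IH B(1) by linarith
  also have "\<dots> = ((real (Suc k))\<^sup>2 + 1 + 2 * real k ^ 3) * B\<^sup>2" by (simp add: algebra_simps)
  also have "\<dots> \<le> (2 * real (Suc k) ^ 3) * B\<^sup>2"
    by (rule mult_right_mono) (auto simp: power2_eq_square power3_eq_cube algebra_simps)
  finally show ?case .
qed simp

lemma lgain1_abs_le:
  assumes "\<And>t. i < t \<Longrightarrow> t \<le> i + k \<Longrightarrow> \<bar>u' t\<bar> \<le> B" and "0 \<le> B"
  shows "\<bar>lgain1 u u' i k\<bar> \<le> (real k)\<^sup>2 * B"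
  using assms(1)
proof (induction k arbitrary: i)
  case (Suc k)
  define y where "y = u' (Suc i) + traj1 u u' (Suc i) k"
  define c where "c = curv (Suc i) (u (Suc i) + traj u 0 (Suc i) k)"
  have IH: "\<bar>lgain1 u u' (Suc i) k\<bar> \<le> (real k)\<^sup>2 * B"
    by (rule Suc.IH) (use Suc.prems in auto)
  have y: "\<bar>y\<bar> \<le> real (Suc k) * B"
    unfolding y_def by (rule step_argument_deriv_le) (use Suc.prems assms(2) in auto)
  have c: "\<bar>c * y\<bar> \<le> \<bar>y\<bar>"
    using mult_right_mono[OF curv_abs_le, of "\<bar>y\<bar>"] by (simp add: abs_mult c_def)
  have "\<bar>lgain1 u u' i (Suc k)\<bar> \<le> real (Suc k) * B + (real k)\<^sup>2 * B"
    using IH y c by (simp add: c_def[symmetric] y_def[symmetric])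
  also have "\<dots> = (real (Suc k) + (real k)\<^sup>2) * B" by (simp add: algebra_simps)
  also have "\<dots> \<le> (real (Suc k))\<^sup>2 * B"
    by (rule mult_right_mono) (use assms(2) in \<open>auto simp: power2_eq_square algebra_simps\<close>)
  finally show ?case .
qed simp

lemma lgain2_abs_le:
  assumes "\<And>t. i < t \<Longrightarrow> t \<le> i + k \<Longrightarrow> \<bar>u' t\<bar> \<le> B \<and> \<bar>u'' t\<bar> \<le> B" and "1 \<le> B"
  shows "\<bar>lgain2 u u' u'' i k\<bar> \<le> 4 * real k ^ 4 * B\<^sup>2"
  using assms(1)
proof (induction k arbitrary: i)
  case (Suc k)
  define y where "y = u' (Suc i) + traj1 u u' (Suc i) k"
  define z where "z = u'' (Suc i) + traj2 u u' u'' (Suc i) k"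
  define c where "c = curv (Suc i) (u (Suc i) + traj u 0 (Suc i) k)"
  define c' where "c' = curv' (Suc i) (u (Suc i) + traj u 0 (Suc i) k)"
  have B: "B \<le> B\<^sup>2" "0 \<le> B" "0 \<le> B\<^sup>2" using \<open>1 \<le> B\<close> by (auto simp: power2_eq_square)
  have IH: "\<bar>lgain2 u u' u'' (Suc i) k\<bar> \<le> 4 * real k ^ 4 * B\<^sup>2"
    by (rule Suc.IH) (use Suc.prems in auto)
  have y: "y\<^sup>2 \<le> (real (Suc k))\<^sup>2 * B\<^sup>2"
    unfolding y_def by (rule step_argument_deriv_le) (use Suc.prems B in auto)
  have "\<bar>traj2 u u' u'' (Suc i) k\<bar> \<le> 2 * real k ^ 3 * B\<^sup>2"
    by (rule traj2_abs_le) (use Suc.prems \<open>1 \<le> B\<close> in auto)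
  moreover have "\<bar>u'' (Suc i)\<bar> \<le> B" using Suc.prems[of "Suc i"] by auto
  ultimately have z: "\<bar>z\<bar> \<le> B\<^sup>2 + 2 * real k ^ 3 * B\<^sup>2"
    unfolding z_def using B(1) by linarith
  have c: "\<bar>c * z\<bar> \<le> \<bar>z\<bar>"
    using mult_right_mono[OF curv_abs_le, of "\<bar>z\<bar>"] by (simp add: abs_mult c_def)
  have c': "\<bar>c' * y\<^sup>2\<bar> \<le> y\<^sup>2"
    using mult_right_mono[OF curv'_abs_le, of "y\<^sup>2"] by (simp add: abs_mult c'_def)
  have "lgain2 u u' u'' i (Suc k) = c' * y\<^sup>2 + c * z + lgain2 u u' u'' (Suc i) k"
    by (simp add: c_def c'_def y_def z_def)
  then have "\<bar>lgain2 u u' u'' i (Suc k)\<bar>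
      \<le> (real (Suc k))\<^sup>2 * B\<^sup>2 + (B\<^sup>2 + 2 * real k ^ 3 * B\<^sup>2) + 4 * real k ^ 4 * B\<^sup>2"
    using c c' y z IH by linarith
  also have "\<dots> = ((real (Suc k))\<^sup>2 + 1 + 2 * real k ^ 3 + 4 * real k ^ 4) * B\<^sup>2" by (simp add: algebra_simps)
  also have "\<dots> \<le> (4 * real (Suc k) ^ 4) * B\<^sup>2"
    by (rule mult_right_mono) (auto simp: power2_eq_square power3_eq_cube power4_eq_xxxx algebra_simps)
  finally show ?case .
qed simp

lemma traj_cong:
  "(\<And>t. i < t \<Longrightarrow> t \<le> i + k \<Longrightarrow> u t = v t) \<Longrightarrow> traj u y i k = traj v y i k"
  by (induction k arbitrary: i) auto

lemma gain_cong:
  "(\<And>t. i < t \<Longrightarrow> t \<le> i + k \<Longrightarrow> u t = v t) \<Longrightarrow> gain u y i k = gain v y i k"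
proof (induction k arbitrary: i)
  case (Suc k)
  have "traj u y (Suc i) k = traj v y (Suc i) k" by (rule traj_cong) (use Suc.prems in auto)
  moreover have "gain u y (Suc i) k = gain v y (Suc i) k" by (rule Suc.IH) (use Suc.prems in auto)
  ultimately show ?case using Suc.prems[of "Suc i"] by simp
qed simp

end

section \<open>Termwise differentiation of the limit\<close>

text \<open>
  \<open>d t x\<close> is the logarithm of the likelihood ratio of the two states at time \<open>t\<close> for the parameter \<open>x\<close>.
\<close>

locale smooth_observations = binary_kernels p for p +
  fixes d d' d'' :: "nat \<Rightarrow> real \<Rightarrow> real"
  assumes d_deriv: "\<And>t x. (d t has_real_derivative d' t x) (at x)"
    and d'_deriv: "\<And>t x. (d' t has_real_derivative d'' t x) (at x)"
    and d''_cont: "\<And>t. continuous_on UNIV (d'' t)"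
    and d_zero: "\<And>t. d t 0 = 0"
begin

text \<open>
  The factor that scales the observation at time \<open>n\<close>, interpolating between the first \<open>n - 1\<close> and the first \<open>n\<close>
  observations.
\<close>

definition damp :: "nat \<Rightarrow> real \<Rightarrow> nat \<Rightarrow> real" where
  "damp n s t = (if t = n then s else 1)"

text \<open>
  The \<open>s\<close>-derivative of the log-odds at time 0; \<open>rate'\<close> and \<open>rate''\<close> are its derivatives in \<open>x\<close>.
\<close>

definition rate :: "nat \<Rightarrow> real \<Rightarrow> real \<Rightarrow> real" where
  "rate n s x = gain (\<lambda>t. damp n s t * d t x) 0 0 n * d n x"

definition rate' :: "nat \<Rightarrow> real \<Rightarrow> real \<Rightarrow> real" where
  "rate' n s x = gain (\<lambda>t. damp n s t * d t x) 0 0 n *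
     (lgain1 (\<lambda>t. damp n s t * d t x) (\<lambda>t. damp n s t * d' t x) 0 n * d n x + d' n x)"

definition rate'' :: "nat \<Rightarrow> real \<Rightarrow> real \<Rightarrow> real" where
  "rate'' n s x = gain (\<lambda>t. damp n s t * d t x) 0 0 n *
     (((lgain1 (\<lambda>t. damp n s t * d t x) (\<lambda>t. damp n s t * d' t x) 0 n)\<^sup>2
       + lgain2 (\<lambda>t. damp n s t * d t x) (\<lambda>t. damp n s t * d' t x) (\<lambda>t. damp n s t * d'' t x) 0 n) * d n x
      + 2 * lgain1 (\<lambda>t. damp n s t * d t x) (\<lambda>t. damp n s t * d' t x) 0 n * d' n x + d'' n x)"

text \<open>
  The last step merely changes the terminal value of the trajectory of the first \<open>n\<close> observations, so the
  \<open>s\<close>-derivative is the gain of these \<open>n\<close> steps times the slope of the last step times \<open>d (Suc n) x\<close>.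
\<close>

lemma increment:
  "((\<lambda>s. rate (Suc n) s x) has_integral
     (traj (\<lambda>t. d t x) 0 0 (Suc n) - traj (\<lambda>t. d t x) 0 0 n)) {0..1}"
proof -
  define F where "F s = traj (\<lambda>t. d t x) (step (Suc n) (s * d (Suc n) x)) 0 n" for s
  have "(F has_real_derivative rate (Suc n) s x) (at s within {0..1})" for s
  proof -
    let ?u = "\<lambda>t. damp (Suc n) s t * d t x"
    let ?y = "step (Suc n) (s * d (Suc n) x)"
    have "(F has_real_derivative
        gain (\<lambda>t. d t x) ?y 0 n * (slope (Suc n) (s * d (Suc n) x) * d (Suc n) x)) (at s)"
      unfolding F_def
      by (rule DERIV_chain2[OF traj_deriv_terminal]) (auto intro!: derivative_eq_intros)
    moreover have "gain ?u ?y 0 n = gain (\<lambda>t. d t x) ?y 0 n"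
      by (rule gain_cong) (auto simp: damp_def)
    moreover have "rate (Suc n) s x = gain ?u ?y 0 n * slope (Suc n) (s * d (Suc n) x) * d (Suc n) x"
      using gain_split[of ?u 0 0 n 1] by (simp add: rate_def damp_def)
    ultimately show ?thesis by (auto intro: has_field_derivative_at_within simp: mult.assoc)
  qed
  then have "((\<lambda>s. rate (Suc n) s x) has_integral F 1 - F 0) {0..1}"
    by (intro fundamental_theorem_of_calculus) (auto simp: has_real_derivative_iff_has_vector_derivative)
  moreover have "F 1 = traj (\<lambda>t. d t x) 0 0 (Suc n)"
    using traj_split[of "\<lambda>t. d t x" 0 0 n 1] by (simp add: F_def)
  ultimately show ?thesis by (simp add: F_def)
qed

lemma d_continuous: "continuous_on S (d t)" "continuous_on S (d' t)" "continuous_on S (d'' t)"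
  using DERIV_continuous_on[OF d_deriv] DERIV_continuous_on[OF d'_deriv] d''_cont
  by (auto intro: continuous_on_subset)

lemma damped_continuous:
  assumes "continuous_on S f" "continuous_on S g"
  shows "continuous_on S (\<lambda>z. damp n (f z) t * d t (g z))"
    "continuous_on S (\<lambda>z. damp n (f z) t * d' t (g z))"
    "continuous_on S (\<lambda>z. damp n (f z) t * d'' t (g z))"
  using assms by (cases "t = n"; auto simp: damp_def intro!: continuous_on_mult
    continuous_on_compose2[OF d_continuous(1)] continuous_on_compose2[OF d_continuous(2)]
    continuous_on_compose2[OF d_continuous(3)])+

lemma rate_continuous:
  assumes fg: "continuous_on S f" "continuous_on S g"
  shows "continuous_on S (\<lambda>z. rate n (f z) (g z))"
    "continuous_on S (\<lambda>z. rate' n (f z) (g z))"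
    "continuous_on S (\<lambda>z. rate'' n (f z) (g z))"
proof -
  note c = damped_continuous[OF fg] gain_continuous[OF damped_continuous(1)[OF fg]]
    lgain1_continuous[OF damped_continuous(1,2)[OF fg]]
    lgain2_continuous[OF damped_continuous[OF fg]]
    continuous_on_compose2[OF d_continuous(1) fg(2) subset_UNIV]
    continuous_on_compose2[OF d_continuous(2) fg(2) subset_UNIV]
    continuous_on_compose2[OF d_continuous(3) fg(2) subset_UNIV]
  show "continuous_on S (\<lambda>z. rate n (f z) (g z))"
    unfolding rate_def by (intro continuous_on_mult c)
  show "continuous_on S (\<lambda>z. rate' n (f z) (g z))"
    unfolding rate'_def by (intro continuous_on_mult continuous_on_add c)
  show "continuous_on S (\<lambda>z. rate'' n (f z) (g z))"
    unfolding rate''_def by (intro continuous_on_mult continuous_on_add continuous_on_power continuous_on_const c)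
qed

lemma rate_deriv:
  "((\<lambda>x. rate n s x) has_real_derivative rate' n s x) (at x)"
  "((\<lambda>x. rate' n s x) has_real_derivative rate'' n s x) (at x)"
proof -
  have u: "((\<lambda>x. damp n s t * d t x) has_real_derivative damp n s t * d' t x) (at x)"
    and u': "((\<lambda>x. damp n s t * d' t x) has_real_derivative damp n s t * d'' t x) (at x)" for t x
    by (auto intro!: derivative_eq_intros d_deriv d'_deriv)
  note D = gain_deriv[where u = "\<lambda>x t. damp n s t * d t x" and u' = "\<lambda>x t. damp n s t * d' t x", OF u]
  note D' = lgain1_deriv[where u = "\<lambda>x t. damp n s t * d t x" and u' = "\<lambda>x t. damp n s t * d' t x"
      and u'' = "\<lambda>x t. damp n s t * d'' t x", OF u u']
  show "((\<lambda>x. rate n s x) has_real_derivative rate' n s x) (at x)"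
    unfolding rate_def rate'_def
    by (rule DERIV_cong[OF DERIV_mult[OF D d_deriv]]) (simp add: algebra_simps)
  show "((\<lambda>x. rate' n s x) has_real_derivative rate'' n s x) (at x)"
    unfolding rate'_def rate''_def
    by (rule DERIV_cong[OF DERIV_mult[OF D DERIV_add[OF DERIV_mult[OF D' d_deriv] d'_deriv]]])
      (simp add: algebra_simps power2_eq_square)
qed

text \<open>
  Differentiation under the integral sign; the integrands are jointly continuous in \<open>(x, s)\<close>.
\<close>

lemma integral_rate_deriv:
  "((\<lambda>x. integral {0..1} (\<lambda>s. rate n s x)) has_real_derivative integral {0..1} (\<lambda>s. rate' n s x)) (at x)"
  "((\<lambda>x. integral {0..1} (\<lambda>s. rate' n s x)) has_real_derivative integral {0..1} (\<lambda>s. rate'' n s x)) (at x)"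
proof -
  have "(\<lambda>s. rate n s x) integrable_on cbox 0 1" "(\<lambda>s. rate' n s x) integrable_on cbox 0 1" for x
    by (intro integrable_continuous rate_continuous continuous_on_id continuous_on_const)+
  moreover have "continuous_on (UNIV \<times> cbox 0 1) (\<lambda>(x, t). rate' n t x)"
    "continuous_on (UNIV \<times> cbox 0 1) (\<lambda>(x, t). rate'' n t x)"
    unfolding split_beta by (intro rate_continuous continuous_on_fst continuous_on_snd continuous_on_id)+
  ultimately show
    "((\<lambda>x. integral {0..1} (\<lambda>s. rate n s x)) has_real_derivative integral {0..1} (\<lambda>s. rate' n s x)) (at x)"
    "((\<lambda>x. integral {0..1} (\<lambda>s. rate' n s x)) has_real_derivative integral {0..1} (\<lambda>s. rate'' n s x)) (at x)"
    using leibniz_rule_field_derivative[of UNIV 0 1 "\<lambda>x s. rate n s x" "\<lambda>x s. rate' n s x" x]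
      leibniz_rule_field_derivative[of UNIV 0 1 "\<lambda>x s. rate' n s x" "\<lambda>x s. rate'' n s x" x]
      rate_deriv by auto
qed

lemma integral_rate'_0: "integral {0..1} (\<lambda>s. rate' n s 0) = memory 0 n * d' n 0"
  by (simp add: rate'_def d_zero gain_0)

text \<open>
  At \<open>x = 0\<close> the integrand is affine in \<open>s\<close>, because the damped observation enters the logarithmic
  derivative of the gain linearly. The factor \<open>1/2\<close> from integrating \<open>s\<close> cancels the 2 of the product rule; this
  is why the squares \<open>(d\<^sub>t')\<^sup>2\<close> occur once and the mixed products \<open>d\<^sub>s' d\<^sub>t'\<close> twice.
\<close>

lemma integral_rate''_0:
  "integral {0..1} (\<lambda>s. rate'' (Suc n) s 0) =
     memory 0 (Suc n) * (d'' (Suc n) 0 + skew 0 (Suc n) * (d' (Suc n) 0)\<^sup>2)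
     + 2 * (memory 0 (Suc n) * d' (Suc n) 0 * (\<Sum>j<n. skew 0 (Suc j) * d' (Suc j) 0))"
proof -
  define S where "S = (\<Sum>j<n. skew 0 (Suc j) * d' (Suc j) 0)"
  define D where "D = memory 0 (Suc n)"
  define a where "a = d' (Suc n) 0"
  define g where "g = skew 0 (Suc n)"
  have "lgain1 (\<lambda>_. 0) (\<lambda>t. damp (Suc n) s t * d' t 0) 0 (Suc n) = S + g * (s * a)" for s
    unfolding lgain1_0 by (simp add: damp_def S_def g_def a_def)
  then have eq: "rate'' (Suc n) s 0 = D * (2 * (S + g * (s * a)) * a + d'' (Suc n) 0)" for s
    by (simp add: rate''_def d_zero gain_0 D_def a_def del: lgain1.simps gain.simps)
  define F where "F s = D * (2 * (S * s + g * (s\<^sup>2 / 2 * a)) * a + d'' (Suc n) 0 * s)" for s :: real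
  have "((\<lambda>s. rate'' (Suc n) s 0) has_integral F 1 - F 0) {0..1}"
    unfolding eq F_def has_real_derivative_iff_has_vector_derivative[symmetric]
    by (intro fundamental_theorem_of_calculus)
      (auto simp: has_real_derivative_iff_has_vector_derivative[symmetric] intro!: derivative_eq_intros)
  then have "integral {0..1} (\<lambda>s. rate'' (Suc n) s 0) = F 1 - F 0" by (rule integral_unique)
  also have "\<dots> = D * (d'' (Suc n) 0 + g * a\<^sup>2) + 2 * (D * a * S)"
    by (simp add: F_def algebra_simps power2_eq_square)
  finally show ?thesis by (simp add: D_def S_def a_def g_def)
qed

text \<open>
  The increments of the log-odds and their first two derivatives are dominated, uniformly for \<open>\<bar>x\<bar> \<le> \<rho>\<close>, by one
  summable sequence. By the Weierstrass test their series may be differentiated termwise twice, and the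
  terms at 0 are known from \<open>integral_rate'_0\<close> and \<open>integral_rate''_0\<close>.
\<close>

theorem limit_derivatives:
  fixes B P :: "nat \<Rightarrow> real" and \<rho> :: real
  assumes "0 < \<rho>"
    and B: "mono B" "\<And>t. 1 \<le> B t"
    and bd: "\<And>t x. \<bar>x\<bar> \<le> \<rho> \<Longrightarrow> \<bar>d t x\<bar> \<le> B t" "\<And>t x. \<bar>x\<bar> \<le> \<rho> \<Longrightarrow> \<bar>d' t x\<bar> \<le> B t"
      "\<And>t x. \<bar>x\<bar> \<le> \<rho> \<Longrightarrow> \<bar>d'' t x\<bar> \<le> B t"
    and gain: "\<And>n s x. \<bar>x\<bar> \<le> \<rho> \<Longrightarrow> 0 \<le> s \<Longrightarrow> s \<le> 1 \<Longrightarrow> \<bar>gain (\<lambda>t. damp n s t * d t x) 0 0 n\<bar> \<le> P n"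
    and summ: "summable (\<lambda>n. P n * (8 * real n ^ 4 * B n ^ 3))"
  defines "r \<equiv> \<lambda>x. lim (\<lambda>n. traj (\<lambda>t. d t x) 0 0 n)"
    and "S1 \<equiv> \<lambda>n. memory 0 n * d' n 0"
    and "S2 \<equiv> \<lambda>n. memory 0 n * (d'' n 0 + skew 0 n * (d' n 0)\<^sup>2)"
    and "S3 \<equiv> \<lambda>n. memory 0 n * d' n 0 * (\<Sum>j<n - 1. skew 0 (Suc j) * d' (Suc j) 0)"
  shows "\<And>x. \<bar>x\<bar> < \<rho> \<Longrightarrow> convergent (\<lambda>n. traj (\<lambda>t. d t x) 0 0 n)"
    and "summable (\<lambda>n. S1 (Suc n))" "summable (\<lambda>n. S2 (Suc n))" "summable (\<lambda>n. S3 (Suc n))"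
    and "(r has_real_derivative (\<Sum>n. S1 (Suc n))) (at 0)"
    and "\<forall>\<^sub>F x in nhds 0. r differentiable at x"
    and "(deriv r has_real_derivative (\<Sum>n. S2 (Suc n)) + 2 * (\<Sum>n. S3 (Suc n))) (at 0)"
proof -
  define b where "b n = P (Suc n) * (8 * real (Suc n) ^ 4 * B (Suc n) ^ 3)" for n
  have b: "summable b"
    unfolding b_def using summable_Suc_iff[of "\<lambda>n. P n * (8 * real n ^ 4 * B n ^ 3)"] summ by (simp only:)
  define I where "I n x = integral {0..1} (\<lambda>s. rate (Suc n) s x)" for n x
  define I' where "I' n x = integral {0..1} (\<lambda>s. rate' (Suc n) s x)" for n x
  define I'' where "I'' n x = integral {0..1} (\<lambda>s. rate'' (Suc n) s x)" for n x
  have rate_bd: "\<bar>rate (Suc n) s x\<bar> \<le> b n \<and> \<bar>rate' (Suc n) s x\<bar> \<le> b n \<and> \<bar>rate'' (Suc n) s x\<bar> \<le> b n"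
    if x: "\<bar>x\<bar> \<le> \<rho>" and s: "0 \<le> s" "s \<le> 1" for n s x
  proof -
    define N where "N = real (Suc n)"
    define \<beta> where "\<beta> = B (Suc n)"
    define u where "u t = damp (Suc n) s t * d t x" for t
    define u' where "u' t = damp (Suc n) s t * d' t x" for t
    define u'' where "u'' t = damp (Suc n) s t * d'' t x" for t
    have \<beta>: "1 \<le> \<beta>" using B by (simp add: \<beta>_def)
    have N: "1 \<le> N" by (simp add: N_def)
    have g: "\<bar>gain u 0 0 (Suc n)\<bar> \<le> P (Suc n)" unfolding u_def by (rule gain[OF x s])
    have damp: "\<bar>damp (Suc n) s t * y\<bar> \<le> \<bar>y\<bar>" for t y
      using s by (auto simp: damp_def abs_mult mult_left_le_one_le)
    have u'b: "\<bar>u' t\<bar> \<le> \<beta> \<and> \<bar>u'' t\<bar> \<le> \<beta>" if "t \<le> 0 + Suc n" for t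
      using damp[of t "d' t x"] damp[of t "d'' t x"] bd(2,3)[OF x, of t] monoD[OF B(1), of t "Suc n"] that
      unfolding u'_def u''_def \<beta>_def by auto
    define E where "E = lgain1 u u' 0 (Suc n)"
    define E' where "E' = lgain2 u u' u'' 0 (Suc n)"
    have E: "\<bar>E\<bar> \<le> N\<^sup>2 * \<beta>" unfolding E_def N_def by (rule lgain1_abs_le) (use u'b \<beta> in auto)
    have E': "\<bar>E'\<bar> \<le> 4 * N ^ 4 * \<beta>\<^sup>2" unfolding E'_def N_def by (rule lgain2_abs_le) (use u'b \<beta> in auto)
    have E2: "E\<^sup>2 \<le> N ^ 4 * \<beta>\<^sup>2"
      using power_mono[OF E, of 2] by (simp add: power_mult_distrib flip: power_mult)
    define dd where "dd = d (Suc n) x"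
    define dd' where "dd' = d' (Suc n) x"
    define dd'' where "dd'' = d'' (Suc n) x"
    have dd: "\<bar>dd\<bar> \<le> \<beta>" "\<bar>dd'\<bar> \<le> \<beta>" "\<bar>dd''\<bar> \<le> \<beta>"
      unfolding dd_def dd'_def dd''_def \<beta>_def using bd x by auto
    have \<beta>p: "\<beta> \<le> \<beta>\<^sup>2" "\<beta>\<^sup>2 \<le> \<beta> ^ 3" "\<beta> \<le> \<beta> ^ 3" "0 \<le> \<beta>"
      using \<beta> power_increasing[of 1 2 \<beta>] power_increasing[of 2 3 \<beta>] power_increasing[of 1 3 \<beta>] by auto
    have Np: "N\<^sup>2 \<le> N ^ 4" "1 \<le> N ^ 4" using N by (auto intro: power_increasing one_le_power)
    define Q where "Q = N ^ 4 * \<beta> ^ 3"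
    have Q1: "\<beta> \<le> Q" "N\<^sup>2 * \<beta>\<^sup>2 \<le> Q"
    proof -
      show "\<beta> \<le> Q" unfolding Q_def using mult_mono[OF Np(2) \<beta>p(3)] Np \<beta>p by auto
      show "N\<^sup>2 * \<beta>\<^sup>2 \<le> Q" unfolding Q_def using Np \<beta>p by (intro mult_mono) auto
    qed
    have Ed: "\<bar>E * z\<bar> \<le> Q" if "\<bar>z\<bar> \<le> \<beta>" for z
    proof -
      have "\<bar>E * z\<bar> \<le> (N\<^sup>2 * \<beta>) * \<beta>"
        unfolding abs_mult by (rule mult_mono[OF E that]) (use \<beta>p in auto)
      also have "\<dots> = N\<^sup>2 * \<beta>\<^sup>2" by (simp add: power2_eq_square)
      finally show ?thesis using Q1 by simp
    qed
    have E2d: "\<bar>(E\<^sup>2 + E') * dd\<bar> \<le> 5 * Q"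
    proof -
      have "\<bar>E\<^sup>2 + E'\<bar> \<le> \<bar>E\<^sup>2\<bar> + \<bar>E'\<bar>" by (rule abs_triangle_ineq)
      also have "\<dots> \<le> 5 * N ^ 4 * \<beta>\<^sup>2" using E2 E' by simp
      finally have *: "\<bar>E\<^sup>2 + E'\<bar> \<le> 5 * N ^ 4 * \<beta>\<^sup>2" .
      have "\<bar>(E\<^sup>2 + E') * dd\<bar> \<le> (5 * N ^ 4 * \<beta>\<^sup>2) * \<beta>"
        unfolding abs_mult by (rule mult_mono[OF * dd(1)]) (use N in auto)
      then show ?thesis by (simp add: Q_def power2_eq_square power3_eq_cube)
    qed
    have gb: "\<bar>gain u 0 0 (Suc n) * z\<bar> \<le> b n" if "\<bar>z\<bar> \<le> 8 * Q" for z
    proof -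
      have "\<bar>gain u 0 0 (Suc n) * z\<bar> \<le> P (Suc n) * (8 * Q)"
        unfolding abs_mult by (rule mult_mono[OF g that]) (use g in auto)
      then show ?thesis by (simp only: b_def Q_def N_def \<beta>_def mult.assoc)
    qed
    have "\<bar>dd\<bar> \<le> 8 * Q" "\<bar>E * dd + dd'\<bar> \<le> 8 * Q" "\<bar>(E\<^sup>2 + E') * dd + 2 * E * dd' + dd''\<bar> \<le> 8 * Q"
      using dd Q1 Ed[OF dd(1)] Ed[OF dd(2)] E2d by (simp_all add: mult.assoc)
    from this[THEN gb] show ?thesis
      unfolding rate_def rate'_def rate''_def u_def u'_def u''_def E_def E'_def dd_def dd'_def dd''_def
      by simp
  qed
  have I_bd: "\<bar>I n x\<bar> \<le> b n" "\<bar>I' n x\<bar> \<le> b n" "\<bar>I'' n x\<bar> \<le> b n" if x: "\<bar>x\<bar> \<le> \<rho>" for n x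
    unfolding I_def I'_def I''_def
    using integral_bound[where a = 0 and b = 1 and B = "b n" and f = "\<lambda>s. rate (Suc n) s x"]
      integral_bound[where a = 0 and b = 1 and B = "b n" and f = "\<lambda>s. rate' (Suc n) s x"]
      integral_bound[where a = 0 and b = 1 and B = "b n" and f = "\<lambda>s. rate'' (Suc n) s x"]
      rate_bd[OF x] rate_continuous[OF continuous_on_id continuous_on_const, of _ "Suc n" x] by auto
  have traj_sum: "traj (\<lambda>t. d t x) 0 0 n = (\<Sum>i<n. I i x)" for n x
  proof (induction n)
    case (Suc n)
    have "I n x = traj (\<lambda>t. d t x) 0 0 (Suc n) - traj (\<lambda>t. d t x) 0 0 n"
      unfolding I_def by (rule integral_unique[OF increment])
    then show ?case using Suc by simp
  qed simp
  have I_sum: "summable (\<lambda>n. I n x)" if "\<bar>x\<bar> \<le> \<rho>" for x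
    by (rule summable_comparison_test'[OF b]) (use I_bd[OF that] in auto)
  show conv: "convergent (\<lambda>n. traj (\<lambda>t. d t x) 0 0 n)" if "\<bar>x\<bar> < \<rho>" for x
    unfolding traj_sum using I_sum[of x] that by (simp add: summable_iff_convergent)
  have r_eq: "r x = (\<Sum>n. I n x)" for x
    unfolding r_def traj_sum by (simp add: suminf_eq_lim)
  define S where "S = {- \<rho> .. \<rho>}"
  have S: "convex S" "0 \<in> S" "interior S = {- \<rho> <..< \<rho>}" using \<open>0 < \<rho>\<close>
    by (auto simp: S_def interior_atLeastAtMost_real)
  have uc: "uniformly_convergent_on S (\<lambda>n x. \<Sum>i<n. I' i x)" "uniformly_convergent_on S (\<lambda>n x. \<Sum>i<n. I'' i x)"
    by (rule Weierstrass_m_test'[OF _ b]; use I_bd in \<open>auto simp: S_def abs_le_iff\<close>)+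
  have der_r: "(r has_real_derivative (\<Sum>n. I' n x)) (at x)" if "\<bar>x\<bar> < \<rho>" for x
    unfolding r_eq[abs_def]
    by (rule has_field_derivative_series'(2)[OF S(1) _ uc(1) S(2)])
      (use that \<open>0 < \<rho>\<close> in \<open>auto simp: S(3) I_def I'_def abs_less_iff intro!: has_field_derivative_at_within integral_rate_deriv I_sum[unfolded I_def]\<close>)
  have der_r': "((\<lambda>x. \<Sum>n. I' n x) has_real_derivative (\<Sum>n. I'' n x)) (at x)" if "\<bar>x\<bar> < \<rho>" for x
  proof (rule has_field_derivative_series'(2)[OF S(1) _ uc(2) S(2)])
    show "summable (\<lambda>n. I' n 0)"
      by (rule summable_comparison_test'[OF b]) (use I_bd[of 0] \<open>0 < \<rho>\<close> in auto)
  qed (use that in \<open>auto simp: S(3) I'_def I''_def abs_less_iff intro!: has_field_derivative_at_within integral_rate_deriv\<close>)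
  have I'0: "I' n 0 = S1 (Suc n)" for n by (simp add: I'_def S1_def integral_rate'_0)
  have I''0: "I'' n 0 = S2 (Suc n) + 2 * S3 (Suc n)" for n
    by (simp add: I''_def S2_def S3_def integral_rate''_0)
  show "summable (\<lambda>n. S1 (Suc n))"
    by (rule summable_comparison_test'[OF b]) (use I_bd[of 0] \<open>0 < \<rho>\<close> in \<open>auto simp flip: I'0\<close>)
  show S2: "summable (\<lambda>n. S2 (Suc n))"
  proof (rule summable_comparison_test'[OF b])
    fix n
    define \<beta> where "\<beta> = B (Suc n)"
    have \<beta>: "1 \<le> \<beta>" using B by (simp add: \<beta>_def)
    have \<beta>p: "\<beta> \<le> \<beta>\<^sup>2" "\<beta>\<^sup>2 \<le> \<beta> ^ 3" "\<beta> \<le> \<beta> ^ 3" "0 \<le> \<beta>"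
      using \<beta> power_increasing[of 1 2 \<beta>] power_increasing[of 2 3 \<beta>] power_increasing[of 1 3 \<beta>] by auto
    have g: "\<bar>memory 0 (Suc n)\<bar> \<le> P (Suc n)"
      using gain[of 0 0 "Suc n"] \<open>0 < \<rho>\<close> by (simp add: d_zero gain_0 del: gain.simps)
    have dd: "\<bar>d' (Suc n) 0\<bar> \<le> \<beta>" "\<bar>d'' (Suc n) 0\<bar> \<le> \<beta>" using bd(2,3)[of 0 "Suc n"] \<open>0 < \<rho>\<close> by (auto simp: \<beta>_def)
    have "\<bar>skew 0 (Suc n) * (d' (Suc n) 0)\<^sup>2\<bar> \<le> 1 * \<beta>\<^sup>2"
      unfolding abs_mult using skew_abs_le power_mono[OF dd(1), of 2] by (intro mult_mono) auto
    then have "\<bar>d'' (Suc n) 0 + skew 0 (Suc n) * (d' (Suc n) 0)\<^sup>2\<bar> \<le> 8 * \<beta> ^ 3"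
      using dd \<beta>p by linarith
    also have "\<dots> \<le> 8 * real (Suc n) ^ 4 * \<beta> ^ 3"
      using \<beta> by (intro mult_right_mono) auto
    finally show "norm (S2 (Suc n)) \<le> b n"
      unfolding S2_def b_def real_norm_def abs_mult \<beta>_def[symmetric]
      by (intro mult_mono) (use g in auto)
  qed
  have I'': "summable (\<lambda>n. I'' n 0)"
    by (rule summable_comparison_test'[OF b]) (use I_bd[of 0] \<open>0 < \<rho>\<close> in auto)
  \<comment> \<open>The double sum inherits summability from the sum of both parts.\<close>
  have "summable (\<lambda>n. (I'' n 0 - S2 (Suc n)) / 2)"
    by (intro summable_divide summable_diff I'' S2)
  then show S3: "summable (\<lambda>n. S3 (Suc n))" by (simp add: I''0)
  show "(r has_real_derivative (\<Sum>n. S1 (Suc n))) (at 0)"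
    using der_r[of 0] \<open>0 < \<rho>\<close> by (simp add: I'0)
  have ev: "\<forall>\<^sub>F x in nhds 0. \<bar>x\<bar> < \<rho>"
    using eventually_nhds_metric[of "\<lambda>x. \<bar>x\<bar> < \<rho>" "0::real"] \<open>0 < \<rho>\<close> by (auto simp: dist_real_def)
  then show "\<forall>\<^sub>F x in nhds 0. r differentiable at x"
    by eventually_elim (use der_r real_differentiable_def in blast)
  have "(\<Sum>n. I'' n 0) = (\<Sum>n. S2 (Suc n)) + 2 * (\<Sum>n. S3 (Suc n))"
    unfolding I''0 by (subst suminf_add[symmetric]) (auto intro!: S2 S3 summable_mult suminf_mult)
  moreover have "\<forall>\<^sub>F x in nhds 0. deriv r x = (\<Sum>n. I' n x)"
    using ev by eventually_elim (use der_r DERIV_imp_deriv in blast)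
  ultimately show "(deriv r has_real_derivative (\<Sum>n. S2 (Suc n)) + 2 * (\<Sum>n. S3 (Suc n))) (at 0)"
    using der_r'[of 0] \<open>0 < \<rho>\<close> by (subst DERIV_cong_ev[OF refl _ refl]) auto
qed

end

section \<open>Exponential forgetting along one realization\<close>

text \<open>
  The gain factors over consecutive blocks of \<open>\<kappa>\<close> steps, each factor evaluated at a terminal value produced by
  the later blocks. Hence the block bound has to be uniform in the terminal value; the remaining
  \<open>n mod \<kappa>\<close> steps do not expand.
\<close>

lemma (in binary_kernels) gain_block_bound:
  assumes block: "\<And>i y. (\<forall>t. i < t \<and> t \<le> i + \<kappa> \<longrightarrow> W t \<le> K) \<Longrightarrow> \<bar>gain u y i \<kappa>\<bar> \<le> c"
    and "1 \<le> \<kappa>"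
  shows "\<bar>gain u y 0 n\<bar> \<le>
    (\<Prod>j<n div \<kappa>. if \<forall>t. j * \<kappa> < t \<and> t \<le> j * \<kappa> + \<kappa> \<longrightarrow> W t \<le> K then c else 1)"
proof -
  let ?fac = "\<lambda>j. if \<forall>t. j * \<kappa> < t \<and> t \<le> j * \<kappa> + \<kappa> \<longrightarrow> W t \<le> K then c else 1"
  have fac: "\<bar>gain u y (j * \<kappa>) \<kappa>\<bar> \<le> ?fac j" for j y
    using block[of "j * \<kappa>" y] gain_abs_le_1 by auto
  have whole: "\<bar>gain u y 0 (m * \<kappa>)\<bar> \<le> (\<Prod>j<m. ?fac j)" for m y
  proof (induction m arbitrary: y)
    case (Suc m)
    have "gain u y 0 (Suc m * \<kappa>) = gain u (traj u y (m * \<kappa>) \<kappa>) 0 (m * \<kappa>) * gain u y (m * \<kappa>) \<kappa>"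
      using gain_split[of u y 0 "m * \<kappa>" \<kappa>] by (simp add: add.commute)
    then have "\<bar>gain u y 0 (Suc m * \<kappa>)\<bar> \<le> (\<Prod>j<m. ?fac j) * ?fac m"
      unfolding abs_mult by (simp only: abs_mult) (rule mult_mono[OF Suc fac _ abs_ge_zero], rule order_trans[OF abs_ge_zero Suc])
    then show ?case by simp
  qed simp
  have "gain u y 0 n = gain u (traj u y (n div \<kappa> * \<kappa>) (n mod \<kappa>)) 0 (n div \<kappa> * \<kappa>) * gain u y (n div \<kappa> * \<kappa>) (n mod \<kappa>)"
    using gain_split[of u y 0 "n div \<kappa> * \<kappa>" "n mod \<kappa>"] by simp
  then have "\<bar>gain u y 0 n\<bar> \<le> \<bar>gain u (traj u y (n div \<kappa> * \<kappa>) (n mod \<kappa>)) 0 (n div \<kappa> * \<kappa>)\<bar>"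
    using gain_abs_le_1 by (simp add: abs_mult mult_left_le)
  also note whole
  finally show ?thesis .
qed

lemma eventually_le_imp_bounded:
  fixes a b :: "nat \<Rightarrow> real"
  assumes "eventually (\<lambda>n. a n \<le> b n) sequentially" and b: "\<And>n. 0 < b n"
  obtains C where "1 \<le> C" "\<And>n. a n \<le> C * b n"
proof -
  obtain N where N: "\<And>n. N \<le> n \<Longrightarrow> a n \<le> b n" using assms(1) unfolding eventually_sequentially by auto
  define C where "C = 1 + (\<Sum>n<N. \<bar>a n\<bar> / b n)"
  have s: "0 \<le> (\<Sum>n<N. \<bar>a n\<bar> / b n)" using b by (intro sum_nonneg) (simp add: less_imp_le)
  have "a n \<le> C * b n" for n
  proof (cases "N \<le> n")
    case True
    have "1 * b n \<le> C * b n" using s b[of n] unfolding C_def by (intro mult_right_mono) auto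
    with N[OF True] show ?thesis by simp
  next
    case False
    have "\<bar>a n\<bar> / b n \<le> (\<Sum>n<N. \<bar>a n\<bar> / b n)"
      by (rule member_le_sum) (use False b in \<open>auto simp: less_imp_le\<close>)
    then have "\<bar>a n\<bar> / b n \<le> C" by (simp add: C_def)
    then have "\<bar>a n\<bar> \<le> C * b n" using b[of n] by (simp add: divide_simps)
    then show ?thesis by simp
  qed
  moreover have "1 \<le> C" using s by (simp add: C_def)
  ultimately show ?thesis using that by blast
qed

lemma summable_power4_exp:
  fixes \<gamma> :: real
  assumes "0 < \<gamma>"
  shows "summable (\<lambda>n. real n ^ 4 * exp (- \<gamma> * real n))"
proof (rule summable_comparison_test')
  show "summable (\<lambda>n. (8 / \<gamma>) ^ 4 * exp (- \<gamma> / 2) ^ n)"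
    using assms by (intro summable_mult summable_geometric) simp
  fix n :: nat
  have "\<gamma> * real n / 8 \<le> exp (\<gamma> * real n / 8)"
    using exp_ge_add_one_self[of "\<gamma> * real n / 8"] by linarith
  then have "(\<gamma> * real n / 8) ^ 4 \<le> exp (\<gamma> * real n / 8) ^ 4"
    using assms by (intro power_mono) auto
  also have "\<dots> = exp (\<gamma> * real n / 2)" by (simp flip: exp_of_nat_mult)
  finally have "real n ^ 4 \<le> (8 / \<gamma>) ^ 4 * exp (\<gamma> * real n / 2)"
    using assms by (simp add: field_simps power_mult_distrib power_divide)
  then have "real n ^ 4 * exp (- \<gamma> * real n) \<le> (8 / \<gamma>) ^ 4 * exp (\<gamma> * real n / 2) * exp (- \<gamma> * real n)"
    by (intro mult_right_mono) auto
  also have "\<dots> = (8 / \<gamma>) ^ 4 * exp (- \<gamma> / 2) ^ n"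
    by (simp add: mult.assoc flip: exp_add exp_of_nat_mult)
  finally show "norm (real n ^ 4 * exp (- \<gamma> * real n)) \<le> (8 / \<gamma>) ^ 4 * exp (- \<gamma> / 2) ^ n" by simp
qed

text \<open>
  If the block products decay like \<open>lam ^ m\<close>, the gain over \<open>n\<close> steps decays like \<open>exp (- 4 \<gamma> n)\<close> for the \<open>\<gamma>\<close> of the
  growth assumption. The third power of the bound \<open>A exp (\<gamma> t)\<close> on the observations leaves the
  summable majorant \<open>n\<^sup>4 exp (- \<gamma> n)\<close>.
\<close>

lemma (in smooth_observations) tame_bounds:
  fixes W :: "nat \<Rightarrow> real"
  assumes "0 < \<rho>" "1 \<le> \<kappa>" "0 < \<phi>" "0 \<le> K"
    and mix: "\<And>i b c. b \<le> 1 \<Longrightarrow> c \<le> 1 \<Longrightarrow> \<phi> \<le> lik (\<lambda>_ _. 1) (\<lambda>b'. of_bool (b' = b)) i \<kappa> c"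
    and W: "\<And>t. 0 \<le> W t"
      "\<And>t x. \<bar>x\<bar> \<le> \<rho> \<Longrightarrow> \<bar>d' t x\<bar> \<le> 2 * W t" "\<And>t x. \<bar>x\<bar> \<le> \<rho> \<Longrightarrow> \<bar>d'' t x\<bar> \<le> 2 * W t"
    and c: "1 - (exp (- (2 * \<rho> * K)) ^ \<kappa> * \<phi>)\<^sup>2 / (exp (2 * \<rho> * K) ^ \<kappa>)\<^sup>2 \<le> c"
    and lam: "0 < lam" "lam < 1"
    and blocks: "\<forall>\<^sub>F m in sequentially.
      (\<Prod>j<m. if \<forall>t. j * \<kappa> < t \<and> t \<le> j * \<kappa> + \<kappa> \<longrightarrow> W t \<le> K then c else 1) \<le> lam ^ m"
    and growth: "\<forall>\<^sub>F t in sequentially. W t \<le> exp (- ln lam / (4 * real \<kappa>) * real t)"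
  obtains B P :: "nat \<Rightarrow> real" where "mono B" "\<And>t. 1 \<le> B t"
    "\<And>t x. \<bar>x\<bar> \<le> \<rho> \<Longrightarrow> \<bar>d t x\<bar> \<le> B t" "\<And>t x. \<bar>x\<bar> \<le> \<rho> \<Longrightarrow> \<bar>d' t x\<bar> \<le> B t"
    "\<And>t x. \<bar>x\<bar> \<le> \<rho> \<Longrightarrow> \<bar>d'' t x\<bar> \<le> B t"
    "\<And>n s x. \<bar>x\<bar> \<le> \<rho> \<Longrightarrow> 0 \<le> s \<Longrightarrow> s \<le> 1 \<Longrightarrow> \<bar>gain (\<lambda>t. damp n s t * d t x) 0 0 n\<bar> \<le> P n"
    "summable (\<lambda>n. P n * (8 * real n ^ 4 * B n ^ 3))"
proof -
  define \<gamma> where "\<gamma> = - ln lam / (4 * real \<kappa>)"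
  have \<gamma>: "0 < \<gamma>" using lam \<open>1 \<le> \<kappa>\<close> by (auto simp: \<gamma>_def intro!: divide_neg_pos)
  let ?fac = "\<lambda>j. if \<forall>t. j * \<kappa> < t \<and> t \<le> j * \<kappa> + \<kappa> \<longrightarrow> W t \<le> K then c else 1"
  obtain C where C: "1 \<le> C" "\<And>t. W t \<le> C * exp (\<gamma> * real t)"
    using eventually_le_imp_bounded[OF growth[folded \<gamma>_def]] by auto
  obtain C' where C': "1 \<le> C'" "\<And>m. (\<Prod>j<m. ?fac j) \<le> C' * lam ^ m"
    using eventually_le_imp_bounded[OF blocks] lam by auto
  define A where "A = 2 * (1 + \<rho>) * C"
  have A: "2 * C \<le> A" "2 * \<rho> * C \<le> A" "1 \<le> A"
  proof -
    have "0 < \<rho> * C" using \<open>1 \<le> C\<close> \<open>0 < \<rho>\<close> by simp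
    moreover have "A = 2 * C + 2 * (\<rho> * C)" by (simp add: A_def algebra_simps)
    ultimately show "2 * C \<le> A" "2 * \<rho> * C \<le> A" "1 \<le> A" using \<open>1 \<le> C\<close> by linarith+
  qed
  define B where "B t = A * exp (\<gamma> * real t)" for t
  define P where "P n = (C' / lam) * exp (- 4 * \<gamma> * real n)" for n
  \<comment> \<open>The observations vanish at 0, so the bound on \<open>d'\<close> also controls \<open>d\<close> itself.\<close>
  have d_le: "\<bar>d t x\<bar> \<le> 2 * \<rho> * W t" if x: "\<bar>x\<bar> \<le> \<rho>" for t x
  proof -
    have "norm (d t x - d t 0) \<le> (2 * W t) * norm (x - 0)"
      by (rule field_differentiable_bound[where S = "{- \<rho>..\<rho>}" and f' = "d' t"])
        (use x \<open>0 < \<rho>\<close> W(2) in \<open>auto simp: abs_le_iff intro!: has_field_derivative_at_within d_deriv\<close>)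
    also have "\<dots> \<le> (2 * W t) * \<rho>" using x W(1)[of t] by (intro mult_left_mono) auto
    finally show ?thesis by (simp add: d_zero mult_ac)
  qed
  have WB: "2 * W t \<le> B t" "2 * \<rho> * W t \<le> B t" for t
  proof -
    have "2 * W t \<le> 2 * C * exp (\<gamma> * real t)" using C(2)[of t] by simp
    also have "\<dots> \<le> B t" unfolding B_def using A(1) by (intro mult_right_mono) auto
    finally show "2 * W t \<le> B t" .
    have "2 * \<rho> * W t \<le> 2 * \<rho> * (C * exp (\<gamma> * real t))"
      using C(2)[of t] \<open>0 < \<rho>\<close> by (intro mult_left_mono) auto
    also have "\<dots> = 2 * \<rho> * C * exp (\<gamma> * real t)" by simp
    also have "\<dots> \<le> B t" unfolding B_def using A(2) by (intro mult_right_mono) auto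
    finally show "2 * \<rho> * W t \<le> B t" .
  qed
  show ?thesis
  proof (rule that[of B P])
    show "mono B" unfolding mono_def B_def using \<gamma> A by (auto intro!: mult_left_mono)
    show "1 \<le> B t" for t
      using mult_mono[of 1 A 1 "exp (\<gamma> * real t)"] A \<gamma> by (simp add: B_def)
    show "\<bar>d t x\<bar> \<le> B t" if "\<bar>x\<bar> \<le> \<rho>" for t x using d_le[OF that, of t] WB(2)[of t] by linarith
    show "\<bar>d' t x\<bar> \<le> B t" if "\<bar>x\<bar> \<le> \<rho>" for t x using W(2)[OF that, of t] WB(1)[of t] by linarith
    show "\<bar>d'' t x\<bar> \<le> B t" if "\<bar>x\<bar> \<le> \<rho>" for t x using W(3)[OF that, of t] WB(1)[of t] by linarith
    show "\<bar>gain (\<lambda>t. damp n s t * d t x) 0 0 n\<bar> \<le> P n" if x: "\<bar>x\<bar> \<le> \<rho>" and s: "0 \<le> s" "s \<le> 1" for n s x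
    proof -
      have block: "\<bar>gain (\<lambda>t. damp n s t * d t x) y i \<kappa>\<bar> \<le> c"
        if good: "\<forall>t. i < t \<and> t \<le> i + \<kappa> \<longrightarrow> W t \<le> K" for i y
      proof (rule order_trans[OF gain_contraction c])
        fix t assume "i < t" "t \<le> i + \<kappa>"
        then have "2 * \<rho> * W t \<le> 2 * \<rho> * K" using good \<open>0 < \<rho>\<close> by (intro mult_left_mono) auto
        moreover have "\<bar>damp n s t * d t x\<bar> \<le> \<bar>d t x\<bar>"
          using s by (auto simp: damp_def abs_mult mult_left_le_one_le)
        ultimately show "\<bar>damp n s t * d t x\<bar> \<le> 2 * \<rho> * K" using d_le[OF x, of t] by linarith
      qed (use mix \<open>0 < \<phi>\<close> in auto)
      have "\<bar>gain (\<lambda>t. damp n s t * d t x) 0 0 n\<bar> \<le> (\<Prod>j<n div \<kappa>. ?fac j)"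
        by (rule gain_block_bound[OF block \<open>1 \<le> \<kappa>\<close>])
      also have "\<dots> \<le> C' * lam ^ (n div \<kappa>)" by (rule C'(2))
      also have "lam ^ (n div \<kappa>) \<le> exp (- 4 * \<gamma> * real n) / lam"
      proof -
        have "real n < real \<kappa> * (real (n div \<kappa>) + 1)"
        proof -
          have "n < \<kappa> * (n div \<kappa> + 1)" using \<open>1 \<le> \<kappa>\<close>
            by (metis Suc_eq_plus1 dividend_less_times_div less_le_trans mult_Suc_right not_one_le_zero zero_less_iff_neq_zero add.commute order_refl)
          then show ?thesis by (metis of_nat_1 of_nat_add of_nat_less_iff of_nat_mult)
        qed
        then have "real n / real \<kappa> \<le> real (n div \<kappa>) + 1" using \<open>1 \<le> \<kappa>\<close> by (simp add: field_simps)
        then have "(real (n div \<kappa>) + 1) * ln lam \<le> real n / real \<kappa> * ln lam"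
          using lam by (intro mult_right_mono_neg) auto
        then have "real (n div \<kappa>) * ln lam \<le> - 4 * \<gamma> * real n - ln lam"
          using \<open>1 \<le> \<kappa>\<close> by (simp add: \<gamma>_def algebra_simps)
        then have "exp (real (n div \<kappa>) * ln lam) \<le> exp (- 4 * \<gamma> * real n - ln lam)" by simp
        then show ?thesis using lam by (simp add: exp_of_nat_mult exp_diff)
      qed
      finally show ?thesis using C' by (simp add: P_def)
    qed
    have "summable (\<lambda>n. (8 * (C' / lam) * A ^ 3) * (real n ^ 4 * exp (- \<gamma> * real n)))"
      by (intro summable_mult summable_power4_exp \<gamma>)
    moreover have "P n * (8 * real n ^ 4 * B n ^ 3) = (8 * (C' / lam) * A ^ 3) * (real n ^ 4 * exp (- \<gamma> * real n))" for n
    proof -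
      have "exp (- 4 * \<gamma> * real n) * exp (\<gamma> * real n) ^ 3 = exp (- \<gamma> * real n)"
        by (simp flip: exp_of_nat_mult exp_add)
      then show ?thesis by (simp add: P_def B_def power_mult_distrib)
    qed
    ultimately show "summable (\<lambda>n. P n * (8 * real n ^ 4 * B n ^ 3))" by simp
  qed
qed

section \<open>Likelihoods of a two-state Markov chain\<close>

lemma trans_prob_bounds: "0 \<le> trans_prob M \<eta> s t a b" "prob_space M \<Longrightarrow> trans_prob M \<eta> s t a b \<le> 1"
proof -
  show "0 \<le> trans_prob M \<eta> s t a b" by (simp add: trans_prob_def cond_prob_def)
  assume "prob_space M"
  then interpret prob_space M .
  show "trans_prob M \<eta> s t a b \<le> 1"
  proof (cases "{\<omega> \<in> space M. \<eta> s \<omega> = a} \<in> events")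
    case True
    then have "prob {\<omega> \<in> space M. \<eta> t \<omega> = b \<and> \<eta> s \<omega> = a} \<le> prob {\<omega> \<in> space M. \<eta> s \<omega> = a}"
      by (intro finite_measure_mono) auto
    then show ?thesis by (auto simp: trans_prob_def cond_prob_def divide_simps zero_less_measure_iff)
  next
    case False
    then show ?thesis by (simp add: trans_prob_def cond_prob_def measure_notin_sets)
  qed
qed

text \<open>
  The Markov property is stated with joint probabilities rather than conditional ones, which spares the
  distinction of null events and carries over to processes with the same law.
\<close>

locale binary_markov = prob_space M for M :: "'w measure" +
  fixes X :: "int \<Rightarrow> 'w \<Rightarrow> nat" and q :: "int \<Rightarrow> nat \<Rightarrow> real"
  assumes X_rv: "\<And>t. X t \<in> measurable M (count_space {0, 1})"
    and q_bounds: "\<And>t c. 0 \<le> q t c" "\<And>t c. q t c \<le> 1"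
    and one_step: "\<And>s t x. s \<le> t \<Longrightarrow>
      prob {\<omega> \<in> space M. (\<forall>i\<in>{s..t}. X i \<omega> = x i) \<and> X (t + 1) \<omega> = 1}
        = prob {\<omega> \<in> space M. \<forall>i\<in>{s..t}. X i \<omega> = x i} * q (t + 1) (x t)"
begin

lemma X_cases: "\<omega> \<in> space M \<Longrightarrow> X t \<omega> = 0 \<or> X t \<omega> = 1"
  using measurable_space[OF X_rv[of t]] by auto

definition window :: "int \<Rightarrow> int \<Rightarrow> (int \<Rightarrow> nat) \<Rightarrow> 'w set" where
  "window s t x = {\<omega> \<in> space M. \<forall>i\<in>{s..t}. X i \<omega> = x i}"

lemma X_event: "{\<omega> \<in> space M. X t \<omega> = b} \<in> events"
proof -
  have "X t -` ({b} \<inter> {0, 1}) \<inter> space M \<in> events" by (rule measurable_sets[OF X_rv]) auto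
  moreover have "X t -` ({b} \<inter> {0, 1}) \<inter> space M = {\<omega> \<in> space M. X t \<omega> = b}" using X_cases by auto
  ultimately show ?thesis by simp
qed

lemma window_event: "window s t x \<in> events"
  unfolding window_def by (rule sets.sets_Collect_finite_All) (auto simp: X_event)

lemma window_Suc:
  assumes "s \<le> t" "b \<le> 1"
  shows "prob (window s (t + 1) (x(t + 1 := b))) =
     prob (window s t x) * (if b = 1 then q (t + 1) (x t) else 1 - q (t + 1) (x t))"
proof -
  have w: "window s (t + 1) (x(t + 1 := b)) = {\<omega> \<in> space M. (\<forall>i\<in>{s..t}. X i \<omega> = x i) \<and> X (t + 1) \<omega> = b}" for b
  proof -
    have "{s..t + 1} = insert (t + 1) {s..t}" using \<open>s \<le> t\<close> by auto
    then show ?thesis by (auto simp: window_def)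
  qed
  have 1: "prob (window s (t + 1) (x(t + 1 := 1))) = prob (window s t x) * q (t + 1) (x t)"
    unfolding w unfolding window_def by (rule one_step[OF \<open>s \<le> t\<close>])
  have "window s t x = window s (t + 1) (x(t + 1 := 1)) \<union> window s (t + 1) (x(t + 1 := 0))"
    unfolding w unfolding window_def using X_cases[of _ "t + 1"] by blast
  moreover have "window s (t + 1) (x(t + 1 := 1)) \<inter> window s (t + 1) (x(t + 1 := 0)) = {}"
    unfolding w by auto
  ultimately have "prob (window s t x) = prob (window s (t + 1) (x(t + 1 := 1))) + prob (window s (t + 1) (x(t + 1 := 0)))"
    using finite_measure_Union[OF window_event window_event] by simp
  with 1 assms(2) show ?thesis by (cases b) (auto simp: algebra_simps)
qed

sublocale binary_kernels "\<lambda>t. q (int t)"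
  by unfold_locales (simp_all add: q_bounds)

text \<open>
  The backward recursion: splitting the event according to the next state extends the observed window by
  one time, and the Markov property supplies the transition probability. The window is kept in the
  statement because the Markov property conditions on the whole past, not just on the last state.
\<close>

lemma lik_integral:
  assumes "s \<le> int i"
  shows "has_bochner_integral M
    (\<lambda>\<omega>. indicator (window s (int i) x) \<omega> * ((\<Prod>t = Suc i..i + k. w t (X (int t) \<omega>)) * v (X (int (i + k)) \<omega>)))
    (prob (window s (int i) x) * lik w v i k (x (int i)))"
  using assms
proof (induction k arbitrary: i x)
  case 0
  have "has_bochner_integral M (\<lambda>\<omega>. indicator (window s (int i) x) \<omega> * v (x (int i)))
      (prob (window s (int i) x) * v (x (int i)))"
    by (intro has_bochner_integral_mult_left has_bochner_integral_real_indicator window_event)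
      (auto simp: emeasure_eq_measure)
  moreover have "(\<lambda>\<omega>. indicator (window s (int i) x) \<omega> * v (x (int i))) =
      (\<lambda>\<omega>. indicator (window s (int i) x) \<omega> * v (X (int i) \<omega>))"
  proof
    fix \<omega>
    have "X (int i) \<omega> = x (int i)" if "\<omega> \<in> window s (int i) x"
      using that 0 by (simp add: window_def)
    then show "indicator (window s (int i) x) \<omega> * v (x (int i)) = indicator (window s (int i) x) \<omega> * v (X (int i) \<omega>)"
      by (simp add: indicator_def)
  qed
  ultimately show ?case by simp
next
  case (Suc k)
  define F where "F i k x \<omega> = indicator (window s (int i) x) \<omega> *
     ((\<Prod>t = Suc i..i + k. w t (X (int t) \<omega>)) * v (X (int (i + k)) \<omega>))" for i k x \<omega>
  define x' where "x' b = x(int i + 1 := b)" for b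
  have IH: "has_bochner_integral M (F (Suc i) k (x' b))
      (prob (window s (int (Suc i)) (x' b)) * lik w v (Suc i) k (x' b (int (Suc i))))" for b
    unfolding F_def by (rule Suc.IH) (use Suc.prems in simp)
  have "has_bochner_integral M (\<lambda>\<omega>. w (Suc i) 0 * F (Suc i) k (x' 0) \<omega> + w (Suc i) 1 * F (Suc i) k (x' 1) \<omega>)
      (w (Suc i) 0 * (prob (window s (int (Suc i)) (x' 0)) * lik w v (Suc i) k (x' 0 (int (Suc i)))) +
       w (Suc i) 1 * (prob (window s (int (Suc i)) (x' 1)) * lik w v (Suc i) k (x' 1 (int (Suc i)))))"
    by (intro has_bochner_integral_add has_bochner_integral_mult_right IH)
  moreover have "w (Suc i) 0 * (prob (window s (int (Suc i)) (x' 0)) * lik w v (Suc i) k (x' 0 (int (Suc i)))) +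
       w (Suc i) 1 * (prob (window s (int (Suc i)) (x' 1)) * lik w v (Suc i) k (x' 1 (int (Suc i))))
     = prob (window s (int i) x) * lik w v i (Suc k) (x (int i))"
  proof -
    have *: "prob (window s (int (Suc i)) (x' 0)) = prob (window s (int i) x) * (1 - q (int (Suc i)) (x (int i)))"
      "prob (window s (int (Suc i)) (x' 1)) = prob (window s (int i) x) * q (int (Suc i)) (x (int i))"
      using window_Suc[OF Suc.prems, of 0 x] window_Suc[OF Suc.prems, of 1 x]
      by (simp_all add: x'_def add.commute)
    show ?thesis unfolding * unfolding lik.simps x'_def by (simp add: algebra_simps)
  qed
  moreover have "w (Suc i) 0 * F (Suc i) k (x' 0) \<omega> + w (Suc i) 1 * F (Suc i) k (x' 1) \<omega> = F i (Suc k) x \<omega>"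
    if "\<omega> \<in> space M" for \<omega>
  proof -
    have *: "{s..int (Suc i)} = insert (int i + 1) {s..int i}" using Suc.prems by auto
    have ind: "indicator (window s (int (Suc i)) (x' b)) \<omega> =
        (indicator (window s (int i) x) \<omega> * of_bool (X (int i + 1) \<omega> = b) :: real)" for b
      using that unfolding window_def * x'_def by (auto simp: indicator_def)
    have "{Suc i..i + Suc k} = insert (Suc i) {Suc (Suc i)..Suc i + k}" by auto
    then have prod: "(\<Prod>t = Suc i..i + Suc k. w t (X (int t) \<omega>)) =
        w (Suc i) (X (int i + 1) \<omega>) * (\<Prod>t = Suc (Suc i)..Suc i + k. w t (X (int t) \<omega>))"
      by (simp add: add.commute)
    show ?thesis
      unfolding F_def prod ind using X_cases[OF that, of "int i + 1"] by (auto simp: algebra_simps)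
  qed
  ultimately show ?case
    unfolding F_def[symmetric] by (subst has_bochner_integral_cong[OF refl _ refl, symmetric]) auto
qed

lemma window_single: "window (int i) (int i) (\<lambda>_. c) = {\<omega> \<in> space M. X (int i) \<omega> = c}"
  by (auto simp: window_def)

lemma trans_prob_eq_lik:
  assumes "0 < prob {\<omega> \<in> space M. X (int i) \<omega> = c}"
  shows "trans_prob M X (int i) (int (i + k)) c b = lik (\<lambda>_ _. 1) (\<lambda>b'. of_bool (b' = b)) i k c"
proof -
  define A where "A = {\<omega> \<in> space M. X (int (i + k)) \<omega> = b \<and> X (int i) \<omega> = c}"
  have "A = {\<omega> \<in> space M. X (int (i + k)) \<omega> = b} \<inter> {\<omega> \<in> space M. X (int i) \<omega> = c}"
    unfolding A_def by blast
  then have A: "A \<in> events" using sets.Int[OF X_event X_event] by metis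
  have "has_bochner_integral M
    (\<lambda>\<omega>. indicator (window (int i) (int i) (\<lambda>_. c)) \<omega> * ((\<Prod>t = Suc i..i + k. 1) * of_bool (X (int (i + k)) \<omega> = b)))
    (prob (window (int i) (int i) (\<lambda>_. c)) * lik (\<lambda>_ _. 1) (\<lambda>b'. of_bool (b' = b)) i k c)"
    by (rule lik_integral[where w = "\<lambda>_ _. 1" and v = "\<lambda>b'. of_bool (b' = b)"]) simp
  moreover have "has_bochner_integral M (indicator A) (prob A)"
    by (rule has_bochner_integral_real_indicator) (use A in \<open>auto simp: emeasure_eq_measure\<close>)
  moreover have "(\<lambda>\<omega>. indicator (window (int i) (int i) (\<lambda>_. c)) \<omega> * ((\<Prod>t = Suc i..i + k. 1) * of_bool (X (int (i + k)) \<omega> = b)))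
      = (indicator A :: _ \<Rightarrow> real)"
    by (auto simp: window_def A_def indicator_def fun_eq_iff)
  ultimately have "prob (window (int i) (int i) (\<lambda>_. c)) * lik (\<lambda>_ _. 1) (\<lambda>b'. of_bool (b' = b)) i k c = prob A"
    by (metis has_bochner_integral_eq)
  then show ?thesis
    using assms unfolding trans_prob_def cond_prob_def window_single A_def by (simp add: field_simps)
qed

lemma integral_uniform_measure_eq_lik:
  assumes "0 < prob {\<omega> \<in> space M. X 0 \<omega> = c}"
  shows "(\<integral>\<omega>. (\<Prod>t = 1..n. w t (X (int t) \<omega>)) \<partial>uniform_measure M {\<omega> \<in> space M. X 0 \<omega> = c})
    = lik w (\<lambda>_. 1) 0 n c"
proof -
  let ?A = "{\<omega> \<in> space M. X 0 \<omega> = c}"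
  have [measurable]: "?A \<in> events" by (rule X_event)
  let ?f = "\<lambda>\<omega>. \<Prod>t = 1..n. w t (X (int t) \<omega>)"
  have "(\<lambda>\<omega>. w t (X (int t) \<omega>)) \<in> borel_measurable M" for t
    by (rule measurable_compose[OF X_rv]) simp
  then have f: "?f \<in> borel_measurable M" by (intro borel_measurable_prod) auto
  have "uniform_measure M ?A = density M (\<lambda>\<omega>. ennreal (indicator ?A \<omega> / prob ?A))"
    unfolding uniform_measure_def using assms
    by (intro density_cong) (measurable, auto simp: emeasure_eq_measure divide_ennreal[symmetric] split: split_indicator)
  then have "(\<integral>\<omega>. ?f \<omega> \<partial>uniform_measure M ?A) = (\<integral>\<omega>. (indicator ?A \<omega> / prob ?A) * ?f \<omega> \<partial>M)"
    using f X_event by (simp add: integral_density)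
  also have "\<dots> = (\<integral>\<omega>. indicator ?A \<omega> * ?f \<omega> \<partial>M) / prob ?A"
    by (simp flip: integral_divide_zero)
  also have "(\<integral>\<omega>. indicator ?A \<omega> * ?f \<omega> \<partial>M) = prob ?A * lik w (\<lambda>_. 1) 0 n c"
    using has_bochner_integral_integral_eq[OF lik_integral[where s = 0 and i = 0 and x = "\<lambda>_. c" and k = n and w = w and v = "\<lambda>_. 1"]] window_single[of 0 c]
    by simp
  finally show ?thesis using assms by simp
qed

end

text \<open>
  Where the window has probability zero both sides vanish; elsewhere this is the definition of a Markov chain.
\<close>

lemma (in prob_space) markov_chain_binary_markov:
  assumes rv: "\<And>t. \<eta> t \<in> measurable M (count_space {0, 1})" and "markov_chain M \<eta>"
  shows "binary_markov M \<eta> (\<lambda>t c. trans_prob M \<eta> (t - 1) t c 1)"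
proof unfold_locales
  fix s t :: int and x :: "int \<Rightarrow> nat"
  assume "s \<le> t"
  let ?W = "{\<omega> \<in> space M. \<forall>i\<in>{s..t}. \<eta> i \<omega> = x i}"
  let ?W' = "{\<omega> \<in> space M. (\<forall>i\<in>{s..t}. \<eta> i \<omega> = x i) \<and> \<eta> (t + 1) \<omega> = 1}"
  have ev: "{\<omega> \<in> space M. \<eta> i \<omega> = b} \<in> events" for i b
  proof -
    have "\<eta> i -` ({b} \<inter> {0, 1}) \<inter> space M \<in> events" by (rule measurable_sets[OF rv]) auto
    moreover have "\<eta> i -` ({b} \<inter> {0, 1}) \<inter> space M = {\<omega> \<in> space M. \<eta> i \<omega> = b}"
      using measurable_space[OF rv[of i]] by auto
    ultimately show ?thesis by simp
  qed
  have W: "?W \<in> events" by (rule sets.sets_Collect_finite_All) (auto simp: ev)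
  show "prob ?W' = prob ?W * trans_prob M \<eta> (t + 1 - 1) (t + 1) (x t) 1"
  proof (cases "prob ?W > 0")
    case True
    define y where "y = x(t + 1 := 1)"
    have eq: "t - int (nat (t - s)) = s" using \<open>s \<le> t\<close> by simp
    have y: "(\<forall>i\<in>{s..t}. \<eta> i \<omega> = y i) \<longleftrightarrow> (\<forall>i\<in>{s..t}. \<eta> i \<omega> = x i)" for \<omega>
      by (auto simp: y_def)
    have "\<P>(\<omega> in M. \<eta> (t + 1) \<omega> = y (t + 1) \<bar> \<forall>i\<in>{s..t}. \<eta> i \<omega> = y i) = \<P>(\<omega> in M. \<eta> (t + 1) \<omega> = y (t + 1) \<bar> \<eta> t \<omega> = y t)"
      using assms(2)[unfolded markov_chain_def, rule_format, of t "nat (t - s)" y] True unfolding eq y by simp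
    then have "prob {\<omega> \<in> space M. \<eta> (t + 1) \<omega> = 1 \<and> (\<forall>i\<in>{s..t}. \<eta> i \<omega> = x i)} / prob ?W = trans_prob M \<eta> t (t + 1) (x t) 1"
      unfolding y by (simp add: trans_prob_def cond_prob_def y_def)
    then show ?thesis using True by (simp add: field_simps conj_commute)
  next
    case False
    then have "prob ?W = 0" by (simp add: zero_less_measure_iff)
    moreover have "prob ?W' \<le> prob ?W" using W by (intro finite_measure_mono) auto
    ultimately show ?thesis by (simp add: measure_le_0_iff)
  qed
qed (use rv in \<open>auto simp: trans_prob_bounds prob_space_axioms\<close>)

text \<open>
  The Markov property concerns only finite-dimensional marginals, so it passes to an equally distributed
  process with the same transition probabilities.
\<close>

lemma (in binary_markov) equal_law_binary_markov:
  assumes rv: "\<And>t. Y t \<in> measurable M (count_space {0, 1})"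
    and law: "distr M (Pi\<^sub>M UNIV (\<lambda>_. count_space {0, 1})) (\<lambda>\<omega> t. Y t \<omega>)
         = distr M (Pi\<^sub>M UNIV (\<lambda>_. count_space {0, 1})) (\<lambda>\<omega> t. X t \<omega>)"
  shows "binary_markov M Y q"
    and "prob {\<omega> \<in> space M. Y t \<omega> = c} = prob {\<omega> \<in> space M. X t \<omega> = c}"
proof -
  let ?P = "Pi\<^sub>M UNIV (\<lambda>_::int. count_space {0, 1::nat})"
  have tr: "prob {\<omega> \<in> space M. \<forall>i\<in>I. Y i \<omega> = x i} = prob {\<omega> \<in> space M. \<forall>i\<in>I. X i \<omega> = x i}"
    if "finite I" for I and x :: "int \<Rightarrow> nat"
  proof -
    define E where "E = {f \<in> space ?P. \<forall>i\<in>I. f i = x i}"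
    have "{f \<in> space ?P. f i = x i} \<in> sets ?P" for i
    proof -
      have "(\<lambda>f. f i) -` ({x i} \<inter> {0, 1}) \<inter> space ?P \<in> sets ?P"
        by (rule measurable_sets[OF measurable_component_singleton]) auto
      moreover have "(\<lambda>f. f i) -` ({x i} \<inter> {0, 1}) \<inter> space ?P = {f \<in> space ?P. f i = x i}"
        by (auto simp: space_PiM)
      ultimately show ?thesis by simp
    qed
    then have E: "E \<in> sets ?P" unfolding E_def by (intro sets.sets_Collect_finite_All that) auto
    have m: "(\<lambda>\<omega> t. V t \<omega>) \<in> measurable M ?P" if "\<And>t. V t \<in> measurable M (count_space {0, 1})" for V
    proof (rule measurable_PiM_single')
      have "V t \<omega> \<in> {0, 1}" if "\<omega> \<in> space M" for t \<omega>
        using measurable_space[OF \<open>\<And>t. V t \<in> measurable M (count_space {0, 1})\<close> that] by simp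
      then show "(\<lambda>\<omega> t. V t \<omega>) \<in> space M \<rightarrow> UNIV \<rightarrow>\<^sub>E space (count_space {0, 1})"
        by (simp add: PiE_iff Pi_iff)
    qed (rule that)
    have pre: "(\<lambda>\<omega> t. V t \<omega>) -` E \<inter> space M = {\<omega> \<in> space M. \<forall>i\<in>I. V i \<omega> = x i}"
      if "\<And>t. V t \<in> measurable M (count_space {0, 1})" for V
      using measurable_space[OF m[OF that]] by (auto simp: E_def)
    have "measure (distr M ?P (\<lambda>\<omega> t. Y t \<omega>)) E = measure (distr M ?P (\<lambda>\<omega> t. X t \<omega>)) E"
      using law by simp
    then show ?thesis
      by (simp only: measure_distr[OF m[OF rv] E] measure_distr[OF m[OF X_rv] E] pre[OF rv] pre[OF X_rv])
  qed
  show "prob {\<omega> \<in> space M. Y t \<omega> = c} = prob {\<omega> \<in> space M. X t \<omega> = c}"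
    using tr[of "{t}" "\<lambda>_. c"] by simp
  show "binary_markov M Y q"
  proof unfold_locales
    fix s t :: int and x :: "int \<Rightarrow> nat"
    assume "s \<le> t"
    have "(\<forall>i\<in>{s..t + 1}. V i \<omega> = (x(t + 1 := 1)) i) \<longleftrightarrow> (\<forall>i\<in>{s..t}. V i \<omega> = x i) \<and> V (t + 1) \<omega> = 1"
      for V :: "int \<Rightarrow> 'a \<Rightarrow> nat" and \<omega>
    proof -
      have "{s..t + 1} = insert (t + 1) {s..t}" using \<open>s \<le> t\<close> by auto
      then show ?thesis by auto
    qed
    note * = this
    show "prob {\<omega> \<in> space M. (\<forall>i\<in>{s..t}. Y i \<omega> = x i) \<and> Y (t + 1) \<omega> = 1}
        = prob {\<omega> \<in> space M. \<forall>i\<in>{s..t}. Y i \<omega> = x i} * q (t + 1) (x t)"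
      using tr[of "{s..t + 1}" "x(t + 1 := 1)"] tr[of "{s..t}" x] one_step[OF \<open>s \<le> t\<close>, of x]
      unfolding * by simp
  qed (use rv q_bounds in auto)
qed

section \<open>Jointly smooth families of functions\<close>

text \<open>
  All derivatives in the second argument up to order \<open>k\<close> exist and are jointly continuous. The recursive form is
  suited to closure properties, because the product, quotient and chain rules express the first derivative
  through functions of the next lower class.
\<close>

primrec joint_C :: "nat \<Rightarrow> ('z::topological_space \<Rightarrow> real \<Rightarrow> real) \<Rightarrow> bool" where
  "joint_C 0 F \<longleftrightarrow> continuous_on UNIV (\<lambda>(z, x). F z x)"
| "joint_C (Suc k) F \<longleftrightarrow> continuous_on UNIV (\<lambda>(z, x). F z x) \<and>
     (\<exists>F'. (\<forall>z x. (F z has_real_derivative F' z x) (at x)) \<and> joint_C k F')"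

lemma joint_C_SucI:
  assumes "continuous_on UNIV (\<lambda>(z, x). F z x)"
    and "\<And>z x. (F z has_real_derivative F' z x) (at x)" and "joint_C k F'"
  shows "joint_C (Suc k) F"
  using assms by (simp only: joint_C.simps) blast

lemma joint_C_SucE:
  assumes "joint_C (Suc k) F"
  obtains F' where "\<And>z x. (F z has_real_derivative F' z x) (at x)" "joint_C k F'"
  using assms by (simp only: joint_C.simps) blast

lemma joint_C_continuous: "joint_C k F \<Longrightarrow> continuous_on UNIV (\<lambda>(z, x). F z x)"
  by (cases k) auto

lemma joint_C_SucD: "joint_C (Suc k) F \<Longrightarrow> joint_C k F"
proof (induction k arbitrary: F)
  case 0
  then show ?case by simp
next
  case (Suc k)
  from Suc.prems obtain F' where F': "\<And>z x. (F z has_real_derivative F' z x) (at x)" "joint_C (Suc k) F'"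
    by (rule joint_C_SucE) blast
  show ?case by (rule joint_C_SucI[OF joint_C_continuous[OF Suc.prems] F'(1) Suc.IH[OF F'(2)]])
qed

lemma joint_C_add: "joint_C k F \<Longrightarrow> joint_C k G \<Longrightarrow> joint_C k (\<lambda>z x. F z x + G z x)"
proof (induction k arbitrary: F G)
  case 0
  then show ?case by (simp add: split_beta continuous_on_add)
next
  case (Suc k)
  obtain F' where F: "\<And>z x. (F z has_real_derivative F' z x) (at x)" "joint_C k F'"
    using joint_C_SucE[OF Suc.prems(1)] by blast
  obtain G' where G: "\<And>z x. (G z has_real_derivative G' z x) (at x)" "joint_C k G'"
    using joint_C_SucE[OF Suc.prems(2)] by blast
  show ?case
    by (rule joint_C_SucI[OF _ DERIV_add[OF F(1) G(1)] Suc.IH[OF F(2) G(2)]])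
      (use Suc.prems[THEN joint_C_continuous] in \<open>simp add: split_beta continuous_on_add\<close>)
qed

lemma joint_C_mult: "joint_C k F \<Longrightarrow> joint_C k G \<Longrightarrow> joint_C k (\<lambda>z x. F z x * G z x)"
proof (induction k arbitrary: F G)
  case 0
  then show ?case by (simp add: split_beta continuous_on_mult)
next
  case (Suc k)
  obtain F' where F: "\<And>z x. (F z has_real_derivative F' z x) (at x)" "joint_C k F'"
    using joint_C_SucE[OF Suc.prems(1)] by blast
  obtain G' where G: "\<And>z x. (G z has_real_derivative G' z x) (at x)" "joint_C k G'"
    using joint_C_SucE[OF Suc.prems(2)] by blast
  have C': "joint_C k (\<lambda>z x. F' z x * G z x + G' z x * F z x)"
    by (intro joint_C_add Suc.IH F(2) G(2) joint_C_SucD[OF Suc.prems(1)] joint_C_SucD[OF Suc.prems(2)])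
  show ?case
    by (rule joint_C_SucI[OF _ DERIV_mult[OF F(1) G(1)] C'])
      (use Suc.prems[THEN joint_C_continuous] in \<open>simp add: split_beta continuous_on_mult\<close>)
qed

lemma joint_C_minus: "joint_C k F \<Longrightarrow> joint_C k (\<lambda>z x. - F z x)"
proof (induction k arbitrary: F)
  case 0
  then show ?case by (simp add: split_beta continuous_on_minus)
next
  case (Suc k)
  obtain F' where F: "\<And>z x. (F z has_real_derivative F' z x) (at x)" "joint_C k F'"
    using joint_C_SucE[OF Suc.prems(1)] by blast
  show ?case
    by (rule joint_C_SucI[OF _ DERIV_minus[OF F(1)] Suc.IH[OF F(2)]])
      (use Suc.prems[THEN joint_C_continuous] in \<open>simp add: split_beta continuous_on_minus\<close>)
qed

lemma joint_C_inverse: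
  assumes nz: "\<And>z x. F z x \<noteq> 0"
  shows "joint_C k F \<Longrightarrow> joint_C k (\<lambda>z x. inverse (F z x))"
proof (induction k)
  case 0
  then show ?case using nz by (simp add: split_beta continuous_on_inverse)
next
  case (Suc k)
  obtain F' where F: "\<And>z x. (F z has_real_derivative F' z x) (at x)" "joint_C k F'"
    using joint_C_SucE[OF Suc.prems] by blast
  have C': "joint_C k (\<lambda>z x. - (inverse (F z x) * F' z x * inverse (F z x)))"
    by (intro joint_C_minus joint_C_mult Suc.IH joint_C_SucD[OF Suc.prems] F(2))
  show ?case
    by (rule joint_C_SucI[OF _ DERIV_inverse'[OF F(1) nz] C'])
      (use joint_C_continuous[OF Suc.prems] nz in \<open>simp add: split_beta continuous_on_inverse\<close>)
qed

lemma joint_C_ln: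
  assumes F: "joint_C k F" and pos: "\<And>z x. 0 < F z x"
  shows "joint_C k (\<lambda>z x. ln (F z x))"
proof -
  have nz: "F z x \<noteq> 0" for z x using pos[of z x] by simp
  have c: "continuous_on UNIV (\<lambda>(z, x). ln (F z x))"
    using joint_C_continuous[OF F] nz by (simp add: split_beta continuous_on_ln)
  show ?thesis
  proof (cases k)
    case (Suc m)
    obtain F' where F': "\<And>z x. (F z has_real_derivative F' z x) (at x)" "joint_C m F'"
      using joint_C_SucE[OF F[unfolded Suc]] by blast
    have "joint_C m (\<lambda>z x. inverse (F z x) * F' z x)"
      by (intro joint_C_mult joint_C_inverse nz F'(2) joint_C_SucD[OF F[unfolded Suc]])
    then show ?thesis
      unfolding Suc by (rule joint_C_SucI[OF c DERIV_chain2[OF DERIV_ln[OF pos] F'(1)]])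
  qed (use c in simp)
qed

lemma joint_C_higher_deriv:
  assumes "joint_C k F"
  shows "j \<le> k \<Longrightarrow> continuous_on UNIV (\<lambda>(z, x). (deriv ^^ j) (F z) x)"
    and "j < k \<Longrightarrow> ((deriv ^^ j) (F z) has_real_derivative (deriv ^^ Suc j) (F z) x) (at x)"
proof -
  have *: "joint_C (k - j) (\<lambda>z. (deriv ^^ j) (F z))" if "j \<le> k" for j
    using that
  proof (induction j)
    case (Suc j)
    then have "k - j = Suc (k - Suc j)" by simp
    with Suc obtain F' where F': "\<And>z x. ((deriv ^^ j) (F z) has_real_derivative F' z x) (at x)" "joint_C (k - Suc j) F'"
      using joint_C_SucE[of "k - Suc j" "\<lambda>z. (deriv ^^ j) (F z)"] by auto
    have "(deriv ^^ Suc j) (F z) = F' z" for z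
      using DERIV_imp_deriv[OF F'(1)] by (auto simp: fun_eq_iff)
    with F'(2) show ?case by simp
  qed (use assms in simp)
  show "j \<le> k \<Longrightarrow> continuous_on UNIV (\<lambda>(z, x). (deriv ^^ j) (F z) x)"
    by (rule joint_C_continuous[OF *])
  assume "j < k"
  then have "k - j = Suc (k - Suc j)" by simp
  then obtain F' where F': "\<And>z x. ((deriv ^^ j) (F z) has_real_derivative F' z x) (at x)"
    using joint_C_SucE[of "k - Suc j" "\<lambda>z. (deriv ^^ j) (F z)"] *[of j] \<open>j < k\<close> by auto
  then show "((deriv ^^ j) (F z) has_real_derivative (deriv ^^ Suc j) (F z) x) (at x)"
    using DERIV_imp_deriv[OF F'[of z x]] F'[of z x] by simp
qed

lemma joint_C_of_higher_derivs:
  assumes "\<And>z. C_upto q (F z)"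
    and "\<And>j. j \<le> q \<Longrightarrow> continuous_on UNIV (\<lambda>(z, x). (deriv ^^ j) (F z) x)"
  shows "joint_C q F"
proof -
  have "joint_C n (\<lambda>z. (deriv ^^ j) (F z))" if "j + n \<le> q" for j n
    using that
  proof (induction n arbitrary: j)
    case 0
    then show ?case using assms(2)[of j] by simp
  next
    case (Suc n)
    show ?case
    proof (rule joint_C_SucI)
      show "((deriv ^^ j) (F z) has_real_derivative (deriv ^^ Suc j) (F z) x) (at x)" for z x
        using assms(1)[of z] Suc.prems by (simp add: C_upto_def DERIV_deriv_iff_real_differentiable)
      show "joint_C n (\<lambda>z. (deriv ^^ Suc j) (F z))" by (rule Suc.IH) (use Suc.prems in simp)
    qed (use assms(2)[of j] Suc.prems in simp)
  qed
  from this[of 0 q] show ?thesis by simp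
qed

context
  fixes f :: "'x \<Rightarrow> 'p \<Rightarrow> ennreal" and \<phi> :: "'z::topological_space \<Rightarrow> 'p \<Rightarrow> 'x" and \<theta> :: "nat \<Rightarrow> real \<Rightarrow> 'p"
    and k :: nat and r :: real
  assumes log_C: "\<And>a b. a \<in> {0, 1} \<Longrightarrow> b \<in> {0, 1} \<Longrightarrow> joint_C k (\<lambda>z. logdens f \<phi> \<theta> z a b)"
    and k: "1 \<le> k" and r: "0 \<le> r"
begin

private definition vals :: "'z \<Rightarrow> real set" where
  "vals z = {\<bar>(deriv ^^ j) (logdens f \<phi> \<theta> z a b) \<epsilon>\<bar> | j \<epsilon> a b.
           1 \<le> j \<and> j \<le> k \<and> \<bar>\<epsilon>\<bar> \<le> r \<and> a \<in> {0, 1} \<and> b \<in> {0, 1}}"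

private lemma Msup_vals: "Msup f \<phi> \<theta> k z r = Sup (vals z)"
  by (simp add: Msup_def vals_def)

private lemma section_continuous:
  assumes "j \<le> k" "a \<in> {0, 1}" "b \<in> {0, 1}"
  shows "continuous_on UNIV (\<lambda>\<epsilon>. (deriv ^^ j) (logdens f \<phi> \<theta> z a b) \<epsilon>)"
    "continuous_on UNIV (\<lambda>z. (deriv ^^ j) (logdens f \<phi> \<theta> z a b) \<epsilon>)"
proof -
  have c: "continuous_on UNIV (\<lambda>(z, x). (deriv ^^ j) (logdens f \<phi> \<theta> z a b) x)"
    by (rule joint_C_higher_deriv(1)[OF log_C]) (use assms in auto)
  show "continuous_on UNIV (\<lambda>\<epsilon>. (deriv ^^ j) (logdens f \<phi> \<theta> z a b) \<epsilon>)"
    using continuous_on_compose2[OF c, where s = UNIV and f = "\<lambda>e. (z, e)"] by (simp add: continuous_on_Pair)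
  show "continuous_on UNIV (\<lambda>z. (deriv ^^ j) (logdens f \<phi> \<theta> z a b) \<epsilon>)"
    using continuous_on_compose2[OF c, where s = UNIV and f = "\<lambda>z. (z, \<epsilon>)"] by (simp add: continuous_on_Pair)
qed

private lemma vals_bdd: "bdd_above (vals z)"
proof -
  have "vals z \<subseteq> (\<Union>j\<in>{1..k}. \<Union>a\<in>{0, 1}. \<Union>b\<in>{0, 1}.
      (\<lambda>\<epsilon>. \<bar>(deriv ^^ j) (logdens f \<phi> \<theta> z a b) \<epsilon>\<bar>) ` {- r..r})"
    unfolding vals_def by (force simp: abs_le_iff)
  moreover have "bdd_above ((\<lambda>\<epsilon>. \<bar>(deriv ^^ j) (logdens f \<phi> \<theta> z a b) \<epsilon>\<bar>) ` {- r..r})"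
    if "j \<in> {1..k}" "a \<in> {0, 1}" "b \<in> {0, 1}" for j a b
  proof -
    have "compact ((\<lambda>\<epsilon>. \<bar>(deriv ^^ j) (logdens f \<phi> \<theta> z a b) \<epsilon>\<bar>) ` {- r..r})"
      using that by (intro compact_continuous_image continuous_on_rabs
        continuous_on_subset[OF section_continuous(1) subset_UNIV]) auto
    then show ?thesis by (intro bounded_imp_bdd_above compact_imp_bounded)
  qed
  then have "bdd_above (\<Union>j\<in>{1..k}. \<Union>a\<in>{0, 1}. \<Union>b\<in>{0, 1}.
      (\<lambda>\<epsilon>. \<bar>(deriv ^^ j) (logdens f \<phi> \<theta> z a b) \<epsilon>\<bar>) ` {- r..r})"
    by (simp add: bdd_above_UN)
  ultimately show ?thesis by (rule bdd_above_mono[rotated])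
qed

lemma higher_deriv_le_Msup:
  assumes "1 \<le> j" "j \<le> k" "\<bar>\<epsilon>\<bar> \<le> r" "a \<in> {0, 1}" "b \<in> {0, 1}"
  shows "\<bar>(deriv ^^ j) (logdens f \<phi> \<theta> z a b) \<epsilon>\<bar> \<le> Msup f \<phi> \<theta> k z r"
  unfolding Msup_vals by (rule cSup_upper[OF _ vals_bdd]) (use assms in \<open>force simp: vals_def\<close>)

lemma Msup_nonneg: "0 \<le> Msup f \<phi> \<theta> k z r"
  using higher_deriv_le_Msup[of 1 0 0 0 z] k r by (intro order_trans[OF abs_ge_zero]) auto

text \<open>
  A supremum of functions that are continuous in \<open>z\<close> is lower semicontinuous: the superlevel sets are unions of
  open sets, however many values of \<open>\<epsilon>\<close> there are.
\<close>

lemma Msup_measurable: "(\<lambda>z. Msup f \<phi> \<theta> k z r) \<in> borel_measurable borel"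
  unfolding borel_measurable_iff_greater
proof
  fix u
  have "{z. u < Msup f \<phi> \<theta> k z r} =
      (\<Union>(j, \<epsilon>, a, b)\<in>{(j, \<epsilon>, a, b). 1 \<le> j \<and> j \<le> k \<and> \<bar>\<epsilon>\<bar> \<le> r \<and> a \<in> {0, 1} \<and> b \<in> {0, 1}}.
         {z. u < \<bar>(deriv ^^ j) (logdens f \<phi> \<theta> z a b) \<epsilon>\<bar>})"
  proof -
    have "\<bar>(deriv ^^ 1) (logdens f \<phi> \<theta> z 0 0) 0\<bar> \<in> vals z" for z
      unfolding vals_def mem_Collect_eq using k r
      by (intro exI[of _ 1] exI[of _ "0::real"] exI[of _ "0::nat"]) simp
    then have "vals z \<noteq> {}" for z by blast
    then have "u < Sup (vals z) \<longleftrightarrow> (\<exists>y\<in>vals z. u < y)" for z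
      by (intro less_cSup_iff vals_bdd)
    moreover have "(\<exists>y\<in>vals z. u < y) \<longleftrightarrow> (\<exists>j \<epsilon> a b. (1 \<le> j \<and> j \<le> k \<and> \<bar>\<epsilon>\<bar> \<le> r \<and> a \<in> {0, 1} \<and> b \<in> {0, 1}) \<and>
        u < \<bar>(deriv ^^ j) (logdens f \<phi> \<theta> z a b) \<epsilon>\<bar>)" for z
      unfolding vals_def mem_Collect_eq Bex_def by iprover
    ultimately show ?thesis unfolding Msup_vals by (simp only: set_eq_iff mem_Collect_eq UN_iff Bex_def split_paired_Ex case_prod_conv simp_thms)
  qed
  also have "open \<dots>"
    by (intro open_UN ballI) (auto intro!: open_Collect_less continuous_intros section_continuous(2))
  finally show "{w \<in> space borel. u < Msup f \<phi> \<theta> k w r} \<in> sets borel" by simp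
qed

end

section \<open>Almost sure rates for independent observations\<close>

context prob_space
begin

lemma indep_vars_reindex:
  assumes g: "inj_on g J" and ind: "indep_vars M' X (g ` J)"
  shows "indep_vars (\<lambda>j. M' (g j)) (\<lambda>j. X (g j)) J"
proof -
  have "indep_sets (\<lambda>j. F (g j)) J" if F: "indep_sets F (g ` J)" for F
    unfolding indep_sets_def
  proof (intro conjI ballI allI impI)
    show "F (g j) \<subseteq> events" if "j \<in> J" for j using F that by (auto simp: indep_sets_def)
  next
    fix K A assume K: "K \<subseteq> J" "K \<noteq> {}" "finite K" and A: "A \<in> Pi K (\<lambda>j. F (g j))"
    have inj: "inj_on g K" using g K(1) by (rule inj_on_subset)
    define A' where "A' i = A (inv_into K g i)" for i
    have A': "A' (g k) = A k" if "k \<in> K" for k using inj that by (simp add: A'_def)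
    have "A' \<in> Pi (g ` K) F" using A A' by auto
    then have "prob (\<Inter>i\<in>g ` K. A' i) = (\<Prod>i\<in>g ` K. prob (A' i))"
      using F[unfolded indep_sets_def, THEN conjunct2, rule_format, of "g ` K" A'] K by auto
    also have "(\<Inter>i\<in>g ` K. A' i) = (\<Inter>k\<in>K. A k)" using A' by auto
    also have "(\<Prod>i\<in>g ` K. prob (A' i)) = (\<Prod>k\<in>K. prob (A k))"
      using A' by (simp add: prod.reindex[OF inj])
    finally show "prob (\<Inter>k\<in>K. A k) = (\<Prod>k\<in>K. prob (A k))" .
  qed
  then show ?thesis using ind by (auto simp: indep_vars_def2)
qed

text \<open>
  At \<open>u = exp (\<gamma> t)\<close> the tail bound is of order \<open>t\<close> to the power \<open>- c\<close>, which is summable, and the Borel-Cantelli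
  lemma applies.
\<close>

lemma AE_eventually_less_exp:
  fixes W :: "nat \<Rightarrow> 'a \<Rightarrow> real"
  assumes W: "\<And>t. random_variable borel (W t)"
    and ident: "\<And>t. distr M borel (W t) = distr M borel (W 0)"
    and tail: "1 < c" "(\<lambda>u. \<P>(\<omega> in M. u \<le> W 0 \<omega>)) \<in> O[at_top](\<lambda>u. ln u powr (- c))"
    and \<gamma>: "0 < \<gamma>"
  shows "AE \<omega> in M. \<forall>\<^sub>F t in sequentially. W t \<omega> < exp (\<gamma> * real t)"
    and "(\<lambda>t. \<P>(\<omega> in M. exp (\<gamma> * real t) \<le> W 0 \<omega>)) \<longlonglongrightarrow> 0"
proof -
  note [measurable] = W
  have lim: "filterlim (\<lambda>t. exp (\<gamma> * real t)) at_top sequentially"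
    using \<gamma> by (intro filterlim_compose[OF exp_at_top] filterlim_tendsto_pos_mult_at_top[OF tendsto_const] filterlim_real_sequentially)
  have "(\<lambda>t. \<P>(\<omega> in M. exp (\<gamma> * real t) \<le> W 0 \<omega>)) \<in> O(\<lambda>t. ln (exp (\<gamma> * real t)) powr (- c))"
    by (rule landau_o.big.compose[OF tail(2) lim])
  then have "(\<lambda>t. \<P>(\<omega> in M. exp (\<gamma> * real t) \<le> W 0 \<omega>)) \<in> O(\<lambda>t. (\<gamma> * real t) powr (- c))"
    by simp
  moreover have "summable (\<lambda>t. norm ((\<gamma> * real t) powr (- c)))"
    using \<gamma> tail(1) by (simp add: powr_mult summable_mult summable_real_powr_iff)
  ultimately have s0: "summable (\<lambda>t. \<P>(\<omega> in M. exp (\<gamma> * real t) \<le> W 0 \<omega>))"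
    by (rule summable_comparison_test_bigo[rotated])
  then show "(\<lambda>t. \<P>(\<omega> in M. exp (\<gamma> * real t) \<le> W 0 \<omega>)) \<longlonglongrightarrow> 0"
    by (rule summable_LIMSEQ_zero)
  have same: "\<P>(\<omega> in M. u \<le> W t \<omega>) = \<P>(\<omega> in M. u \<le> W 0 \<omega>)" for u t
  proof -
    have "\<P>(\<omega> in M. u \<le> W t \<omega>) = measure (distr M borel (W t)) {u..}" for t
      by (subst measure_distr) (auto intro!: arg_cong[where f = prob])
    then show ?thesis using ident[of t] by simp
  qed
  have "summable (\<lambda>t. prob {\<omega> \<in> space M. exp (\<gamma> * real t) \<le> W t \<omega>})"
    by (subst same) (rule s0)
  then have "AE \<omega> in M. \<forall>\<^sub>F t in sequentially. \<omega> \<in> space M - {\<omega> \<in> space M. exp (\<gamma> * real t) \<le> W t \<omega>}"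
    by (intro borel_cantelli_AE1) (auto simp: emeasure_eq_measure)
  then show "AE \<omega> in M. \<forall>\<^sub>F t in sequentially. W t \<omega> < exp (\<gamma> * real t)"
    by eventually_elim (auto elim: eventually_mono)
qed

text \<open>
  The block factors are independent with a common expectation \<open>lam0 < 1\<close>, so their product has expectation
  \<open>lam0 ^ m\<close>. With \<open>lam = sqrt lam0\<close>, the Markov inequality bounds the probability that the product exceeds
  \<open>lam ^ m\<close> by \<open>lam ^ m\<close>, which is summable.
\<close>

lemma AE_block_product_decay:
  fixes W :: "nat \<Rightarrow> 'a \<Rightarrow> real" and c :: real
  assumes ind: "indep_vars (\<lambda>_. borel) W UNIV"
    and ident: "\<And>t. distr M borel (W t) = distr M borel (W 0)"
    and K: "0 < \<P>(\<omega> in M. W 0 \<omega> \<le> K)" and c: "0 < c" "c < 1"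
  obtains lam :: real where "0 < lam" "lam < 1"
    "AE \<omega> in M. \<forall>\<^sub>F m in sequentially.
      (\<Prod>j<m. if \<forall>t. j * \<kappa> < t \<and> t \<le> j * \<kappa> + \<kappa> \<longrightarrow> W t \<omega> \<le> K then c else 1) \<le> lam ^ m"
proof -
  have W[measurable]: "random_variable borel (W t)" for t using ind by (simp add: indep_vars_def)
  define p where "p = \<P>(\<omega> in M. W 0 \<omega> \<le> K)"
  define good where "good w = (indicator {..K} w :: real)" for w
  have [measurable]: "good \<in> borel_measurable borel" unfolding good_def by measurable
  have good_p: "expectation (\<lambda>\<omega>. good (W t \<omega>)) = p" for t
  proof -
    have "expectation (\<lambda>\<omega>. good (W t \<omega>)) = integral\<^sup>L (distr M borel (W t)) good" for t
      by (simp add: integral_distr)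
    then have "expectation (\<lambda>\<omega>. good (W t \<omega>)) = expectation (\<lambda>\<omega>. good (W 0 \<omega>))"
      using ident[of t] by simp
    also have "\<dots> = expectation (indicator {\<omega> \<in> space M. W 0 \<omega> \<le> K})"
      by (intro Bochner_Integration.integral_cong) (auto simp: good_def indicator_def)
    finally show ?thesis by (simp add: p_def)
  qed
  have int_good: "integrable M (\<lambda>\<omega>. good (W t \<omega>))" for t
    by (rule integrable_const_bound[where B = 1]) (auto simp: good_def indicator_def)
  define blk where "blk j = {j * \<kappa> <.. j * \<kappa> + \<kappa>}" for j
  define fac where "fac j w = 1 - (1 - c) * (\<Prod>t\<in>blk j. good (w t))" for j and w :: "nat \<Rightarrow> real"
  define F where "F j \<omega> = fac j (restrict (\<lambda>t. W t \<omega>) (blk j))" for j \<omega>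
  have F_eq: "F j \<omega> = (if \<forall>t. j * \<kappa> < t \<and> t \<le> j * \<kappa> + \<kappa> \<longrightarrow> W t \<omega> \<le> K then c else 1)" for j \<omega>
  proof (cases "\<forall>t\<in>blk j. W t \<omega> \<le> K")
    case True
    then have "(\<Prod>t\<in>blk j. good (W t \<omega>)) = 1" by (intro prod.neutral) (simp add: good_def)
    with True show ?thesis by (auto simp: F_def fac_def blk_def)
  next
    case False
    then obtain t where "t \<in> blk j" "good (W t \<omega>) = 0" by (auto simp: good_def)
    then have "(\<Prod>t\<in>blk j. good (W t \<omega>)) = 0" by (intro prod_zero) (auto simp: blk_def)
    with False show ?thesis by (auto simp: F_def fac_def blk_def)
  qed
  have "indep_vars (\<lambda>j. PiM (blk j) (\<lambda>_. borel)) (\<lambda>j \<omega>. restrict (\<lambda>t. W t \<omega>) (blk j)) UNIV"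
  proof (rule indep_vars_restrict[OF ind])
    have "blk i \<inter> blk j = {}" if "i < j" for i j
    proof -
      have "i * \<kappa> + \<kappa> \<le> j * \<kappa>" using mult_le_mono1[of "Suc i" j \<kappa>] that by (simp add: add.commute)
      then show ?thesis by (auto simp: blk_def)
    qed
    then show "disjoint_family_on blk UNIV"
      unfolding disjoint_family_on_def by (metis inf_commute linorder_neqE_nat)
  qed auto
  then have indF: "indep_vars (\<lambda>_. borel) F UNIV"
    unfolding F_def[abs_def]
  proof (rule indep_vars_compose2)
    fix j
    show "fac j \<in> borel_measurable (PiM (blk j) (\<lambda>_. borel))"
      unfolding fac_def[abs_def] by measurable
  qed
  have [measurable]: "random_variable borel (F j)" for j using indF by (simp add: indep_vars_def)
  have F_bd: "0 \<le> F j \<omega>" "F j \<omega> \<le> 1" for j \<omega> using c by (auto simp: F_eq)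
  have intF: "integrable M (F j)" for j
    by (rule integrable_const_bound[where B = 1]) (use F_bd in auto)
  define lam0 where "lam0 = 1 - (1 - c) * p ^ \<kappa>"
  have EF: "expectation (F j) = lam0" for j
  proof -
    have ind': "indep_vars (\<lambda>_. borel) (\<lambda>t \<omega>. good (W t \<omega>)) (blk j)"
      by (rule indep_vars_compose2[OF indep_vars_subset[OF ind]]) auto
    have fin: "finite (blk j)" by (simp add: blk_def)
    have "expectation (\<lambda>\<omega>. \<Prod>t\<in>blk j. good (W t \<omega>)) = p ^ \<kappa>"
      using indep_vars_lebesgue_integral[OF fin ind' int_good] by (simp add: good_p blk_def)
    moreover have "integrable M (\<lambda>\<omega>. \<Prod>t\<in>blk j. good (W t \<omega>))"
      by (rule indep_vars_integrable[OF fin ind' int_good])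
    moreover have "F j = (\<lambda>\<omega>. 1 - (1 - c) * (\<Prod>t\<in>blk j. good (W t \<omega>)))"
      by (simp add: F_def fac_def fun_eq_iff)
    ultimately show ?thesis by (simp add: lam0_def prob_space)
  qed
  have p: "0 < p" "p \<le> 1" using K by (auto simp: p_def)
  have p\<kappa>: "0 < p ^ \<kappa>" "p ^ \<kappa> \<le> 1" using p by (auto intro: power_le_one)
  have "(1 - c) * p ^ \<kappa> \<le> (1 - c) * 1" by (rule mult_left_mono) (use p\<kappa> c in auto)
  also have "\<dots> < 1" using c by simp
  finally have "(1 - c) * p ^ \<kappa> < 1" .
  moreover have "0 < (1 - c) * p ^ \<kappa>" using c p\<kappa> by simp
  ultimately have lam0: "0 < lam0" "lam0 < 1" using c by (simp_all add: lam0_def)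
  define lam where "lam = sqrt lam0"
  have lam: "0 < lam" "lam < 1" "lam0 = lam\<^sup>2" using lam0 by (auto simp: lam_def)
  have prob_le: "prob {\<omega> \<in> space M. lam ^ m \<le> (\<Prod>j<m. F j \<omega>)} \<le> lam ^ m" for m
  proof -
    have ind': "indep_vars (\<lambda>_. borel) F {..<m}" by (rule indep_vars_subset[OF indF]) auto
    have "expectation (\<lambda>\<omega>. \<Prod>j<m. F j \<omega>) = lam0 ^ m"
      using indep_vars_lebesgue_integral[OF _ ind' intF] by (simp add: EF)
    moreover have "integrable M (\<lambda>\<omega>. \<Prod>j<m. F j \<omega>)"
      by (rule indep_vars_integrable[OF _ ind' intF]) auto
    then have "prob {\<omega> \<in> space M. lam ^ m \<le> (\<Prod>j<m. F j \<omega>)} \<le> expectation (\<lambda>\<omega>. \<Prod>j<m. F j \<omega>) / lam ^ m"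
      by (rule integral_Markov_inequality_measure[where A = "{}"]) (use lam F_bd in \<open>auto intro!: prod_nonneg\<close>)
    ultimately show ?thesis using lam by (simp add: power2_eq_square power_mult_distrib)
  qed
  have "summable (\<lambda>m. prob {\<omega> \<in> space M. lam ^ m \<le> (\<Prod>j<m. F j \<omega>)})"
    by (rule summable_comparison_test'[OF summable_geometric[of lam]]) (use lam prob_le in auto)
  then have "AE \<omega> in M. \<forall>\<^sub>F m in sequentially. \<omega> \<in> space M - {\<omega> \<in> space M. lam ^ m \<le> (\<Prod>j<m. F j \<omega>)}"
    by (intro borel_cantelli_AE1) (auto simp: emeasure_eq_measure)
  then have "AE \<omega> in M. \<forall>\<^sub>F m in sequentially. (\<Prod>j<m. F j \<omega>) \<le> lam ^ m"
    by eventually_elim (auto elim!: eventually_mono)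
  then show ?thesis using that[OF lam(1,2)] unfolding F_eq by blast
qed

end

section \<open>Derivatives of the limiting log-likelihood ratio\<close>

theorem theorem3p1:
  fixes M :: "'w measure"
    and \<eta> \<sigma> :: "int \<Rightarrow> 'w \<Rightarrow> nat"
    and Z :: "int \<Rightarrow> 'w \<Rightarrow> 'z::euclidean_space"
    and \<Theta> :: "(real ^ 'd) set"
    and \<phi> :: "'z \<Rightarrow> real ^ 'd \<Rightarrow> 'x::euclidean_space"
    and f :: "'x \<Rightarrow> real ^ 'd \<Rightarrow> ennreal"
    and \<theta> :: "nat \<Rightarrow> real \<Rightarrow> real ^ 'd"
    and \<kappa> q :: nat
    and \<phi>star :: real
  assumes "prob_space M"
    and eta_rv: "\<And>t. \<eta> t \<in> measurable M (count_space {0, 1})"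
    and sigma_rv: "\<And>t. \<sigma> t \<in> measurable M (count_space {0, 1})"
    and Z_rv: "\<And>t. Z t \<in> borel_measurable M"
    and Theta: "open \<Theta>"
    and theta: "\<And>a \<epsilon>. a \<in> {0, 1} \<Longrightarrow> \<theta> a \<epsilon> \<in> \<Theta>"
    and theta_zero: "\<theta> 0 0 = 0" "\<theta> 1 0 = 0"
    and sigma_copy:
      "distr M (Pi\<^sub>M UNIV (\<lambda>_. count_space {0, 1})) (\<lambda>\<omega> t. \<sigma> t \<omega>)
         = distr M (Pi\<^sub>M UNIV (\<lambda>_. count_space {0, 1})) (\<lambda>\<omega> t. \<eta> t \<omega>)"
    and sigma_indep:
      "indep_elements M
         (Pi\<^sub>M UNIV (\<lambda>_. count_space {0, 1})) (\<lambda>\<omega> t. \<sigma> t \<omega>)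
         (Pi\<^sub>M UNIV (\<lambda>_. count_space {0, 1}) \<Otimes>\<^sub>M Pi\<^sub>M UNIV (\<lambda>_. borel))
         (\<lambda>\<omega>. (\<lambda>t. \<eta> t \<omega>, \<lambda>t. Z t \<omega>))"
    and Z_eta_indep:
      "indep_elements M
         (Pi\<^sub>M UNIV (\<lambda>_. borel)) (\<lambda>\<omega> t. Z t \<omega>)
         (Pi\<^sub>M UNIV (\<lambda>_. count_space {0, 1})) (\<lambda>\<omega> t. \<eta> t \<omega>)"
    and Z_indep: "prob_space.indep_vars M (\<lambda>_. borel) Z UNIV"
    and Z_ident: "\<And>s t. distr M borel (Z s) = distr M borel (Z t)"
    and density: "\<And>p t. p \<in> \<Theta> \<Longrightarrow> distributed M lborel (\<lambda>\<omega>. \<phi> (Z t \<omega>) p) (\<lambda>x. f x p)"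
    and markov: "markov_chain M \<eta>"
    and mixing: "\<kappa> \<ge> 1" "\<phi>star > 0"
      "\<And>a b s t. a \<in> {0, 1} \<Longrightarrow> b \<in> {0, 1} \<Longrightarrow> \<bar>s - t\<bar> \<ge> int \<kappa> \<Longrightarrow> trans_prob M \<eta> s t a b \<ge> \<phi>star"
    and dens_pos: "\<And>z a b \<epsilon>. a \<in> {0, 1} \<Longrightarrow> b \<in> {0, 1} \<Longrightarrow>
      0 < dens f \<phi> \<theta> z a b \<epsilon> \<and> dens f \<phi> \<theta> z a b \<epsilon> < \<infinity>"
    and dens_cont: "\<And>z a b. a \<in> {0, 1} \<Longrightarrow> b \<in> {0, 1} \<Longrightarrow> continuous_on UNIV (dens f \<phi> \<theta> z a b)"
    and q: "q \<ge> 2"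
    and smooth: "\<And>z a b. a \<in> {0, 1} \<Longrightarrow> b \<in> {0, 1} \<Longrightarrow> C_upto q (rdens f \<phi> \<theta> z a b)"
    and smooth_joint: "\<And>j a b. j \<le> q \<Longrightarrow> a \<in> {0, 1} \<Longrightarrow> b \<in> {0, 1} \<Longrightarrow>
      continuous_on UNIV (\<lambda>(z, \<epsilon>). (deriv ^^ j) (rdens f \<phi> \<theta> z a b) \<epsilon>)"
    and tail: "\<And>r. r > 0 \<Longrightarrow> \<exists>c>2.
      (\<lambda>u. \<P>(\<omega> in M. Msup f \<phi> \<theta> q (Z 0 \<omega>) r \<ge> u)) \<in> O[at_top](\<lambda>u. (ln u) powr (- c))"
  shows "AE \<omega> in M.
    (let h = (\<lambda>t. \<eta> t \<omega>);
         z = (\<lambda>t. Z t \<omega>);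
         r = r_lim M \<sigma> f \<phi> \<theta> h z;
         D = (\<lambda>t. trans_diff M \<eta> 0 t);
         G = (\<lambda>t. trans_prob M \<eta> 0 t 1 0 - trans_prob M \<eta> 0 t 0 1);
         d1 = (\<lambda>t. deriv (dlog f \<phi> \<theta> h z t) 0);
         d2 = (\<lambda>t. (deriv ^^ 2) (dlog f \<phi> \<theta> h z t) 0);
         S1 = (\<lambda>t. D t * d1 t);
         S2 = (\<lambda>t. D t * (d2 t + G t * (d1 t)\<^sup>2));
         S3 = (\<lambda>t. D t * d1 t * (\<Sum>s = 1..t - 1. G s * d1 s))
     in (\<forall>\<epsilon>. convergent (\<lambda>n. log_lik_ratio M \<sigma> f \<phi> \<theta> h z n \<epsilon>)) \<and>
        summable (\<lambda>n. S1 (int (Suc n))) \<and>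
        summable (\<lambda>n. S2 (int (Suc n))) \<and>
        summable (\<lambda>n. S3 (int (Suc n))) \<and>
        (r has_real_derivative (\<Sum>n. S1 (int (Suc n)))) (at 0) \<and>
        (\<forall>\<^sub>F \<epsilon> in nhds 0. r differentiable at \<epsilon>) \<and>
        (deriv r has_real_derivative
           (\<Sum>n. S2 (int (Suc n))) + 2 * (\<Sum>n. S3 (int (Suc n)))) (at 0))"
proof -
  interpret prob_space M by fact
  define q' where "q' t c = trans_prob M \<eta> (t - 1) t c 1" for t c
  interpret E: binary_markov M \<eta> q'
    using markov_chain_binary_markov[OF eta_rv markov] by (simp add: q'_def[abs_def])
  interpret S: binary_markov M \<sigma> q'
    by (rule E.equal_law_binary_markov(1)[OF sigma_rv sigma_copy])
  \<comment> \<open>A conditional probability given a null event is 0 by convention, so mixing rules out null states.\<close>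
  have eta_pos: "0 < prob {\<omega> \<in> space M. \<eta> t \<omega> = a}" if "a \<le> 1" for t a
  proof (rule ccontr)
    assume "\<not> ?thesis"
    then have "trans_prob M \<eta> t (t + int \<kappa>) a a = 0"
      by (simp add: trans_prob_def cond_prob_def zero_less_measure_iff)
    moreover have "a \<in> {0, 1}" using that by auto
    ultimately show False using mixing(2) mixing(3)[of a a t "t + int \<kappa>"] by simp
  qed
  have sigma_pos: "0 < prob {\<omega> \<in> space M. \<sigma> t \<omega> = a}" if "a \<le> 1" for t a
    using E.equal_law_binary_markov(2)[OF sigma_rv sigma_copy] eta_pos[OF that] by simp
  have mix: "\<phi>star \<le> E.lik (\<lambda>_ _. 1) (\<lambda>b'. of_bool (b' = b)) i \<kappa> c" if "b \<le> 1" "c \<le> 1" for i b c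
  proof -
    have "b \<in> {0, 1}" "c \<in> {0, 1}" using that by auto
    then show ?thesis
      using mixing(3)[of c b "int i" "int (i + \<kappa>)"] E.trans_prob_eq_lik[OF eta_pos[OF that(2)], of i \<kappa> b] by simp
  qed
  have rdens_pos: "0 < rdens f \<phi> \<theta> z a b \<epsilon>" if "a \<in> {0, 1}" "b \<in> {0, 1}" for z a b \<epsilon>
    using dens_pos[OF that, of z \<epsilon>] by (auto simp: rdens_def enn2real_positive_iff)
  have log_C: "joint_C q (\<lambda>z. logdens f \<phi> \<theta> z a b)" if "a \<in> {0, 1}" "b \<in> {0, 1}" for a b
  proof -
    have "joint_C q (\<lambda>z. rdens f \<phi> \<theta> z a b)"
      by (rule joint_C_of_higher_derivs) (use smooth smooth_joint that in auto)
    from joint_C_ln[OF this rdens_pos[OF that]] show ?thesis by (simp add: logdens_def[abs_def])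
  qed
  have q1: "1 \<le> q" using q by simp

  define D where "D \<omega> t = dlog f \<phi> \<theta> (\<lambda>t. \<eta> t \<omega>) (\<lambda>t. Z t \<omega>) (int t)" for \<omega> t
  define L where "L \<omega> t b = logdens f \<phi> \<theta> (Z (int t) \<omega>) (\<eta> (int t) \<omega>) b" for \<omega> t b
  have D_eq: "D \<omega> t = (\<lambda>x. L \<omega> t 1 x - L \<omega> t 0 x)" for \<omega> t
    by (simp add: fun_eq_iff D_def L_def dlog_def psi_def logdens_def)
  have eta01: "\<eta> t \<omega> \<in> {0, 1}" if "\<omega> \<in> space M" for t \<omega>
    using E.X_cases[OF that, of t] by auto
  have L_deriv: "(L \<omega> t b has_real_derivative deriv (L \<omega> t b) x) (at x)"
    "(deriv (L \<omega> t b) has_real_derivative deriv (deriv (L \<omega> t b)) x) (at x)"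
    "continuous_on UNIV (deriv (deriv (L \<omega> t b)))"
    if "\<omega> \<in> space M" "b \<in> {0, 1}" for \<omega> t b x
  proof -
    note C = log_C[OF eta01[OF that(1), of "int t"] that(2)]
    show "(L \<omega> t b has_real_derivative deriv (L \<omega> t b) x) (at x)"
      using joint_C_higher_deriv(2)[OF C, of 0] q by (simp add: L_def)
    show "(deriv (L \<omega> t b) has_real_derivative deriv (deriv (L \<omega> t b)) x) (at x)"
      using joint_C_higher_deriv(2)[OF C, of 1] q by (simp add: L_def)
    have "continuous_on UNIV (\<lambda>(z, x). (deriv ^^ 2) (logdens f \<phi> \<theta> z (\<eta> (int t) \<omega>) b) x)"
      by (rule joint_C_higher_deriv(1)[OF C q])
    from continuous_on_compose2[OF this, where s = UNIV and f = "\<lambda>x. (Z (int t) \<omega>, x)"]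
    show "continuous_on UNIV (deriv (deriv (L \<omega> t b)))"
      by (simp add: L_def numeral_2_eq_2 continuous_on_Pair)
  qed
  have D': "deriv (D \<omega> t) = (\<lambda>x. deriv (L \<omega> t 1) x - deriv (L \<omega> t 0) x)"
    and D'': "deriv (deriv (D \<omega> t)) = (\<lambda>x. deriv (deriv (L \<omega> t 1)) x - deriv (deriv (L \<omega> t 0)) x)"
    if "\<omega> \<in> space M" for \<omega> t
  proof -
    note L1 = L_deriv[OF that, of 1] and L0 = L_deriv[OF that, of 0]
    show *: "deriv (D \<omega> t) = (\<lambda>x. deriv (L \<omega> t 1) x - deriv (L \<omega> t 0) x)"
      unfolding D_eq by (rule ext, rule DERIV_imp_deriv, rule DERIV_diff) (use L1 L0 in auto)
    show "deriv (deriv (D \<omega> t)) = (\<lambda>x. deriv (deriv (L \<omega> t 1)) x - deriv (deriv (L \<omega> t 0)) x)"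
      unfolding * by (rule ext, rule DERIV_imp_deriv, rule DERIV_diff) (use L1 L0 in auto)
  qed
  have obs: "smooth_observations (\<lambda>t. q' (int t)) (D \<omega>) (\<lambda>t. deriv (D \<omega> t)) (\<lambda>t. deriv (deriv (D \<omega> t)))"
    if \<omega>: "\<omega> \<in> space M" for \<omega>
  proof unfold_locales
    note L1 = L_deriv[OF \<omega>, of 1] and L0 = L_deriv[OF \<omega>, of 0]
    fix t x
    show "(D \<omega> t has_real_derivative deriv (D \<omega> t) x) (at x)"
      unfolding D'[OF \<omega>] unfolding D_eq by (rule DERIV_diff) (use L1 L0 in auto)
    show "(deriv (D \<omega> t) has_real_derivative deriv (deriv (D \<omega> t)) x) (at x)"
      unfolding D''[OF \<omega>] unfolding D'[OF \<omega>] by (rule DERIV_diff) (use L1 L0 in auto)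
    show "continuous_on UNIV (deriv (deriv (D \<omega> t)))"
      unfolding D''[OF \<omega>] by (rule continuous_on_diff) (use L1 L0 in auto)
    show "D \<omega> t 0 = 0"
      using theta_zero by (simp add: D_eq L_def logdens_def rdens_def dens_def)
  qed

  define tame where "tame \<rho> \<omega> \<longleftrightarrow> (\<exists>B P :: nat \<Rightarrow> real. mono B \<and> (\<forall>t. 1 \<le> B t) \<and>
     (\<forall>t x. \<bar>x\<bar> \<le> \<rho> \<longrightarrow> \<bar>D \<omega> t x\<bar> \<le> B t) \<and> (\<forall>t x. \<bar>x\<bar> \<le> \<rho> \<longrightarrow> \<bar>deriv (D \<omega> t) x\<bar> \<le> B t) \<and>
     (\<forall>t x. \<bar>x\<bar> \<le> \<rho> \<longrightarrow> \<bar>deriv (deriv (D \<omega> t)) x\<bar> \<le> B t) \<and>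
     (\<forall>n s x. \<bar>x\<bar> \<le> \<rho> \<longrightarrow> 0 \<le> s \<longrightarrow> s \<le> 1 \<longrightarrow>
        \<bar>E.gain (\<lambda>t. smooth_observations.damp n s t * D \<omega> t x) 0 0 n\<bar> \<le> P n) \<and>
     summable (\<lambda>n. P n * (8 * real n ^ 4 * B n ^ 3)))" for \<rho> \<omega>
  have AE_tame: "AE \<omega> in M. tame \<rho> \<omega>" if \<rho>: "0 < \<rho>" for \<rho>
  proof -
    define W where "W t \<omega> = Msup f \<phi> \<theta> q (Z (int t) \<omega>) \<rho>" for t \<omega>
    note Msup_m[measurable] = Msup_measurable[OF log_C q1 less_imp_le[OF \<rho>]]
    note Z_rv[measurable]
    have W_rv: "random_variable borel (W t)" for t unfolding W_def[abs_def] by measurable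
    have ident: "distr M borel (W t) = distr M borel (W 0)" for t
    proof -
      have "distr M borel (W t) = distr (distr M borel (Z (int t))) borel (\<lambda>z. Msup f \<phi> \<theta> q z \<rho>)" for t
        unfolding W_def[abs_def] by (subst distr_distr) (auto simp: comp_def)
      then show ?thesis using Z_ident[of "int t" 0] by simp
    qed
    have ind: "indep_vars (\<lambda>_. borel) W UNIV"
    proof -
      have "indep_vars (\<lambda>_. borel) (\<lambda>t. Z (int t)) UNIV"
        by (rule indep_vars_reindex[where g = int]) (auto intro: indep_vars_subset[OF Z_indep])
      then show ?thesis
        unfolding W_def[abs_def] by (rule indep_vars_compose2) simp
    qed
    obtain c0 where c0: "c0 > 2"
      "(\<lambda>u. \<P>(\<omega> in M. Msup f \<phi> \<theta> q (Z 0 \<omega>) \<rho> \<ge> u)) \<in> O[at_top](\<lambda>u. (ln u) powr (- c0))"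
      using tail[OF \<rho>] by blast
    have growth: "AE \<omega> in M. \<forall>\<^sub>F t in sequentially. W t \<omega> < exp (\<gamma> * real t)"
      and tail0: "(\<lambda>t. \<P>(\<omega> in M. exp (\<gamma> * real t) \<le> W 0 \<omega>)) \<longlonglongrightarrow> 0" if "0 < \<gamma>" for \<gamma>
      using AE_eventually_less_exp[where W = W and c = c0 and \<gamma> = \<gamma>, OF W_rv ident _ _ that] c0
      by (auto simp: W_def)
    \<comment> \<open>A level below which the suprema stay with positive probability; it defines the good blocks.\<close>
    obtain K where K: "0 \<le> K" "0 < \<P>(\<omega> in M. W 0 \<omega> \<le> K)"
    proof -
      have "\<forall>\<^sub>F t in sequentially. \<P>(\<omega> in M. exp (1 * real t) \<le> W 0 \<omega>) < 1"
        using tail0[of 1] by (intro order_tendstoD(2)) auto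
      then obtain t where t: "\<P>(\<omega> in M. exp (real t) \<le> W 0 \<omega>) < 1" by (auto simp: eventually_sequentially)
      note W_rv[measurable]
      have "1 - prob {\<omega> \<in> space M. exp (real t) \<le> W 0 \<omega>} = prob (space M - {\<omega> \<in> space M. exp (real t) \<le> W 0 \<omega>})"
        by (subst prob_compl) auto
      also have "\<dots> \<le> prob {\<omega> \<in> space M. W 0 \<omega> \<le> exp (real t)}" by (rule finite_measure_mono) auto
      finally show ?thesis using t by (intro that[of "exp (real t)"]) auto
    qed
    \<comment> \<open>The contraction factor of a good block, raised to \<open>1/2\<close> if needed so that it is positive.\<close>
    define c where "c = max (1 / 2) (1 - (exp (- (2 * \<rho> * K)) ^ \<kappa> * \<phi>star)\<^sup>2 / (exp (2 * \<rho> * K) ^ \<kappa>)\<^sup>2)"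
    have "0 < (exp (- (2 * \<rho> * K)) ^ \<kappa> * \<phi>star)\<^sup>2 / (exp (2 * \<rho> * K) ^ \<kappa>)\<^sup>2"
      using mixing(2) by (intro divide_pos_pos zero_less_power) auto
    then have c: "0 < c" "c < 1" unfolding c_def by linarith+
    obtain lam where lam: "0 < lam" "lam < 1"
      "AE \<omega> in M. \<forall>\<^sub>F m in sequentially.
        (\<Prod>j<m. if \<forall>t. j * \<kappa> < t \<and> t \<le> j * \<kappa> + \<kappa> \<longrightarrow> W t \<omega> \<le> K then c else 1) \<le> lam ^ m"
      using AE_block_product_decay[where W = W, OF ind ident K(2) c] by blast
    have \<gamma>: "0 < - ln lam / (4 * real \<kappa>)"
      using lam mixing(1) by (auto intro!: divide_neg_pos)
    show ?thesis
      using lam(3) growth[OF \<gamma>] AE_space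
    proof eventually_elim
      case (elim \<omega>)
      note \<omega> = elim(3)
      interpret O: smooth_observations "\<lambda>t. q' (int t)" "D \<omega>" "\<lambda>t. deriv (D \<omega> t)" "\<lambda>t. deriv (deriv (D \<omega> t))"
        by (rule obs[OF \<omega>])
      have Lb: "\<bar>deriv (L \<omega> t b) x\<bar> \<le> W t \<omega>" "\<bar>deriv (deriv (L \<omega> t b)) x\<bar> \<le> W t \<omega>"
        if "\<bar>x\<bar> \<le> \<rho>" "b \<in> {0, 1}" for t b x
        using higher_deriv_le_Msup[OF log_C q1 less_imp_le[OF \<rho>] _ _ that(1) eta01[OF \<omega>, of "int t"] that(2), of 1 "Z (int t) \<omega>"]
          higher_deriv_le_Msup[OF log_C q1 less_imp_le[OF \<rho>] _ _ that(1) eta01[OF \<omega>, of "int t"] that(2), of 2 "Z (int t) \<omega>"] q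
        by (simp_all add: L_def W_def numeral_2_eq_2)
      show "tame \<rho> \<omega>"
        unfolding tame_def
      proof (rule O.tame_bounds[where W = "\<lambda>t. W t \<omega>" and K = K and c = c and lam = lam and \<rho> = \<rho> and \<kappa> = \<kappa> and \<phi> = \<phi>star])
        show "0 \<le> W t \<omega>" for t unfolding W_def by (rule Msup_nonneg[OF log_C q1 less_imp_le[OF \<rho>]])
        show "\<bar>deriv (D \<omega> t) x\<bar> \<le> 2 * W t \<omega>" if "\<bar>x\<bar> \<le> \<rho>" for t x
          using Lb(1)[OF that, of 1 t] Lb(1)[OF that, of 0 t] unfolding D'[OF \<omega>] by simp
        show "\<bar>deriv (deriv (D \<omega> t)) x\<bar> \<le> 2 * W t \<omega>" if "\<bar>x\<bar> \<le> \<rho>" for t x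
          using Lb(2)[OF that, of 1 t] Lb(2)[OF that, of 0 t] unfolding D''[OF \<omega>] by simp
        show "\<forall>\<^sub>F t in sequentially. W t \<omega> \<le> exp (- ln lam / (4 * real \<kappa>) * real t)"
          using elim(2) by eventually_elim simp
      next
        fix B P :: "nat \<Rightarrow> real"
        assume "mono B" "\<And>t. 1 \<le> B t"
          "\<And>t x. \<bar>x\<bar> \<le> \<rho> \<Longrightarrow> \<bar>D \<omega> t x\<bar> \<le> B t" "\<And>t x. \<bar>x\<bar> \<le> \<rho> \<Longrightarrow> \<bar>deriv (D \<omega> t) x\<bar> \<le> B t"
          "\<And>t x. \<bar>x\<bar> \<le> \<rho> \<Longrightarrow> \<bar>deriv (deriv (D \<omega> t)) x\<bar> \<le> B t"
          "\<And>n s x. \<bar>x\<bar> \<le> \<rho> \<Longrightarrow> 0 \<le> s \<Longrightarrow> s \<le> 1 \<Longrightarrow> \<bar>E.gain (\<lambda>t. O.damp n s t * D \<omega> t x) 0 0 n\<bar> \<le> P n"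
          "summable (\<lambda>n. P n * (8 * real n ^ 4 * B n ^ 3))"
        then show "\<exists>B P :: nat \<Rightarrow> real. mono B \<and> (\<forall>t. 1 \<le> B t) \<and>
           (\<forall>t x. \<bar>x\<bar> \<le> \<rho> \<longrightarrow> \<bar>D \<omega> t x\<bar> \<le> B t) \<and> (\<forall>t x. \<bar>x\<bar> \<le> \<rho> \<longrightarrow> \<bar>deriv (D \<omega> t) x\<bar> \<le> B t) \<and>
           (\<forall>t x. \<bar>x\<bar> \<le> \<rho> \<longrightarrow> \<bar>deriv (deriv (D \<omega> t)) x\<bar> \<le> B t) \<and>
           (\<forall>n s x. \<bar>x\<bar> \<le> \<rho> \<longrightarrow> 0 \<le> s \<longrightarrow> s \<le> 1 \<longrightarrow>
              \<bar>E.gain (\<lambda>t. O.damp n s t * D \<omega> t x) 0 0 n\<bar> \<le> P n) \<and>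
           summable (\<lambda>n. P n * (8 * real n ^ 4 * B n ^ 3))"
          by (intro exI[of _ B] exI[of _ P] conjI allI impI) simp_all
      qed (use \<rho> mixing K lam elim mix in \<open>auto simp: c_def\<close>)
    qed
  qed
  \<comment> \<open>The exceptional null set depends on the radius, so convergence for every parameter uses countably many radii.\<close>
  have "AE \<omega> in M. \<forall>N::nat. tame (real (Suc N)) \<omega>"
    unfolding AE_all_countable by (intro allI AE_tame) simp
  then show ?thesis
    using AE_space
  proof eventually_elim
    case (elim \<omega>)
    note \<omega> = elim(2)
    interpret O: smooth_observations "\<lambda>t. q' (int t)" "D \<omega>" "\<lambda>t. deriv (D \<omega> t)" "\<lambda>t. deriv (deriv (D \<omega> t))"
      by (rule obs[OF \<omega>])
    let ?h = "\<lambda>t. \<eta> t \<omega>" and ?z = "\<lambda>t. Z t \<omega>"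
    have lr: "log_lik_ratio M \<sigma> f \<phi> \<theta> ?h ?z n x = E.traj (\<lambda>t. D \<omega> t x) 0 0 n" for n x
    proof -
      define w where "w t b = psi f \<phi> \<theta> ?h ?z (int t) x b" for t b
      have w_pos: "0 < w t b" if "b \<le> 1" for t b
      proof -
        have "b \<in> {0, 1}" using that by auto
        then show ?thesis using rdens_pos[OF eta01[OF \<omega>]] by (simp add: w_def psi_def)
      qed
      have cl: "cond_lik M \<sigma> f \<phi> \<theta> ?h ?z n x c = E.lik w (\<lambda>_. 1) 0 n c" if "c \<le> 1" for c
      proof -
        have "(\<Prod>s = 1..int n. psi f \<phi> \<theta> ?h ?z s x (\<sigma> s \<omega>')) = (\<Prod>t = 1..n. w t (\<sigma> (int t) \<omega>'))" for \<omega>'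
          unfolding w_def by (rule prod.reindex_bij_witness[of _ int nat]) auto
        then show ?thesis
          unfolding cond_lik_def using S.integral_uniform_measure_eq_lik[OF sigma_pos[OF that], of w n] by simp
      qed
      have wr: "w t b = w t 0 * exp (D \<omega> t x * real b)" if "b \<le> 1" for t b
      proof -
        have "exp (D \<omega> t x) = w t 1 / w t 0"
          using w_pos[of 0 t] w_pos[of 1 t] by (simp add: D_def dlog_def w_def exp_diff)
        then show ?thesis using w_pos[of 0 t] that by (cases b) auto
      qed
      have scale: "E.lik w (\<lambda>_. 1) 0 n c =
          (\<Prod>t = Suc 0..n. w t 0) * E.lik (\<lambda>t b. exp (D \<omega> t x * real b)) (\<lambda>_. 1) 0 n c" for c
        using E.lik_scale[where r = "\<lambda>t. w t 0" and i = 0 and k = n and v = "\<lambda>_. 1" and c = c, OF wr]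
        by (simp only: add_0)
      define R where "R = (\<Prod>t = Suc 0..n. w t 0)"
      define l where "l c = E.lik (\<lambda>t b. exp (D \<omega> t x * real b)) (\<lambda>_. 1) 0 n c" for c
      have R: "0 < R" unfolding R_def by (intro prod_pos) (simp add: w_pos)
      have l: "0 < l c" for c unfolding l_def by (rule E.lik_pos) auto
      have "cond_lik M \<sigma> f \<phi> \<theta> ?h ?z n x c = R * l c" if "c \<le> 1" for c
        unfolding cl[OF that] scale R_def l_def ..
      then have "log_lik_ratio M \<sigma> f \<phi> \<theta> ?h ?z n x = ln (l 1 / l 0)"
        using R by (simp add: log_lik_ratio_def)
      also have "\<dots> = ln (l 1) - ln (l 0)" using l[of 0] l[of 1] by (simp add: ln_div)
      also have "\<dots> = E.traj (\<lambda>t. D \<omega> t x) 0 0 n"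
        unfolding E.traj_eq_ln_lik l_def by simp
      finally show ?thesis .
    qed
    have r_eq: "r_lim M \<sigma> f \<phi> \<theta> ?h ?z = (\<lambda>x. lim (\<lambda>n. E.traj (\<lambda>t. D \<omega> t x) 0 0 n))"
      by (simp add: r_lim_def lr fun_eq_iff)
    have tp: "trans_prob M \<eta> 0 (int t) c b = E.lik (\<lambda>_ _. 1) (\<lambda>b'. of_bool (b' = b)) 0 t c" if "c \<le> 1" for t c b
      using E.trans_prob_eq_lik[OF eta_pos[OF that], of 0 t b] by simp
    have D_memory: "trans_diff M \<eta> 0 (int t) = E.memory 0 t" for t
      by (simp add: trans_diff_def tp E.memory_def E.hit_def)
    have G_skew: "trans_prob M \<eta> 0 (int t) 1 0 - trans_prob M \<eta> 0 (int t) 0 1 = E.skew 0 t" for t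
      using E.hit_complement[of 1 0 t] by (simp add: tp E.skew_def E.hit_def)
    have sum_eq: "(\<Sum>s = 1..int (Suc n) - 1. (trans_prob M \<eta> 0 s 1 0 - trans_prob M \<eta> 0 s 0 1) *
        deriv (dlog f \<phi> \<theta> ?h ?z s) 0) = (\<Sum>j<n. E.skew 0 (Suc j) * deriv (D \<omega> (Suc j)) 0)" for n
      unfolding D_def G_skew[symmetric]
      by (rule sum.reindex_bij_witness[of _ "\<lambda>j. int (Suc j)" "\<lambda>s. nat (s - 1)"]) (auto simp: nat_diff_distrib)
    have lim: "\<And>x. \<bar>x\<bar> < \<rho> \<Longrightarrow> convergent (\<lambda>n. E.traj (\<lambda>t. D \<omega> t x) 0 0 n)"
      "summable (\<lambda>n. E.memory 0 (Suc n) * deriv (D \<omega> (Suc n)) 0)"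
      "summable (\<lambda>n. E.memory 0 (Suc n) * (deriv (deriv (D \<omega> (Suc n))) 0 + E.skew 0 (Suc n) * (deriv (D \<omega> (Suc n)) 0)\<^sup>2))"
      "summable (\<lambda>n. E.memory 0 (Suc n) * deriv (D \<omega> (Suc n)) 0 * (\<Sum>j<Suc n - 1. E.skew 0 (Suc j) * deriv (D \<omega> (Suc j)) 0))"
      "(r_lim M \<sigma> f \<phi> \<theta> ?h ?z has_real_derivative (\<Sum>n. E.memory 0 (Suc n) * deriv (D \<omega> (Suc n)) 0)) (at 0)"
      "\<forall>\<^sub>F x in nhds 0. r_lim M \<sigma> f \<phi> \<theta> ?h ?z differentiable at x"
      "(deriv (r_lim M \<sigma> f \<phi> \<theta> ?h ?z) has_real_derivative
        (\<Sum>n. E.memory 0 (Suc n) * (deriv (deriv (D \<omega> (Suc n))) 0 + E.skew 0 (Suc n) * (deriv (D \<omega> (Suc n)) 0)\<^sup>2)) +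
        2 * (\<Sum>n. E.memory 0 (Suc n) * deriv (D \<omega> (Suc n)) 0 * (\<Sum>j<Suc n - 1. E.skew 0 (Suc j) * deriv (D \<omega> (Suc j)) 0))) (at 0)"
      if tame: "tame \<rho> \<omega>" and \<rho>: "0 < \<rho>" for \<rho>
    proof -
      obtain B P :: "nat \<Rightarrow> real" where BP: "mono B" "\<And>t. 1 \<le> B t"
          "\<And>t x. \<bar>x\<bar> \<le> \<rho> \<Longrightarrow> \<bar>D \<omega> t x\<bar> \<le> B t" "\<And>t x. \<bar>x\<bar> \<le> \<rho> \<Longrightarrow> \<bar>deriv (D \<omega> t) x\<bar> \<le> B t"
          "\<And>t x. \<bar>x\<bar> \<le> \<rho> \<Longrightarrow> \<bar>deriv (deriv (D \<omega> t)) x\<bar> \<le> B t"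
          "\<And>n s x. \<bar>x\<bar> \<le> \<rho> \<Longrightarrow> 0 \<le> s \<Longrightarrow> s \<le> 1 \<Longrightarrow> \<bar>E.gain (\<lambda>t. O.damp n s t * D \<omega> t x) 0 0 n\<bar> \<le> P n"
          "summable (\<lambda>n. P n * (8 * real n ^ 4 * B n ^ 3))"
        using tame unfolding tame_def by (elim exE conjE) (rule that; simp)
      note T = O.limit_derivatives[OF \<rho> BP]
      show "\<And>x. \<bar>x\<bar> < \<rho> \<Longrightarrow> convergent (\<lambda>n. E.traj (\<lambda>t. D \<omega> t x) 0 0 n)" by (rule T(1))
      show "summable (\<lambda>n. E.memory 0 (Suc n) * deriv (D \<omega> (Suc n)) 0)" by (rule T(2))
      show "summable (\<lambda>n. E.memory 0 (Suc n) * (deriv (deriv (D \<omega> (Suc n))) 0 + E.skew 0 (Suc n) * (deriv (D \<omega> (Suc n)) 0)\<^sup>2))"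
        by (rule T(3))
      show "summable (\<lambda>n. E.memory 0 (Suc n) * deriv (D \<omega> (Suc n)) 0 * (\<Sum>j<Suc n - 1. E.skew 0 (Suc j) * deriv (D \<omega> (Suc j)) 0))"
        by (rule T(4))
      show "(r_lim M \<sigma> f \<phi> \<theta> ?h ?z has_real_derivative (\<Sum>n. E.memory 0 (Suc n) * deriv (D \<omega> (Suc n)) 0)) (at 0)"
        unfolding r_eq by (rule T(5))
      show "\<forall>\<^sub>F x in nhds 0. r_lim M \<sigma> f \<phi> \<theta> ?h ?z differentiable at x"
        unfolding r_eq by (rule T(6))
      show "(deriv (r_lim M \<sigma> f \<phi> \<theta> ?h ?z) has_real_derivative
        (\<Sum>n. E.memory 0 (Suc n) * (deriv (deriv (D \<omega> (Suc n))) 0 + E.skew 0 (Suc n) * (deriv (D \<omega> (Suc n)) 0)\<^sup>2)) +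
        2 * (\<Sum>n. E.memory 0 (Suc n) * deriv (D \<omega> (Suc n)) 0 * (\<Sum>j<Suc n - 1. E.skew 0 (Suc j) * deriv (D \<omega> (Suc j)) 0))) (at 0)"
        unfolding r_eq by (rule T(7))
    qed
    have conv: "convergent (\<lambda>n. log_lik_ratio M \<sigma> f \<phi> \<theta> ?h ?z n x)" for x
    proof -
      obtain N where "\<bar>x\<bar> < real (Suc N)" using reals_Archimedean2[of "\<bar>x\<bar>"] by (metis of_nat_Suc add.commute less_add_one order_less_trans)
      then show ?thesis unfolding lr using lim(1)[of "real (Suc N)" x] elim(1) by simp
    qed
    have tame1: "tame 1 \<omega>" using elim(1)[rule_format, of 0] by simp
    have d1: "deriv (dlog f \<phi> \<theta> ?h ?z (int (Suc n))) 0 = deriv (D \<omega> (Suc n)) 0"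
      and d2: "(deriv ^^ 2) (dlog f \<phi> \<theta> ?h ?z (int (Suc n))) 0 = deriv (deriv (D \<omega> (Suc n))) 0" for n
      by (simp_all add: D_def numeral_2_eq_2)
    show ?case
      unfolding Let_def sum_eq d1 d2 D_memory G_skew
      using conv lim(2-7)[OF tame1 zero_less_one] by (simp only: diff_Suc_1 simp_thms)
  qed
qed

end
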